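(* Let $(M,g,\mathcal{F},J)$ be a transversely almost Hermitian foliated manifold which is transversely cosymplectic, and let $(N,\mathcal{F}')$ be a foliated Riemannian manifold with normal twistor bundle $W'=Z(N,\mathcal{F}')$, equipped with its lifted foliation $\mathcal{F}'_Z$ and with the projection $\pi:W'\to N$. If $\psi:(M,\mathcal{F})\to (W',\mathcal{F}'_Z)$ is transversely $J^-$-holomorphic, then $\pi\circ\psi:(M,\mathcal{F})\to(N,\mathcal{F}')$ is transversely harmonic.
   Context: A foliated Riemannian manifold $(M,g,\mathcal{F})$ is a manifold with a Riemannian foliation $\mathcal{F}$ and a bundle-like metric $g$; equivalently, $\mathcal{F}$ is given by local submersions with connected fibres $f_i:U_i\to T$ onto open subsets of a Riemannian manifold $(T,\bar g)$ (the transverse model) with transition maps $k_{ij}$, $f_i=k_{ij}f_j$, which are local isometries, and the $f_i$ are Riemannian submersions. $Q=TM/T\mathcal{F}$ is the normal bundle, $g_Q$ the induced metric on it (locally $f_i^*\bar g$), and $\nabla$ the normal Levi-Civita connection on $Q$ (locally the pull-back by $f_i$ of the Levi-Civita connection of $\bar g$). A map is foliated if it is smooth and maps leaves into leaves. A tensor on $Q$ is foliated if locally it is the pull-back by $f_i$ of a tensor on $T$. Transversely almost Hermitian: $Q$ carries a foliated $J$ with $J^2=-\mathrm{Id}$, $g_Q(JX,JY)=g_Q(X,Y)$. The complexification splits as $Q^{\mathbb{C}}=Q^{1,0}\oplus Q^{0,1}$ ($\pm i$ eigenbundles of $J$), and $Q^{2,0}=\bigwedge^2Q^{1,0}$, $Q^{0,2}=\bigwedge^2Q^{0,1}$.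 The fundamental 2-vector $F\in\Gamma(\bigwedge^2Q)$ is defined by $g_Q(F,X\wedge Y)=g_Q(JX,Y)$. Identifying $Q^*$ with $Q$ by $g_Q$, the derivative of $F$ in normal directions is a section $\nabla F$ of $(Q\otimes\bigwedge^2 Q)^{\mathbb C}$ and decomposes as $\nabla F=D_1F+D_2F$ with $D_1F\in (Q^{1,0}\otimes Q^{2,0})\oplus(Q^{0,1}\otimes Q^{0,2})$ and $D_2F\in(Q^{1,0}\otimes Q^{0,2})\oplus(Q^{0,1}\otimes Q^{2,0})$. The foliation is transversely cosymplectic if $\mathrm{tr}(D_2F)=0$, where $\mathrm{tr}$ is the $g_Q$-contraction of the derivative slot with the 2-vector, with values in $Q^{\mathbb C}$. Normal twistor bundle: let $Q'=TN/T\mathcal{F}'$, with $\mathcal F'$ of even codimension. $W'=Z(N,\mathcal{F}')$ has fibre over $y\in N$ the set of $P:Q'_y\to Q'_y$ with $P^2=-\mathrm{id}$ and $g_{Q'}(P\cdot,P\cdot)=g_{Q'}$. If $\mathcal{F}'$ is given by submersions $f_i:U_i\to T$, then $W'|_{U_i}\cong f_i^*Z(T)$, where $Z(T)$ is the bundle of orthogonal almost complex structures on $TT$, and the induced submersions $W'|_{U_i}\to Z(T)$ define the lifted foliation $\mathcal{F}'_Z$, of the same dimension as $\mathcal{F}'$. The normal Levi-Civita connection of $\mathcal F'$ gives a splitting $TW'=H\oplus V$ with $V=\ker d\pi$, $T\mathcal{F}'_Z$ is the horizontal lift of $T\mathcal{F}'$, and so the normal bundle $Q(W')=TW'/T\mathcal{F}'_Z$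 is isomorphic to $\pi^{-1}Q'\oplus V$. At $P\in W'$, $V_P=\{A\in\mathfrak{so}(Q'_{\pi(P)}):AP+PA=0\}$. The transverse almost complex structure $J^-$ on $Q(W')$ equals $P$ on $(\pi^{-1}Q')_P=Q'_{\pi(P)}$ and $A\mapsto -P\circ A$ on $V_P$. A foliated map $\phi$ between foliated manifolds with transverse almost complex structures is transversely holomorphic if $\phi^T_*\circ J=J'\circ\phi^T_*$, where $\phi^T_*:Q\to\phi^{-1}Q'$ is the map induced by the differential on normal bundles; transversely $J^-$-holomorphic means this with $J^-$ on the target. The transverse tension field of a foliated map $\phi$ is $\tau_b(\phi)=\mathrm{tr}_Q\tilde\nabla\phi^T_*$, where $\tilde\nabla$ is the connection on $Q^*\otimes\phi^{-1}Q'$ induced by the normal Levi-Civita connections and the trace is taken over a local $g_Q$-orthonormal frame of $Q$; $\phi$ is transversely harmonic if $\tau_b(\phi)=0$. *)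

theory Defs
  imports "HOL-Analysis.Analysis"
begin

section \<open>Smooth manifolds\<close>

text \<open>\<open>k\<close> times continuously differentiable functions, and smooth functions, on a set \<open>S\<close> that is
  always open below.\<close>

primrec Ck_on :: "nat \<Rightarrow> 'a::euclidean_space set \<Rightarrow> ('a \<Rightarrow> 'b::real_normed_vector) \<Rightarrow> bool" where
  "Ck_on 0 = (\<lambda>S f. continuous_on S f)"
| "Ck_on (Suc k) = (\<lambda>S f. (\<forall>x\<in>S. f differentiable (at x)) \<and>
      (\<forall>v. Ck_on k S (\<lambda>x. frechet_derivative f (at x) v)))"

definition smooth_on :: "'a::euclidean_space set \<Rightarrow> ('a \<Rightarrow> 'b::real_normed_vector) \<Rightarrow> bool" where
  "smooth_on S f \<longleftrightarrow> (\<forall>k. Ck_on k S f)"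

type_synonym ('a, 'e) chart = "'a set \<times> ('a \<Rightarrow> 'e)"

text \<open>A manifold comes with a preferred chart \<open>chart_at M p\<close> around every point \<open>p\<close>.  The tangent
  space \<open>T\<^sub>pM\<close> is realised as the model space \<open>'e\<close>, a vector being represented by its
  coordinates in \<open>chart_at M p\<close>; so elements of the type \<open>'e\<close> that represent tangent vectors at
  different points must not be compared directly.\<close>

record ('a, 'e) mfd =
  mtop :: "'a topology"
  atlas :: "('a, 'e) chart set"
  chart_at :: "'a \<Rightarrow> ('a, 'e) chart"

abbreviation carrier_of :: "('a, 'e) mfd \<Rightarrow> 'a set" where
  "carrier_of M \<equiv> topspace (mtop M)"

definition chart_inv :: "('a, 'e) chart \<Rightarrow> 'e \<Rightarrow> 'a" where
  "chart_inv C = inv_into (fst C) (snd C)"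

definition smooth_manifold :: "('a, 'e::euclidean_space) mfd \<Rightarrow> bool" where
  "smooth_manifold M \<longleftrightarrow>
     Hausdorff_space (mtop M) \<and> second_countable (mtop M) \<and>
     (\<forall>(U, c)\<in>atlas M. openin (mtop M) U \<and> open (c ` U) \<and>
        homeomorphic_map (subtopology (mtop M) U) (top_of_set (c ` U)) c) \<and>
     (\<forall>(U, c)\<in>atlas M. \<forall>(V, d)\<in>atlas M. smooth_on (c ` (U \<inter> V)) (d \<circ> chart_inv (U, c))) \<and>
     (\<forall>p\<in>carrier_of M. chart_at M p \<in> atlas M \<and> p \<in> fst (chart_at M p))"

text \<open>Smoothness on an open subset \<open>S\<close> of \<open>M\<close>.\<close>

definition smooth_map_on ::
  "'a set \<Rightarrow> ('a, 'e::euclidean_space) mfd \<Rightarrow> ('b, 'f::euclidean_space) mfd \<Rightarrow> ('a \<Rightarrow> 'b) \<Rightarrow> bool" where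
  "smooth_map_on S M N \<phi> \<longleftrightarrow>
     continuous_map (subtopology (mtop M) S) (mtop N) \<phi> \<and>
     (\<forall>(U, c)\<in>atlas M. \<forall>(V, d)\<in>atlas N.
        smooth_on (c ` {p \<in> S \<inter> U. \<phi> p \<in> V}) (d \<circ> \<phi> \<circ> chart_inv (U, c)))"

definition dir_deriv ::
  "('a, 'e::euclidean_space) mfd \<Rightarrow> 'a \<Rightarrow> ('a \<Rightarrow> 'v::real_normed_vector) \<Rightarrow> 'e \<Rightarrow> 'v" where
  "dir_deriv M p h =
     frechet_derivative (h \<circ> chart_inv (chart_at M p)) (at (snd (chart_at M p) p))"

text \<open>The differential \<open>T\<^sub>pM \<rightarrow> T\<^bsub>\<phi>(p)\<^esub>N\<close>.\<close>

definition mderiv ::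
  "('a, 'e::euclidean_space) mfd \<Rightarrow> ('b, 'f::euclidean_space) mfd \<Rightarrow> ('a \<Rightarrow> 'b) \<Rightarrow> 'a \<Rightarrow> 'e \<Rightarrow> 'f" where
  "mderiv M N \<phi> p = dir_deriv M p (snd (chart_at N (\<phi> p)) \<circ> \<phi>)"

text \<open>Passage between \<open>T\<^sub>pM\<close> and the coordinates in an arbitrary chart around \<open>p\<close>.\<close>

definition to_coord :: "('a, 'e::euclidean_space) mfd \<Rightarrow> ('a, 'e) chart \<Rightarrow> 'a \<Rightarrow> 'e \<Rightarrow> 'e" where
  "to_coord M C p = dir_deriv M p (snd C)"

definition from_coord :: "('a, 'e::euclidean_space) mfd \<Rightarrow> ('a, 'e) chart \<Rightarrow> 'a \<Rightarrow> 'e \<Rightarrow> 'e" where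
  "from_coord M C p =
     frechet_derivative (snd (chart_at M p) \<circ> chart_inv C) (at (snd C p))"


section \<open>Riemannian manifolds\<close>

text \<open>\<open>g p\<close> is the inner product on \<open>T\<^sub>pM\<close>.\<close>

type_synonym ('a, 'e) metric = "'a \<Rightarrow> 'e \<Rightarrow> 'e \<Rightarrow> real"

definition metric_in_chart ::
  "('a, 'e::euclidean_space) mfd \<Rightarrow> ('a, 'e) metric \<Rightarrow> ('a, 'e) chart \<Rightarrow> 'e \<Rightarrow> 'e \<Rightarrow> 'e \<Rightarrow> real" where
  "metric_in_chart M g C x u v =
     (let p = chart_inv C x in g p (from_coord M C p u) (from_coord M C p v))"

definition riemannian_manifold :: "('a, 'e::euclidean_space) mfd \<Rightarrow> ('a, 'e) metric \<Rightarrow> bool" where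
  "riemannian_manifold M g \<longleftrightarrow>
     smooth_manifold M \<and>
     (\<forall>p\<in>carrier_of M. bilinear (g p) \<and> (\<forall>u v. g p u v = g p v u) \<and> (\<forall>u. u \<noteq> 0 \<longrightarrow> g p u u > 0)) \<and>
     (\<forall>(U, c)\<in>atlas M. \<forall>u v. smooth_on (c ` U) (\<lambda>x. metric_in_chart M g (U, c) x u v))"

text \<open>The Christoffel symbols \<open>\<Gamma>(u, v) = \<nabla>\<^sub>u v\<close> (\<open>u\<close>, \<open>v\<close> constant in the chart \<open>C\<close>) of the
  Levi-Civita connection, given by the Koszul formula for coordinate vector fields.\<close>

definition christoffel ::
  "('a, 'e::euclidean_space) mfd \<Rightarrow> ('a, 'e) metric \<Rightarrow> ('a, 'e) chart \<Rightarrow> 'e \<Rightarrow> 'e \<Rightarrow> 'e \<Rightarrow> 'e" where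
  "christoffel M g C x u v =
     (let G = metric_in_chart M g C;
          dG = (\<lambda>a b d. frechet_derivative (\<lambda>y. G y b d) (at x) a)
      in THE z. \<forall>w. G x z w = (dG u v w + dG v u w - dG w u v) / 2)"


section \<open>Foliated Riemannian manifolds\<close>

text \<open>A foliation given by local submersions \<open>fol_map F i : fol_dom F i \<rightarrow> fol_model F\<close> onto open
  subsets of the transverse model.  \<open>fol_at F p\<close> is the index of a preferred submersion around
  \<open>p\<close>, used only to realise the normal bundle, see \<open>nproj\<close>.\<close>

record ('i, 'a, 't, 'q::finite) foliation =
  fol_index :: "'i set"
  fol_dom :: "'i \<Rightarrow> 'a set"
  fol_map :: "'i \<Rightarrow> 'a \<Rightarrow> 't"
  fol_model :: "('t, real^'q) mfd"
  fol_metric :: "('t, real^'q) metric"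
  fol_at :: "'a \<Rightarrow> 'i"

definition foliated_riemannian ::
  "('a, 'e::euclidean_space) mfd \<Rightarrow> ('a, 'e) metric \<Rightarrow> ('i, 'a, 't, 'q::finite) foliation \<Rightarrow> bool" where
  "foliated_riemannian M g F \<longleftrightarrow>
     (let T = fol_model F; h = fol_metric F; I = fol_index F; U = fol_dom F; f = fol_map F;
          D = (\<lambda>i. mderiv M T (f i))
      in riemannian_manifold M g \<and> riemannian_manifold T h \<and>
         (\<forall>i\<in>I. openin (mtop M) (U i)) \<and> (\<Union>i\<in>I. U i) = carrier_of M \<and>
         (\<forall>p\<in>carrier_of M. fol_at F p \<in> I \<and> p \<in> U (fol_at F p)) \<and>
         (\<forall>i\<in>I. smooth_map_on (U i) M T (f i) \<and> openin (mtop T) (f i ` U i) \<and>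
            (\<forall>p\<in>U i. surj (D i p)) \<and>
            (\<forall>t. connectedin (mtop M) {p \<in> U i. f i p = t})) \<and>
         (\<forall>i\<in>I. \<forall>p\<in>U i. \<forall>u v.
            (\<forall>k. D i p k = 0 \<longrightarrow> g p u k = 0 \<and> g p v k = 0) \<longrightarrow>
            h (f i p) (D i p u) (D i p v) = g p u v) \<and>
         (\<forall>i\<in>I. \<forall>j\<in>I. \<exists>k.
            (\<forall>p\<in>U i \<inter> U j. f i p = k (f j p)) \<and>
            smooth_map_on (f j ` (U i \<inter> U j)) T T k \<and>
            (\<forall>t\<in>f j ` (U i \<inter> U j). \<forall>u v.
               h (k t) (mderiv T T k t u) (mderiv T T k t v) = h t u v)))"

text \<open>The fibres of the local submersions, being connected, are the plaques; the leaves are the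
  classes of the equivalence relation generated by lying on a common plaque.\<close>

definition plaque_chain :: "'i set \<Rightarrow> ('i \<Rightarrow> 'a set) \<Rightarrow> ('i \<Rightarrow> 'a \<Rightarrow> 't) \<Rightarrow> 'a \<Rightarrow> 'a \<Rightarrow> bool" where
  "plaque_chain I U f = (\<lambda>p q. \<exists>i\<in>I. p \<in> U i \<and> q \<in> U i \<and> f i p = f i q)\<^sup>*\<^sup>*"

definition same_leaf :: "('i, 'a, 't, 'q::finite) foliation \<Rightarrow> 'a \<Rightarrow> 'a \<Rightarrow> bool" where
  "same_leaf F = plaque_chain (fol_index F) (fol_dom F) (fol_map F)"

definition foliated_map ::
  "('a, 'e::euclidean_space) mfd \<Rightarrow> ('i, 'a, 't, 'q::finite) foliation \<Rightarrow>
   ('b, 'f::euclidean_space) mfd \<Rightarrow> ('j, 'b, 's, 'r::finite) foliation \<Rightarrow> ('a \<Rightarrow> 'b) \<Rightarrow> bool" where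
  "foliated_map M F N F' \<phi> \<longleftrightarrow>
     smooth_map_on (carrier_of M) M N \<phi> \<and>
     (\<forall>p\<in>carrier_of M. \<forall>q\<in>carrier_of M. same_leaf F p q \<longrightarrow> same_leaf F' (\<phi> p) (\<phi> q))"


section \<open>The normal bundle and its Levi-Civita connection\<close>

text \<open>The differential \<open>df\<^sub>i : T\<^sub>pM \<rightarrow> T\<^bsub>f\<^sub>i(p)\<^esub>T\<close> is onto with kernel \<open>T\<^sub>p\<F>\<close>, so that it is a
  quotient map for \<open>Q\<^sub>p = T\<^sub>pM / T\<^sub>p\<F>\<close>.  Taking for \<open>i\<close> the preferred index at \<open>p\<close>, the space
  \<open>Q\<^sub>p\<close> is realised as \<open>T\<^bsub>f\<^sub>i(p)\<^esub>T\<close>, that is \<open>real^'q\<close>.\<close>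

definition nproj ::
  "('a, 'e::euclidean_space) mfd \<Rightarrow> ('i, 'a, 't, 'q::finite) foliation \<Rightarrow> 'a \<Rightarrow> 'e \<Rightarrow> real^'q" where
  "nproj M F p = mderiv M (fol_model F) (fol_map F (fol_at F p)) p"

text \<open>The metric \<open>g\<^sub>Q\<close>, locally \<open>f\<^sub>i\<^sup>* gbar\<close>.\<close>

definition nmetric :: "('i, 'a, 't, 'q::finite) foliation \<Rightarrow> 'a \<Rightarrow> real^'q \<Rightarrow> real^'q \<Rightarrow> real" where
  "nmetric F p = fol_metric F (fol_map F (fol_at F p) p)"

text \<open>The map induced by \<open>L\<close> on the quotient with quotient map \<open>q\<close>.\<close>

definition on_quotient :: "('e \<Rightarrow> 'v) \<Rightarrow> ('e \<Rightarrow> 'w) \<Rightarrow> 'v \<Rightarrow> 'w" where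
  "on_quotient q L u = (THE w. \<forall>X. q X = u \<longrightarrow> L X = w)"

text \<open>The identification \<open>Q\<^sub>y \<cong> T\<^bsub>f\<^sub>i(y)\<^esub>T\<close> induced by \<open>df\<^sub>i\<close>, for any \<open>i\<close> with \<open>y \<in> U\<^sub>i\<close>.\<close>

definition ntriv ::
  "('a, 'e::euclidean_space) mfd \<Rightarrow> ('i, 'a, 't, 'q::finite) foliation \<Rightarrow> 'i \<Rightarrow> 'a \<Rightarrow> real^'q \<Rightarrow> real^'q"
  where
  "ntriv M F i y = on_quotient (nproj M F y) (mderiv M (fol_model F) (fol_map F i) y)"

text \<open>Matrix of the trivialisation of \<open>Q\<close> given by the submersion \<open>i\<close> and the chart \<open>C\<close> of the
  transverse model: it takes \<open>u \<in> Q\<^sub>y\<close> to the coordinates of \<open>df\<^sub>i(u)\<close> in \<open>C\<close>.\<close>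

definition nframe ::
  "('a, 'e::euclidean_space) mfd \<Rightarrow> ('i, 'a, 't, 'q::finite) foliation \<Rightarrow> 'i \<Rightarrow> ('t, real^'q) chart \<Rightarrow>
   'a \<Rightarrow> real^'q^'q" where
  "nframe M F i C y = matrix (to_coord (fol_model F) C (fol_map F i y) \<circ> ntriv M F i y)"

text \<open>The same for the preferred submersion and chart at \<open>p\<close>; it is the identity at \<open>y = p\<close>.\<close>

definition nframe_at ::
  "('a, 'e::euclidean_space) mfd \<Rightarrow> ('i, 'a, 't, 'q::finite) foliation \<Rightarrow> 'a \<Rightarrow> 'a \<Rightarrow> real^'q^'q" where
  "nframe_at M F p =
     nframe M F (fol_at F p) (chart_at (fol_model F) (fol_map F (fol_at F p) p))"

text \<open>The normal Levi-Civita connection, the pull-back by \<open>f\<^sub>i\<close> of the Levi-Civita connection of the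
  transverse model: \<open>nconn M F p X\<close> is the value at \<open>X \<in> T\<^sub>pM\<close> of its connection matrix in the
  frame \<open>nframe_at M F p\<close>, so that \<open>(\<nabla>\<^sub>X s)(p) = X(R s) + nconn M F p X *v s(p)\<close> with
  \<open>R = nframe_at M F p\<close>.\<close>

definition nconn ::
  "('a, 'e::euclidean_space) mfd \<Rightarrow> ('i, 'a, 't, 'q::finite) foliation \<Rightarrow> 'a \<Rightarrow> 'e \<Rightarrow> real^'q^'q" where
  "nconn M F p X =
     (let T = fol_model F; t = fol_map F (fol_at F p) p; C = chart_at T t
      in matrix (christoffel T (fol_metric F) C (snd C t) (nproj M F p X)))"

text \<open>The lift of \<open>u \<in> Q\<^sub>p\<close> to the \<open>g\<close>-orthogonal complement of \<open>T\<^sub>p\<F>\<close>.\<close>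

definition nlift ::
  "('a, 'e::euclidean_space) mfd \<Rightarrow> ('a, 'e) metric \<Rightarrow> ('i, 'a, 't, 'q::finite) foliation \<Rightarrow>
   'a \<Rightarrow> real^'q \<Rightarrow> 'e" where
  "nlift M g F p u =
     (THE X. nproj M F p X = u \<and> (\<forall>Y. nproj M F p Y = 0 \<longrightarrow> g p X Y = 0))"

text \<open>A section of \<open>End(Q)\<close> is given by its matrices \<open>J p\<close> on \<open>Q\<^sub>p\<close>.  It is foliated if locally it
  is the pull-back of a smooth endomorphism field on an open subset of the transverse model.\<close>

definition smooth_endo_on ::
  "'t set \<Rightarrow> ('t, real^'q::finite) mfd \<Rightarrow> ('t \<Rightarrow> real^'q^'q) \<Rightarrow> bool" where
  "smooth_endo_on S T A \<longleftrightarrow>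
     (\<forall>(V, d)\<in>atlas T. smooth_on (d ` (V \<inter> S))
        (\<lambda>x. let t = chart_inv (V, d) x; R = matrix (to_coord T (V, d) t)
             in R ** A t ** matrix_inv R))"

definition foliated_endo ::
  "('a, 'e::euclidean_space) mfd \<Rightarrow> ('i, 'a, 't, 'q::finite) foliation \<Rightarrow> ('a \<Rightarrow> real^'q^'q) \<Rightarrow> bool"
  where
  "foliated_endo M F J \<longleftrightarrow>
     (\<forall>i\<in>fol_index F. \<forall>p\<in>fol_dom F i. \<exists>U A.
        openin (mtop M) U \<and> p \<in> U \<and> U \<subseteq> fol_dom F i \<and>
        smooth_endo_on (fol_map F i ` U) (fol_model F) A \<and>
        (\<forall>y\<in>U. \<forall>u. ntriv M F i y (J y *v u) = A (fol_map F i y) *v ntriv M F i y u))"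


section \<open>Transversely almost Hermitian and cosymplectic foliations\<close>

definition transv_almost_hermitian ::
  "('a, 'e::euclidean_space) mfd \<Rightarrow> ('a, 'e) metric \<Rightarrow> ('i, 'a, 't, 'q::finite) foliation \<Rightarrow>
   ('a \<Rightarrow> real^'q^'q) \<Rightarrow> bool" where
  "transv_almost_hermitian M g F J \<longleftrightarrow>
     foliated_riemannian M g F \<and> foliated_endo M F J \<and>
     (\<forall>p\<in>carrier_of M. J p ** J p = - mat 1 \<and>
        (\<forall>u v. nmetric F p (J p *v u) (J p *v v) = nmetric F p u v))"

text \<open>Elements of \<open>Q \<otimes> Q\<close> are matrices, those of \<open>\<And>\<^sup>2 Q\<close> antisymmetric matrices, with
  \<open>X \<and> Y = X \<otimes> Y - Y \<otimes> X\<close>.  The inner product on \<open>\<And>\<^sup>2 Q\<close> is the one with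
  \<open>\<langle>X \<and> Y, Z \<and> W\<rangle> = \<langle>X, Z\<rangle> \<langle>Y, W\<rangle> - \<langle>X, W\<rangle> \<langle>Y, Z\<rangle>\<close>.\<close>

definition wedge :: "real^'q \<Rightarrow> real^'q \<Rightarrow> real^'q^'q" where
  "wedge X Y = (\<chi> a b. X $ a * Y $ b - X $ b * Y $ a)"

definition nmetric2 ::
  "('i, 'a, 't, 'q::finite) foliation \<Rightarrow> 'a \<Rightarrow> real^'q^'q \<Rightarrow> real^'q^'q \<Rightarrow> real" where
  "nmetric2 F p A B =
     (\<Sum>a\<in>UNIV. \<Sum>b\<in>UNIV. \<Sum>c\<in>UNIV. \<Sum>d\<in>UNIV. A $ a $ b * B $ c $ d *
        nmetric F p (axis a 1) (axis c 1) * nmetric F p (axis b 1) (axis d 1)) / 2"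

definition fundamental_2vector ::
  "('i, 'a, 't, 'q::finite) foliation \<Rightarrow> ('a \<Rightarrow> real^'q^'q) \<Rightarrow> 'a \<Rightarrow> real^'q^'q" where
  "fundamental_2vector F J p =
     (THE A. transpose A = - A \<and> (\<forall>X Y. nmetric2 F p A (wedge X Y) = nmetric F p (J p *v X) Y))"

text \<open>The connection on \<open>Q \<otimes> Q\<close> induced by the normal Levi-Civita connection.\<close>

definition nabla_2vector ::
  "('a, 'e::euclidean_space) mfd \<Rightarrow> ('i, 'a, 't, 'q::finite) foliation \<Rightarrow> ('a \<Rightarrow> real^'q^'q) \<Rightarrow>
   'a \<Rightarrow> 'e \<Rightarrow> real^'q^'q" where
  "nabla_2vector M F A p X =
     (let R = nframe_at M F p; \<Gamma> = nconn M F p X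
      in dir_deriv M p (\<lambda>y. R y ** A y ** transpose (R y)) X + \<Gamma> ** A p + A p ** transpose \<Gamma>)"

text \<open>\<open>\<nabla>F\<close> as an element \<open>N\<close> of \<open>Q \<otimes> \<And>\<^sup>2 Q\<close> with entries \<open>N $ c $ a $ b\<close>, where \<open>c\<close> belongs to the
  derivative slot: contracting that slot with \<open>u \<in> Q\<^sub>p\<close> by means of \<open>g\<^sub>Q\<close> gives \<open>\<nabla>\<^sub>u F\<close>.\<close>

definition nabla_fundamental ::
  "('a, 'e::euclidean_space) mfd \<Rightarrow> ('a, 'e) metric \<Rightarrow> ('i, 'a, 't, 'q::finite) foliation \<Rightarrow>
   ('a \<Rightarrow> real^'q^'q) \<Rightarrow> 'a \<Rightarrow> real^'q^'q^'q" where
  "nabla_fundamental M g F J p =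
     (THE N. \<forall>u. (\<Sum>c\<in>UNIV. nmetric F p (axis c 1) u *\<^sub>R N $ c) =
        nabla_2vector M F (fundamental_2vector F J) p (nlift M g F p u))"

text \<open>The projections \<open>(1 \<mp> \<i>J)/2\<close> of the complexification of \<open>Q\<^sub>p\<close> onto the \<open>\<plusminus>\<i>\<close> eigenspaces
  of \<open>J\<close>, and the projection that they induce on a threefold tensor product.\<close>

definition proj10 :: "real^'q^'q \<Rightarrow> complex^'q^'q" where
  "proj10 J = (\<chi> a b. ((if a = b then 1 else 0) - \<i> * of_real (J $ a $ b)) / 2)"

definition proj01 :: "real^'q^'q \<Rightarrow> complex^'q^'q" where
  "proj01 J = (\<chi> a b. ((if a = b then 1 else 0) + \<i> * of_real (J $ a $ b)) / 2)"

definition tensor3_apply ::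
  "complex^'q^'q \<Rightarrow> complex^'q^'q \<Rightarrow> complex^'q^'q \<Rightarrow> real^'q^'q^'q \<Rightarrow> complex^'q^'q^'q::finite" where
  "tensor3_apply A B C N =
     (\<chi> c a b. \<Sum>c'\<in>UNIV. \<Sum>a'\<in>UNIV. \<Sum>b'\<in>UNIV.
        A $ c $ c' * B $ a $ a' * C $ b $ b' * of_real (N $ c' $ a' $ b'))"

text \<open>\<open>D\<^sub>2F\<close>, the component of \<open>\<nabla>F\<close> in \<open>(Q\<^sup>1\<^sup>,\<^sup>0 \<otimes> Q\<^sup>0\<^sup>,\<^sup>2) \<oplus> (Q\<^sup>0\<^sup>,\<^sup>1 \<otimes> Q\<^sup>2\<^sup>,\<^sup>0)\<close>.\<close>

definition D2_fundamental ::
  "('a, 'e::euclidean_space) mfd \<Rightarrow> ('a, 'e) metric \<Rightarrow> ('i, 'a, 't, 'q::finite) foliation \<Rightarrow>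
   ('a \<Rightarrow> real^'q^'q) \<Rightarrow> 'a \<Rightarrow> complex^'q^'q^'q" where
  "D2_fundamental M g F J p =
     (let N = nabla_fundamental M g F J p; A = proj10 (J p); B = proj01 (J p)
      in tensor3_apply A B B N + tensor3_apply B A A N)"

text \<open>The \<open>g\<^sub>Q\<close>-contraction of the derivative slot with the first slot of the 2-vector (contracting
  with the second slot changes the sign only).\<close>

definition tr_deriv ::
  "('i, 'a, 't, 'q::finite) foliation \<Rightarrow> 'a \<Rightarrow> complex^'q^'q^'q \<Rightarrow> complex^'q" where
  "tr_deriv F p N =
     (\<chi> b. \<Sum>c\<in>UNIV. \<Sum>a\<in>UNIV. of_real (nmetric F p (axis c 1) (axis a 1)) * N $ c $ a $ b)"

definition transv_cosymplectic ::
  "('a, 'e::euclidean_space) mfd \<Rightarrow> ('a, 'e) metric \<Rightarrow> ('i, 'a, 't, 'q::finite) foliation \<Rightarrow>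
   ('a \<Rightarrow> real^'q^'q) \<Rightarrow> bool" where
  "transv_cosymplectic M g F J \<longleftrightarrow>
     (\<forall>p\<in>carrier_of M. tr_deriv F p (D2_fundamental M g F J p) = 0)"


section \<open>Transversely harmonic maps\<close>

text \<open>The map \<open>\<phi>\<^sup>T\<^sub>* : Q\<^sub>p \<rightarrow> Q'\<^bsub>\<phi>(p)\<^esub>\<close> induced by the differential on the normal bundles.\<close>

definition transv_diff ::
  "('a, 'e::euclidean_space) mfd \<Rightarrow> ('i, 'a, 't, 'q::finite) foliation \<Rightarrow>
   ('b, 'f::euclidean_space) mfd \<Rightarrow> ('j, 'b, 's, 'r::finite) foliation \<Rightarrow> ('a \<Rightarrow> 'b) \<Rightarrow>
   'a \<Rightarrow> real^'q \<Rightarrow> real^'r" where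
  "transv_diff M F N F' \<phi> p =
     on_quotient (nproj M F p) (nproj N F' (\<phi> p) \<circ> mderiv M N \<phi> p)"

text \<open>\<open>(\<nabla>\<^sub>X A)(p)\<close> for the connection induced on \<open>Hom(Q, \<phi>\<^sup>-\<^sup>1Q') = Q\<^sup>* \<otimes> \<phi>\<^sup>-\<^sup>1Q'\<close> by the normal
  Levi-Civita connections, \<open>X \<in> T\<^sub>pM\<close>.\<close>

definition nabla_hom ::
  "('a, 'e::euclidean_space) mfd \<Rightarrow> ('i, 'a, 't, 'q::finite) foliation \<Rightarrow>
   ('b, 'f::euclidean_space) mfd \<Rightarrow> ('j, 'b, 's, 'r::finite) foliation \<Rightarrow> ('a \<Rightarrow> 'b) \<Rightarrow>
   ('a \<Rightarrow> real^'q^'r) \<Rightarrow> 'a \<Rightarrow> 'e \<Rightarrow> real^'q^'r" where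
  "nabla_hom M F N F' \<phi> A p X =
     dir_deriv M p
       (\<lambda>y. nframe_at N F' (\<phi> p) (\<phi> y) ** A y ** matrix_inv (nframe_at M F p y)) X
     + nconn N F' (\<phi> p) (mderiv M N \<phi> p X) ** A p - A p ** nconn M F p X"

definition orthonormal_frame ::
  "('i, 'a, 't, 'q::finite) foliation \<Rightarrow> 'a \<Rightarrow> ('q \<Rightarrow> real^'q) \<Rightarrow> bool" where
  "orthonormal_frame F p e \<longleftrightarrow> (\<forall>a b. nmetric F p (e a) (e b) = (if a = b then 1 else 0))"

text \<open>The trace does not depend on the chosen frame.\<close>

definition transv_tension ::
  "('a, 'e::euclidean_space) mfd \<Rightarrow> ('a, 'e) metric \<Rightarrow> ('i, 'a, 't, 'q::finite) foliation \<Rightarrow>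
   ('b, 'f::euclidean_space) mfd \<Rightarrow> ('j, 'b, 's, 'r::finite) foliation \<Rightarrow> ('a \<Rightarrow> 'b) \<Rightarrow>
   'a \<Rightarrow> real^'r" where
  "transv_tension M g F N F' \<phi> p =
     (let e = (SOME e. orthonormal_frame F p e);
          A = (\<lambda>y. matrix (transv_diff M F N F' \<phi> y))
      in \<Sum>a\<in>UNIV. nabla_hom M F N F' \<phi> A p (nlift M g F p (e a)) *v e a)"

definition transv_harmonic ::
  "('a, 'e::euclidean_space) mfd \<Rightarrow> ('a, 'e) metric \<Rightarrow> ('i, 'a, 't, 'q::finite) foliation \<Rightarrow>
   ('b, 'f::euclidean_space) mfd \<Rightarrow> ('j, 'b, 's, 'r::finite) foliation \<Rightarrow> ('a \<Rightarrow> 'b) \<Rightarrow> bool" where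
  "transv_harmonic M g F N F' \<phi> \<longleftrightarrow>
     foliated_map M F N F' \<phi> \<and> (\<forall>p\<in>carrier_of M. transv_tension M g F N F' \<phi> p = 0)"


section \<open>The normal twistor bundle\<close>

text \<open>The total space of \<open>End(Q')\<close>, consisting of the pairs \<open>(y, P)\<close> with \<open>P\<close> the matrix of an
  endomorphism of \<open>Q'\<^sub>y\<close>.  Its charts are given by a chart \<open>(U, c)\<close> of \<open>N\<close>, a local submersion \<open>i\<close>
  and a chart \<open>(V, d)\<close> of the transverse model.\<close>

definition endo_chart ::
  "('b, 'f::euclidean_space) mfd \<Rightarrow> ('j, 'b, 's, 'r::finite) foliation \<Rightarrow>
   ('b, 'f) chart \<Rightarrow> 'j \<Rightarrow> ('s, real^'r) chart \<Rightarrow> ('b \<times> (real^'r^'r), 'f \<times> (real^'r^'r)) chart" where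
  "endo_chart N F C i D =
     ({(y, P). y \<in> fst C \<and> y \<in> fol_dom F i \<and> fol_map F i y \<in> fst D},
      (\<lambda>(y, P). (snd C y, nframe N F i D y ** P ** matrix_inv (nframe N F i D y))))"

definition endo_atlas ::
  "('b, 'f::euclidean_space) mfd \<Rightarrow> ('j, 'b, 's, 'r::finite) foliation \<Rightarrow>
   ('b \<times> (real^'r^'r), 'f \<times> (real^'r^'r)) chart set" where
  "endo_atlas N F =
     {endo_chart N F C i D | C i D. C \<in> atlas N \<and> i \<in> fol_index F \<and> D \<in> atlas (fol_model F)}"

definition endo_bundle ::
  "('b, 'f::euclidean_space) mfd \<Rightarrow> ('j, 'b, 's, 'r::finite) foliation \<Rightarrow>
   ('b \<times> (real^'r^'r), 'f \<times> (real^'r^'r)) mfd" where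
  "endo_bundle N F =
     \<lparr>mtop = topology_generated_by {{w \<in> W. c w \<in> S} | W c S. (W, c) \<in> endo_atlas N F \<and> open S},
      atlas = endo_atlas N F,
      chart_at = (\<lambda>(y, P). endo_chart N F (chart_at N y) (fol_at F y)
         (chart_at (fol_model F) (fol_map F (fol_at F y) y)))\<rparr>"

text \<open>\<open>W' = Z(N, \<F>')\<close>, a subbundle of \<open>End(Q')\<close> and so an embedded submanifold of its total space.
  Accordingly a map into \<open>W'\<close> is smooth iff it is smooth as a map into \<open>End(Q')\<close>, and tangent vectors
  of \<open>W'\<close> are tangent vectors of \<open>End(Q')\<close>.\<close>

definition twistor_bundle ::
  "('b, 'f::euclidean_space) mfd \<Rightarrow> ('j, 'b, 's, 'r::finite) foliation \<Rightarrow> ('b \<times> (real^'r^'r)) set" where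
  "twistor_bundle N F =
     {(y, P). y \<in> carrier_of N \<and> P ** P = - mat 1 \<and>
        (\<forall>u v. nmetric F y (P *v u) (P *v v) = nmetric F y u v)}"

text \<open>The induced submersions \<open>W'|U\<^sub>i \<rightarrow> Z(T)\<close>, \<open>(y, P) \<mapsto> (f\<^sub>i(y), df\<^sub>i \<circ> P \<circ> df\<^sub>i\<^sup>-\<^sup>1)\<close>, and the
  leaves of the lifted foliation which they define.\<close>

definition twistor_submersion ::
  "('b, 'f::euclidean_space) mfd \<Rightarrow> ('j, 'b, 's, 'r::finite) foliation \<Rightarrow> 'j \<Rightarrow>
   'b \<times> (real^'r^'r) \<Rightarrow> 's \<times> (real^'r^'r)" where
  "twistor_submersion N F i =
     (\<lambda>(y, P). (fol_map F i y,
        matrix (ntriv N F i y) ** P ** matrix_inv (matrix (ntriv N F i y))))"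

definition twistor_same_leaf ::
  "('b, 'f::euclidean_space) mfd \<Rightarrow> ('j, 'b, 's, 'r::finite) foliation \<Rightarrow>
   'b \<times> (real^'r^'r) \<Rightarrow> 'b \<times> (real^'r^'r) \<Rightarrow> bool" where
  "twistor_same_leaf N F =
     plaque_chain (fol_index F) (\<lambda>i. {w \<in> twistor_bundle N F. fst w \<in> fol_dom F i})
       (twistor_submersion N F)"

definition twistor_foliated_map ::
  "('a, 'e::euclidean_space) mfd \<Rightarrow> ('i, 'a, 't, 'q::finite) foliation \<Rightarrow>
   ('b, 'f::euclidean_space) mfd \<Rightarrow> ('j, 'b, 's, 'r::finite) foliation \<Rightarrow>
   ('a \<Rightarrow> 'b \<times> (real^'r^'r)) \<Rightarrow> bool" where
  "twistor_foliated_map M F N F' \<psi> \<longleftrightarrow>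
     \<psi> ` carrier_of M \<subseteq> twistor_bundle N F' \<and>
     smooth_map_on (carrier_of M) M (endo_bundle N F') \<psi> \<and>
     (\<forall>p\<in>carrier_of M. \<forall>q\<in>carrier_of M.
        same_leaf F p q \<longrightarrow> twistor_same_leaf N F' (\<psi> p) (\<psi> q))"

text \<open>The vertical part of a tangent vector \<open>(v, B)\<close> of \<open>End(Q')\<close> at \<open>(y, P)\<close> with respect to the
  splitting \<open>H \<oplus> V\<close> given by the connection \<open>d + [\<Gamma>, \<cdot>]\<close> on \<open>End(Q')\<close> that is induced by the normal
  Levi-Civita connection: \<open>H\<close> consists of the \<open>(v, B)\<close> with \<open>B = - [\<Gamma>(v), P]\<close>.\<close>

definition vertical_part ::
  "('b, 'f::euclidean_space) mfd \<Rightarrow> ('j, 'b, 's, 'r::finite) foliation \<Rightarrow>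
   'b \<times> (real^'r^'r) \<Rightarrow> 'f \<times> (real^'r^'r) \<Rightarrow> (real^'r^'r)" where
  "vertical_part N F w \<xi> =
     (let \<Gamma> = nconn N F (fst w) (mderiv (endo_bundle N F) N fst w \<xi>)
      in snd \<xi> + \<Gamma> ** snd w - snd w ** \<Gamma>)"

text \<open>The quotient map \<open>TW' \<rightarrow> Q(W') = TW' / T\<F>'\<^sub>Z \<cong> \<pi>\<^sup>-\<^sup>1Q' \<oplus> V\<close>.  Its kernel is the horizontal
  lift of \<open>T\<F>'\<close>, and \<open>V\<^sub>P\<close> is contained in \<open>End(Q'\<^bsub>\<pi>(P)\<^esub>)\<close>.\<close>

definition twistor_nproj ::
  "('b, 'f::euclidean_space) mfd \<Rightarrow> ('j, 'b, 's, 'r::finite) foliation \<Rightarrow>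
   'b \<times> (real^'r^'r) \<Rightarrow> 'f \<times> (real^'r^'r) \<Rightarrow> (real^'r) \<times> (real^'r^'r)" where
  "twistor_nproj N F w \<xi> =
     (nproj N F (fst w) (mderiv (endo_bundle N F) N fst w \<xi>), vertical_part N F w \<xi>)"

definition J_minus ::
  "'b \<times> (real^'r^'r) \<Rightarrow> (real^'r) \<times> (real^'r^'r) \<Rightarrow> (real^'r::finite) \<times> (real^'r^'r)" where
  "J_minus = (\<lambda>(y, P) (u, A). (P *v u, - (P ** A)))"

definition twistor_transv_diff ::
  "('a, 'e::euclidean_space) mfd \<Rightarrow> ('i, 'a, 't, 'q::finite) foliation \<Rightarrow>
   ('b, 'f::euclidean_space) mfd \<Rightarrow> ('j, 'b, 's, 'r::finite) foliation \<Rightarrow>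
   ('a \<Rightarrow> 'b \<times> (real^'r^'r)) \<Rightarrow> 'a \<Rightarrow> real^'q \<Rightarrow> (real^'r) \<times> (real^'r^'r)" where
  "twistor_transv_diff M F N F' \<psi> p =
     on_quotient (nproj M F p)
       (twistor_nproj N F' (\<psi> p) \<circ> mderiv M (endo_bundle N F') \<psi> p)"

definition transv_J_minus_holomorphic ::
  "('a, 'e::euclidean_space) mfd \<Rightarrow> ('i, 'a, 't, 'q::finite) foliation \<Rightarrow> ('a \<Rightarrow> real^'q^'q) \<Rightarrow>
   ('b, 'f::euclidean_space) mfd \<Rightarrow> ('j, 'b, 's, 'r::finite) foliation \<Rightarrow>
   ('a \<Rightarrow> 'b \<times> (real^'r^'r)) \<Rightarrow> bool" where
  "transv_J_minus_holomorphic M F J N F' \<psi> \<longleftrightarrow>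
     twistor_foliated_map M F N F' \<psi> \<and>
     (\<forall>p\<in>carrier_of M. \<forall>u.
        twistor_transv_diff M F N F' \<psi> p (J p *v u) =
        J_minus (\<psi> p) (twistor_transv_diff M F N F' \<psi> p u))"

end

theory Submission
  imports Defs
begin

text \<open>Put \<open>\<phi> = \<pi> \<circ> \<psi>\<close>, let \<open>A = \<phi>\<^sup>T\<^sub>*\<close> and let \<open>P\<close> be the section of \<open>\<phi>\<^sup>-\<^sup>1 End(Q')\<close> given by
  \<open>\<psi>\<close>.  Transverse \<open>J\<^sup>-\<close>-holomorphicity says \<open>A J = P A\<close> and \<open>\<nabla>\<^bsub>Ju\<^esub> P = - P \<nabla>\<^sub>u P\<close>.  Differentiating the first
  equation gives \<open>(\<nabla>\<^sub>u A) J + A (\<nabla>\<^sub>u J) = (\<nabla>\<^sub>u P) A + P (\<nabla>\<^sub>u A)\<close>.  Apply this to \<open>J u\<close> and sum over an orthonormal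
  frame: the terms with \<open>P (\<nabla>\<^sub>u A) J u\<close> cancel because the second fundamental form \<open>(\<nabla>\<^sub>u A) v\<close> is symmetric and
  \<open>J\<close> is skew, those with \<open>(\<nabla>\<^sub>u P) A J u\<close> cancel by the second equation, and what remains is
  \<open>\<tau>\<^sub>b(\<phi>) = - A J (div J)\<close>.  Finally \<open>div J = tr(\<nabla>F) = tr(D\<^sub>2F) = 0\<close>.

  That \<open>\<psi>\<close> induces maps of normal bundles at all needs an argument: it maps leaves into leaves only as sets.
  A curve in a leaf is mapped into a leaf of \<open>\<F>'\<^sub>Z\<close>, which consists of countably many plaques of each
  submersion, so by continuity it stays in one plaque and its velocity is tangent to \<open>\<F>'\<^sub>Z\<close>.\<close>

section \<open>Calculus and linear algebra\<close>

text \<open>A vector of \<open>Q\<close> at \<open>y\<close> is stored in the realisation given by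
  the preferred submersion at \<open>y\<close>, and this choice may jump with \<open>y\<close>. So
  \<open>A\<close>, \<open>J\<close>, \<open>P\<close> and \<open>F\<close> cannot be differentiated
  as they stand. Near \<open>p\<close> they are rewritten in the frames \<open>nframe_at\<close>
  based at \<open>p\<close> and at \<open>\<phi> p\<close>, which come from transverse coordinates
  and are the identity at the base point. There \<open>A J = P A\<close>, \<open>J^2 = -1\<close>
  and \<open>P^2 = -1\<close> keep their form, the ordinary product rule applies, and adding
  Christoffel terms gives the covariant identities. The equality \<open>div J = tr(D_2 F)\<close>
  has two sources. The connection is metric, so \<open>\<nabla>F\<close> is
  \<open>- (\<nabla>J) g^{-1}\<close>; and \<open>\<nabla>J\<close> anticommutes with
  \<open>J\<close>, so \<open>\<nabla>F\<close> takes values in \<open>Q^{2,0} + Q^{0,2}\<close>.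
  The trace of \<open>D_1 F\<close> vanishes because \<open>g_Q\<close> is zero on
  \<open>Q^{1,0} x Q^{1,0}\<close> and on \<open>Q^{0,1} x Q^{0,1}\<close>. A leaf has countably
  many plaques because second countability gives a countable family of submersions, and connected
  plaques can be followed inside that family.\<close>

text \<open>The mean value theorem in direction \<open>u\<close> turns the second difference into a
  difference of two values of \<open>f' _ u\<close>, and the first-order expansion of
  \<open>f' _ u\<close> at \<open>x\<close> finishes. This way the second derivatives need to exist
  at the single point \<open>x\<close> only.\<close>

lemma second_difference_limit:
  fixes f :: "'a::euclidean_space \<Rightarrow> real"
  assumes S: "open S" "x \<in> S"
    and f: "\<And>y. y \<in> S \<Longrightarrow> (f has_derivative f' y) (at y)"
    and f2: "((\<lambda>y. f' y u) has_derivative L) (at x)"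
  shows "((\<lambda>h. (f (x + h *\<^sub>R u + h *\<^sub>R v) - f (x + h *\<^sub>R u) - f (x + h *\<^sub>R v) + f x) / h\<^sup>2)
    \<longlongrightarrow> L v) (at_right 0)"
proof (rule tendstoI)
  fix e :: real assume "e > 0"
  \<comment> \<open>The two expansion errors add up to at most
    \<open>2 * (e / C) * h * (norm u + norm v)\<close>. The summand \<open>1\<close> makes this
    strictly less than \<open>e * h\<close>, also for \<open>u = v = 0\<close>.\<close>
  define C where "C = 2 * (norm u + norm v) + 1"
  have C: "C > 0" unfolding C_def by (intro add_nonneg_pos) auto
  have e': "e / C > 0" using \<open>e > 0\<close> C by simp
  have linL: "linear L" using f2 has_derivative_linear by blast
  have "\<forall>e>0. \<exists>d>0. \<forall>y. norm (y - x) < d \<longrightarrow> \<bar>f' y u - f' x u - L (y - x)\<bar> \<le> e * norm (y - x)"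
    using f2 by (simp add: has_derivative_at_alt)
  with e' obtain d1 where d1: "d1 > 0" "\<And>y. norm (y - x) < d1 \<Longrightarrow>
      \<bar>f' y u - f' x u - L (y - x)\<bar> \<le> e / C * norm (y - x)"
    by blast
  obtain d2 where d2: "d2 > 0" "ball x d2 \<subseteq> S"
    using S open_contains_ball by blast
  define d where "d = min d1 d2 / C"
  have d: "d > 0" using d1 d2 C by (simp add: d_def)
  show "\<forall>\<^sub>F h in at_right 0. dist ((f (x + h *\<^sub>R u + h *\<^sub>R v) - f (x + h *\<^sub>R u) -
      f (x + h *\<^sub>R v) + f x) / h\<^sup>2) (L v) < e"
    unfolding eventually_at_right_field
  proof (intro exI[of _ d] conjI allI impI d)
    fix h :: real assume h: "0 < h" "h < d"
    have hC: "h * C < min d1 d2" using h C by (simp add: d_def pos_less_divide_eq)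
    have nrm: "norm (t *\<^sub>R u + s *\<^sub>R v) \<le> h * (norm u + norm v)" if "0 \<le> t" "t \<le> h" "0 \<le> s" "s \<le> h" for t s
    proof -
      have "norm (t *\<^sub>R u + s *\<^sub>R v) \<le> t * norm u + s * norm v"
        using that norm_triangle_ineq[of "t *\<^sub>R u" "s *\<^sub>R v"] by simp
      also have "\<dots> \<le> h * norm u + h * norm v"
        using that by (intro add_mono mult_right_mono) auto
      finally show ?thesis by (simp add: algebra_simps)
    qed
    have nrm2: "norm (t *\<^sub>R u + s *\<^sub>R v) < min d1 d2" if "0 \<le> t" "t \<le> h" "0 \<le> s" "s \<le> h" for t s
    proof -
      have "h * (norm u + norm v) \<le> h * C"
        using h by (intro mult_left_mono) (auto simp: C_def)
      with nrm[OF that] hC show ?thesis by linarith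
    qed
    have inS: "x + (t *\<^sub>R u + s *\<^sub>R v) \<in> S" if "0 \<le> t" "t \<le> h" "0 \<le> s" "s \<le> h" for t s
    proof -
      have "dist x (x + (t *\<^sub>R u + s *\<^sub>R v)) < d2"
        using nrm2[OF that] by (subst dist_commute) (simp add: dist_norm)
      then show ?thesis using d2 by (auto simp: ball_def)
    qed
    \<comment> \<open>The term \<open>0 *\<^sub>R v\<close> is kept so that both points have the
      form \<open>t *\<^sub>R u + s *\<^sub>R v\<close> to which \<open>nrm\<close>,
      \<open>nrm2\<close> and \<open>inS\<close> apply.\<close>
    define g where "g = (\<lambda>t. f (x + (t *\<^sub>R u + h *\<^sub>R v)) - f (x + (t *\<^sub>R u + 0 *\<^sub>R v)))"
    have dg: "(g has_derivative (\<lambda>r. f' (x + (t *\<^sub>R u + h *\<^sub>R v)) (r *\<^sub>R u) - f' (x + (t *\<^sub>R u + 0 *\<^sub>R v)) (r *\<^sub>R u))) (at t)"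
      if "0 \<le> t" "t \<le> h" for t
      unfolding g_def using that h
      by (auto intro!: derivative_eq_intros has_derivative_compose[OF _ f] inS simp del: scaleR_zero_left)
    have "\<exists>t\<in>{0<..<h}. g h - g 0 = f' (x + (t *\<^sub>R u + h *\<^sub>R v)) ((h - 0) *\<^sub>R u) - f' (x + (t *\<^sub>R u + 0 *\<^sub>R v)) ((h - 0) *\<^sub>R u)"
      by (rule mvt_simple[OF h(1)]) (use dg h in \<open>auto intro: has_derivative_at_withinI\<close>)
    then obtain t where t: "0 < t" "t < h" and
      mv: "g h - g 0 = f' (x + (t *\<^sub>R u + h *\<^sub>R v)) (h *\<^sub>R u) - f' (x + (t *\<^sub>R u + 0 *\<^sub>R v)) (h *\<^sub>R u)"
      by auto
    define a where "a = t *\<^sub>R u + h *\<^sub>R v"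
    define b where "b = t *\<^sub>R u + 0 *\<^sub>R v"
    have lin: "linear (f' (x + a))" "linear (f' (x + b))"
      unfolding a_def b_def using inS[of t h] inS[of t 0] t h f has_derivative_linear by force+
    have mv': "g h - g 0 = h * (f' (x + a) u - f' (x + b) u)"
      unfolding mv a_def[symmetric] b_def[symmetric] linear_cmul[OF lin(1)] linear_cmul[OF lin(2)]
      by (simp add: right_diff_distrib)
    have na: "norm a \<le> h * (norm u + norm v)" "norm b \<le> h * (norm u + norm v)"
      unfolding a_def b_def using nrm[of t h] nrm[of t 0] t h by auto
    have "\<bar>f' (x + a) u - f' x u - L a\<bar> \<le> e / C * norm a"
      using d1(2)[of "x + a"] nrm2[of t h] t h by (simp add: a_def)
    moreover have "\<bar>f' (x + b) u - f' x u - L b\<bar> \<le> e / C * norm b"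
      using d1(2)[of "x + b"] nrm2[of t 0] t h by (simp add: b_def)
    moreover have "e / C * norm a \<le> e / C * (h * (norm u + norm v))"
      "e / C * norm b \<le> e / C * (h * (norm u + norm v))"
      using na e' by (auto intro!: mult_left_mono simp del: times_divide_eq_left)
    moreover have "L a - L b = h * L v"
      unfolding a_def b_def using linL by (simp add: linear_add linear_cmul)
    ultimately have "\<bar>f' (x + a) u - f' (x + b) u - h * L v\<bar> \<le> 2 * (e / C * (h * (norm u + norm v)))"
      by linarith
    also have "\<dots> = e / C * (h * (2 * (norm u + norm v)))" by simp
    also have "\<dots> < e / C * (h * C)"
      using e' h by (intro mult_strict_left_mono) (auto simp: C_def)
    also have "\<dots> = e * h" using C by simp
    finally have est: "\<bar>f' (x + a) u - f' (x + b) u - h * L v\<bar> < e * h" .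
    have "f (x + h *\<^sub>R u + h *\<^sub>R v) - f (x + h *\<^sub>R u) - f (x + h *\<^sub>R v) + f x = g h - g 0"
      by (simp add: g_def add.assoc)
    moreover have "h * c / h\<^sup>2 - l = (c - h * l) / h" for c l :: real
      using h by (simp add: field_simps power2_eq_square)
    ultimately have "(f (x + h *\<^sub>R u + h *\<^sub>R v) - f (x + h *\<^sub>R u) - f (x + h *\<^sub>R v) + f x) / h\<^sup>2 - L v
        = (f' (x + a) u - f' (x + b) u - h * L v) / h"
      by (simp only: mv')
    also have "\<bar>\<dots>\<bar> < e"
      using est h by (simp add: abs_divide pos_divide_less_eq)
    finally show "dist ((f (x + h *\<^sub>R u + h *\<^sub>R v) - f (x + h *\<^sub>R u) -
      f (x + h *\<^sub>R v) + f x) / h\<^sup>2) (L v) < e" by (simp add: dist_norm)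
  qed
qed

text \<open>The second difference does not change when \<open>u\<close> and \<open>v\<close> are
  exchanged, so \<open>L v\<close> and \<open>K u\<close> are limits of the same quotient.\<close>

lemma second_derivative_symmetric_real:
  fixes f :: "'a::euclidean_space \<Rightarrow> real"
  assumes S: "open S" "x \<in> S"
    and f: "\<And>y. y \<in> S \<Longrightarrow> (f has_derivative f' y) (at y)"
    and "((\<lambda>y. f' y u) has_derivative L) (at x)" "((\<lambda>y. f' y v) has_derivative K) (at x)"
  shows "L v = K u"
proof -
  have "((\<lambda>h. (f (x + h *\<^sub>R u + h *\<^sub>R v) - f (x + h *\<^sub>R u) - f (x + h *\<^sub>R v) + f x) / h\<^sup>2)
    \<longlongrightarrow> L v) (at_right 0)"
    by (rule second_difference_limit[OF S f assms(4)])
  moreover have "((\<lambda>h. (f (x + h *\<^sub>R v + h *\<^sub>R u) - f (x + h *\<^sub>R v) - f (x + h *\<^sub>R u) + f x) / h\<^sup>2)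
    \<longlongrightarrow> K u) (at_right 0)"
    by (rule second_difference_limit[OF S f assms(5)])
  moreover have "(\<lambda>h. (f (x + h *\<^sub>R v + h *\<^sub>R u) - f (x + h *\<^sub>R v) - f (x + h *\<^sub>R u) + f x) / h\<^sup>2)
    = (\<lambda>h. (f (x + h *\<^sub>R u + h *\<^sub>R v) - f (x + h *\<^sub>R u) - f (x + h *\<^sub>R v) + f x) / h\<^sup>2)"
    by (simp add: algebra_simps)
  ultimately show ?thesis
    using tendsto_unique[OF trivial_limit_at_right_real] by force
qed

lemma second_derivative_symmetric:
  fixes f :: "'a::euclidean_space \<Rightarrow> 'b::euclidean_space"
  assumes S: "open S" "x \<in> S"
    and f: "\<And>y. y \<in> S \<Longrightarrow> (f has_derivative f' y) (at y)"
    and "((\<lambda>y. f' y u) has_derivative L) (at x)" "((\<lambda>y. f' y v) has_derivative K) (at x)"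
  shows "L v = K u"
proof (rule euclidean_eqI)
  fix b :: 'b assume "b \<in> Basis"
  show "L v \<bullet> b = K u \<bullet> b"
    by (rule second_derivative_symmetric_real[OF S, where f = "\<lambda>y. f y \<bullet> b" and f' = "\<lambda>y w. f' y w \<bullet> b"
          and L = "\<lambda>w. L w \<bullet> b" and K = "\<lambda>w. K w \<bullet> b"])
      (use f assms(4,5) in \<open>auto intro!: has_derivative_inner_left\<close>)
qed

section \<open>Differentiating products and inverses of matrices\<close>

lemma bounded_bilinear_matrix_matrix_mult:
  "bounded_bilinear ((**) :: real^'n^'m \<Rightarrow> real^'p^'n \<Rightarrow> real^'p^'m)"
  unfolding bilinear_conv_bounded_bilinear[symmetric] bilinear_def
  by (auto intro!: linearI simp: matrix_matrix_mult_def vec_eq_iff algebra_simps sum.distrib sum_distrib_left)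

lemma bounded_bilinear_matrix_vector_mult:
  "bounded_bilinear ((*v) :: real^'n^'m \<Rightarrow> real^'n \<Rightarrow> real^'m)"
  unfolding bilinear_conv_bounded_bilinear[symmetric] bilinear_def
  by (auto intro!: linearI simp: matrix_vector_right_distrib matrix_vector_mult_add_rdistrib
      matrix_vector_mult_scaleR scaleR_matrix_vector_assoc)

lemma linear_matrix_mult_right: "linear (\<lambda>X. A ** X :: real^'p^'m)" for A :: "real^'n^'m"
  using bounded_bilinear_matrix_matrix_mult bounded_linear.linear bounded_bilinear.bounded_linear_right by blast

lemma linear_matrix_mult_left: "linear (\<lambda>X. X ** A :: real^'p^'m)" for A :: "real^'p^'n"
  using bounded_bilinear_matrix_matrix_mult bounded_linear.linear bounded_bilinear.bounded_linear_left by blast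

lemma matrix_mult_distrib:
  fixes A B :: "real^'n^'m" and C D :: "real^'p^'n"
  shows "(A + B) ** C = A ** C + B ** C" "A ** (C + D) = A ** C + A ** D"
    "(A - B) ** C = A ** C - B ** C" "A ** (C - D) = A ** C - A ** D"
    "(- A) ** C = - (A ** C)" "A ** (- C) = - (A ** C)"
  using linear_add[OF linear_matrix_mult_left, of A B C] linear_add[OF linear_matrix_mult_right, of A C D]
    linear_diff[OF linear_matrix_mult_left, of A B C] linear_diff[OF linear_matrix_mult_right, of A C D]
    linear_neg[OF linear_matrix_mult_left, of A C] linear_neg[OF linear_matrix_mult_right, of A C]
  by auto

lemma matrix_apply: "linear f \<Longrightarrow> matrix f *v x = f x" for f :: "real^'n \<Rightarrow> real^'m"
  by (simp add: matrix_works scalar_mult_eq_scaleR[abs_def])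

lemmas has_derivative_matrix_mult = bounded_bilinear.FDERIV[OF bounded_bilinear_matrix_matrix_mult]

lemma matrix_inv_unique:
  fixes A :: "real^'n^'n"
  assumes "A ** B = mat 1"
  shows "matrix_inv A = B"
proof -
  have BA: "B ** A = mat 1" using assms matrix_left_right_inverse by blast
  then have "A ** matrix_inv A = mat 1"
    unfolding matrix_inv_def using assms by (metis (mono_tags, lifting) someI_ex)
  then have "B ** (A ** matrix_inv A) = B" by (simp add: matrix_mul_rid)
  then show ?thesis by (simp add: matrix_mul_assoc BA)
qed

lemma matrix_inv_right_left:
  fixes A :: "real^'n^'n"
  assumes "invertible A"
  shows "A ** matrix_inv A = mat 1" "matrix_inv A ** A = mat 1"
  using assms matrix_inv_unique unfolding invertible_def by metis+

lemma matrix_inv_mat_1: "matrix_inv (mat 1 :: real^'n^'n) = mat 1"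
  by (rule matrix_inv_unique) simp

lemma matrix_conjugate_cancel:
  fixes R :: "real^'n^'n"
  assumes "invertible R"
  shows "(X ** matrix_inv R) ** (R ** Y) = X ** Y"
proof -
  have "(X ** matrix_inv R) ** (R ** Y) = X ** (matrix_inv R ** R) ** Y" by (simp only: matrix_mul_assoc)
  then show ?thesis by (simp add: matrix_inv_right_left[OF assms])
qed

lemma matrix_inv_matrix_mult:
  fixes A B :: "real^'n^'n"
  assumes "invertible A" "invertible B"
  shows "matrix_inv (A ** B) = matrix_inv B ** matrix_inv A"
proof (rule matrix_inv_unique)
  have "A ** B ** (matrix_inv B ** matrix_inv A) = A ** (B ** matrix_inv B) ** matrix_inv A"
    by (simp add: matrix_mul_assoc)
  then show "A ** B ** (matrix_inv B ** matrix_inv A) = mat 1"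
    using assms by (simp add: matrix_inv_right_left matrix_mul_rid)
qed

lemma differentiable_vec_lambda:
  fixes f :: "'a::real_normed_vector \<Rightarrow> 'n::finite \<Rightarrow> 'b::euclidean_space"
  assumes "\<And>i. (\<lambda>x. f x i) differentiable (at a within S)"
  shows "(\<lambda>x. \<chi> i. f x i) differentiable (at a within S)"
proof -
  from assms obtain f' where f': "\<And>i. ((\<lambda>x. f x i) has_derivative f' i) (at a within S)"
    unfolding differentiable_def by metis
  have "((\<lambda>x. \<chi> i. f x i) has_derivative (\<lambda>h. \<chi> i. f' i h)) (at a within S)"
    by (subst has_derivative_componentwise_within)
       (use f' in \<open>auto simp: Basis_vec_def inner_axis intro!: has_derivative_inner_left\<close>)
  then show ?thesis by (auto simp: differentiable_def)
qed

lemma differentiable_vec_nth: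
  fixes f :: "'a::real_normed_vector \<Rightarrow> 'b::euclidean_space^'n"
  assumes "f differentiable (at a within S)"
  shows "(\<lambda>x. f x $ i) differentiable (at a within S)"
  using assms bounded_linear.has_derivative[OF bounded_linear_vec_nth] unfolding differentiable_def by blast

lemma differentiable_prod_real:
  fixes f :: "'i \<Rightarrow> 'a::real_normed_vector \<Rightarrow> real"
  assumes "\<And>i. i \<in> I \<Longrightarrow> f i differentiable (at a within S)"
  shows "(\<lambda>x. \<Prod>i\<in>I. f i x) differentiable (at a within S)"
proof -
  from assms obtain f' where "\<And>i. i \<in> I \<Longrightarrow> (f i has_derivative f' i) (at a within S)"
    unfolding differentiable_def by metis
  from has_derivative_prod[of I f, OF this] show ?thesis
    by (rule differentiableI)
qed

lemma differentiable_det: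
  fixes M :: "'a::real_normed_vector \<Rightarrow> real^'n^'n"
  assumes "\<And>i j. (\<lambda>x. M x $ i $ j) differentiable (at a)"
  shows "(\<lambda>x. det (M x)) differentiable (at a)"
  unfolding det_def
  by (auto intro!: differentiable_sum differentiable_mult differentiable_prod_real assms
      simp: finite_permutations)

lemma matrix_inv_cramer:
  fixes A :: "real^'n^'n"
  assumes "det A \<noteq> 0"
  shows "matrix_inv A = (\<chi> k c. det (\<chi> i j. if j = k then axis c 1 $ i else A $ i $ j) / det A)"
proof -
  have "matrix_inv A $ k $ c = det (\<chi> i j. if j = k then axis c 1 $ i else A $ i $ j) / det A" for k c
  proof -
    have "A *v (matrix_inv A *v axis c 1) = axis c 1"
      using assms by (simp add: matrix_vector_mul_assoc matrix_inv_right_left invertible_det_nz)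
    then have "matrix_inv A *v axis c 1 = (\<chi> k. det (\<chi> i j. if j = k then axis c 1 $ i else A $ i $ j) / det A)"
      using cramer[OF assms] by blast
    from arg_cong[OF this, of "\<lambda>x. x $ k"] show ?thesis
      by (simp add: matrix_vector_mult_basis column_def)
  qed
  then show ?thesis by (simp add: vec_eq_iff)
qed

text \<open>By Cramer's rule the entries of the inverse are quotients of polynomials in the entries
  of \<open>M\<close>. The denominator \<open>det (M x)\<close> is continuous at \<open>a\<close>,
  so it stays nonzero nearby.\<close>

lemma differentiable_matrix_inv:
  fixes M :: "'a::real_normed_vector \<Rightarrow> real^'n^'n"
  assumes M: "M differentiable (at a)" and inv: "invertible (M a)"
  shows "(\<lambda>x. matrix_inv (M x)) differentiable (at a)"
    and "\<forall>\<^sub>F x in nhds a. invertible (M x)"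
proof -
  have comp: "(\<lambda>x. M x $ i $ j) differentiable (at a)" for i j
    by (intro differentiable_vec_nth M)
  have detM: "(\<lambda>x. det (M x)) differentiable (at a)"
    by (rule differentiable_det[OF comp])
  have nz: "det (M a) \<noteq> 0" using inv invertible_det_nz by blast
  have "isCont (\<lambda>x. det (M x)) a" using detM differentiable_imp_continuous_within by blast
  then have "\<forall>\<^sub>F x in at a. det (M x) \<noteq> 0"
    using nz by (simp add: isCont_def tendsto_imp_eventually_ne)
  then have ev: "\<forall>\<^sub>F x in nhds a. det (M x) \<noteq> 0"
    using nz unfolding eventually_nhds_conv_at by blast
  then show "\<forall>\<^sub>F x in nhds a. invertible (M x)"
    by (simp add: invertible_det_nz)
  have comp': "(\<lambda>x. if j = k then axis c 1 $ i else M x $ i $ j) differentiable (at a)" for c k i j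
    by (cases "j = k") (auto intro: comp)
  have D: "(\<lambda>x. \<chi> k c. det (\<chi> i j. if j = k then axis c 1 $ i else M x $ i $ j) / det (M x)) differentiable (at a)"
    by (intro differentiable_vec_lambda differentiable_divide differentiable_det detM nz)
       (use comp' in auto)
  obtain U where U: "open U" "a \<in> U" "\<And>x. x \<in> U \<Longrightarrow> det (M x) \<noteq> 0"
    using ev by (auto simp: eventually_nhds)
  obtain D' where "((\<lambda>x. \<chi> k c. det (\<chi> i j. if j = k then axis c 1 $ i else M x $ i $ j) / det (M x))
      has_derivative D') (at a)" using D unfolding differentiable_def by blast
  then have "((\<lambda>x. matrix_inv (M x)) has_derivative D') (at a)"
    using U by (auto intro: has_derivative_transform_within_open simp: matrix_inv_cramer)
  then show "(\<lambda>x. matrix_inv (M x)) differentiable (at a)" unfolding differentiable_def by blast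
qed

section \<open>Inner products and orthonormal bases\<close>

definition inner_product :: "('a::euclidean_space \<Rightarrow> 'a \<Rightarrow> real) \<Rightarrow> bool" where
  "inner_product b \<longleftrightarrow> bilinear b \<and> (\<forall>u v. b u v = b v u) \<and> (\<forall>u. u \<noteq> 0 \<longrightarrow> b u u > 0)"

text \<open>Orthonormal subsets of \<open>K\<close> are independent, so their cardinality is bounded
  and one of maximal size exists. It spans \<open>K\<close>, since otherwise a Gram-Schmidt step
  would add one more vector.\<close>

lemma inner_product_basis:
  assumes b: "inner_product b" and K: "subspace K"
  obtains S where "S \<subseteq> K" "independent S" "span S = K" "\<forall>s\<in>S. \<forall>t\<in>S. b s t = (if s = t then 1 else 0)"
proof -
  have bil: "bilinear b" and sym: "\<And>u v. b u v = b v u" and pos: "\<And>u. u \<noteq> 0 \<Longrightarrow> b u u > 0"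
    using b by (auto simp: inner_product_def)
  note blin = bilinear_ladd[OF bil] bilinear_radd[OF bil] bilinear_lmul[OF bil] bilinear_rmul[OF bil]
    bilinear_lzero[OF bil] bilinear_rzero[OF bil] bilinear_lsub[OF bil] bilinear_rsub[OF bil]
  have bsum: "b (\<Sum>s\<in>S. c s *\<^sub>R s) t = (\<Sum>s\<in>S. c s * b s t)" for S c t
    using linear_sum[of "\<lambda>x. b x t" "\<lambda>s. c s *\<^sub>R s" S] bil by (simp add: bilinear_def blin(3))
  let ?O = "\<lambda>S. S \<subseteq> K \<and> (\<forall>s\<in>S. \<forall>t\<in>S. b s t = (if s = t then 1 else 0))"
  have indep: "independent S" if S: "?O S" for S
  proof (rule ccontr)
    assume "\<not> independent S"
    then obtain T u v where T: "finite T" "T \<subseteq> S" "(\<Sum>v\<in>T. u v *\<^sub>R v) = 0" "v \<in> T" "u v \<noteq> 0"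
      unfolding dependent_explicit by blast
    have "0 = b (\<Sum>v\<in>T. u v *\<^sub>R v) v" using T blin by simp
    also have "\<dots> = (\<Sum>s\<in>T. u s * b s v)" by (rule bsum)
    also have "\<dots> = (\<Sum>s\<in>T. if s = v then u s else 0)"
      using S T by (intro sum.cong refl) (metis (no_types, lifting) mult.right_neutral mult_zero_right subsetD)
    also have "\<dots> = u v" using T by simp
    finally show False using T by simp
  qed
  have bound: "card S \<le> DIM('a)" if "?O S" for S
    using indep[OF that] independent_bound by blast
  have "\<exists>S. ?O S \<and> (\<forall>T. ?O T \<longrightarrow> card T \<le> card S)"
    by (rule Lattices_Big.ex_has_greatest_nat[where k = "{}" and b = "DIM('a) + 1"])
      (use bound in \<open>auto simp: less_Suc_eq_le\<close>)
  then obtain S where S: "?O S" and max: "\<And>T. ?O T \<Longrightarrow> card T \<le> card S"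
    by blast
  have finS: "finite S" using indep[OF S] independent_bound by blast
  have "span S = K"
  proof (rule ccontr)
    assume "span S \<noteq> K"
    then obtain x where x: "x \<in> K" "x \<notin> span S" using S K span_minimal by blast
    define y where "y = x - (\<Sum>s\<in>S. b x s *\<^sub>R s)"
    have sumS: "(\<Sum>s\<in>S. b x s *\<^sub>R s) \<in> span S" by (intro span_sum span_scale span_base)
    then have "y \<noteq> 0" using x by (auto simp: y_def)
    have "y \<in> K" unfolding y_def using x sumS span_minimal[of S K] S K by (auto intro: subspace_diff)
    have yt: "b y t = 0" if "t \<in> S" for t
    proof -
      have "b (\<Sum>s\<in>S. b x s *\<^sub>R s) t = (\<Sum>s\<in>S. b x s * b s t)" by (rule bsum)
      also have "\<dots> = (\<Sum>s\<in>S. if s = t then b x s else 0)" using S that by (intro sum.cong) auto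
      also have "\<dots> = b x t" using finS that by simp
      finally show ?thesis by (simp add: y_def blin)
    qed
    define z where "z = (1 / sqrt (b y y)) *\<^sub>R y"
    have "b z z = 1" using pos[OF \<open>y \<noteq> 0\<close>] by (simp add: z_def blin field_simps)
    moreover have "b z t = 0" "b t z = 0" if "t \<in> S" for t using yt that sym by (simp_all add: z_def blin)
    moreover have "z \<in> K" using \<open>y \<in> K\<close> K by (simp add: z_def subspace_scale)
    ultimately have "?O (insert z S)" "z \<notin> S" using S by force+
    then show False using max[of "insert z S"] finS by simp
  qed
  then show ?thesis using that S indep[OF S] by blast
qed

section \<open>Locality of smoothness, and curves in a fibre\<close>

lemma Ck_on_subset: "Ck_on k S f \<Longrightarrow> T \<subseteq> S \<Longrightarrow> Ck_on k T f"
  by (induction k arbitrary: f) (auto intro: continuous_on_subset)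

lemma frechet_derivative_cong_open:
  assumes "open S" "x \<in> S" "\<And>y. y \<in> S \<Longrightarrow> f y = g y"
  shows "frechet_derivative f (at x) = frechet_derivative g (at x)"
proof -
  have "(f has_derivative D) (at x) \<longleftrightarrow> (g has_derivative D) (at x)" for D
    using assms has_derivative_transform_within_open by metis
  then show ?thesis unfolding frechet_derivative_def by simp
qed

lemma Ck_on_cong:
  assumes "open S" "\<And>x. x \<in> S \<Longrightarrow> f x = g x" "Ck_on k S f"
  shows "Ck_on k S g"
  using assms(2,3)
proof (induction k arbitrary: f g)
  case 0
  then show ?case by (metis Ck_on.simps(1) continuous_on_cong)
next
  case (Suc k)
  have "g differentiable (at x)" if "x \<in> S" for x
    using Suc.prems that assms(1) has_derivative_transform_within_open unfolding Ck_on.simps differentiable_def by metis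
  moreover have "Ck_on k S (\<lambda>x. frechet_derivative g (at x) v)" for v
    by (rule Suc.IH[of "\<lambda>x. frechet_derivative f (at x) v"])
      (use Suc.prems in \<open>auto intro: fun_cong frechet_derivative_cong_open[OF assms(1)]\<close>)
  ultimately show ?case by simp
qed

text \<open>Needed for the projection of \<open>\<psi>\<close> to the base: its smoothness on one
  chart domain is seen only piece by piece, on the domains of the bundle charts.\<close>

lemma Ck_on_UN:
  assumes "\<And>i. i \<in> I \<Longrightarrow> open (S i)" "\<And>i. i \<in> I \<Longrightarrow> Ck_on k (S i) f"
  shows "Ck_on k (\<Union>i\<in>I. S i) f"
  using assms(2)
proof (induction k arbitrary: f)
  case 0
  then show ?case using assms(1) by (auto intro: continuous_on_open_UN)
qed auto

lemma Ck_on_bounded_linear: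
  assumes "bounded_linear L" "open S" "Ck_on k S f"
  shows "Ck_on k S (\<lambda>x. L (f x))"
  using assms(3)
proof (induction k arbitrary: f)
  case 0
  then show ?case using assms(1) by (auto intro: bounded_linear.continuous_on)
next
  case (Suc k)
  have d: "((\<lambda>x. L (f x)) has_derivative (\<lambda>v. L (frechet_derivative f (at x) v))) (at x)" if "x \<in> S" for x
    using Suc.prems that assms(1) by (auto intro: bounded_linear.has_derivative simp: frechet_derivative_works)
  have "Ck_on k S (\<lambda>x. frechet_derivative (\<lambda>x. L (f x)) (at x) v)" for v
    by (rule Ck_on_cong[OF assms(2) _ Suc.IH[of "\<lambda>x. frechet_derivative f (at x) v"]])
      (use Suc.prems frechet_derivative_at[OF d, symmetric] in auto)
  then show ?case using d by (auto simp: differentiable_def)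
qed

lemma smooth_on_differentiable: "smooth_on S f \<Longrightarrow> x \<in> S \<Longrightarrow> f differentiable (at x)"
  unfolding smooth_on_def by (metis Ck_on.simps(2))

lemma smooth_on_deriv: "smooth_on S f \<Longrightarrow> smooth_on S (\<lambda>x. frechet_derivative f (at x) v)"
  unfolding smooth_on_def by (metis Ck_on.simps(2))

lemma smooth_on_continuous: "smooth_on S f \<Longrightarrow> continuous_on S f"
  unfolding smooth_on_def by (metis Ck_on.simps(1))

lemma frechet_works: "f differentiable (at x) \<Longrightarrow> (f has_derivative frechet_derivative f (at x)) (at x)"
  by (simp add: frechet_derivative_works[symmetric])

text \<open>The curve is the preimage of a straight line under
  \<open>x \<mapsto> x + L (f x - f x\<^sub>0 - Df(x\<^sub>0)(x - x\<^sub>0))\<close>, where \<open>L\<close> is a right inverse of \<open>Df(x\<^sub>0)\<close>.\<close>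

lemma curve_in_fibre:
  fixes f :: "'a::euclidean_space \<Rightarrow> 'b::euclidean_space"
  assumes f: "smooth_on S f" and S: "open S" "x0 \<in> S"
    and surj: "surj (frechet_derivative f (at x0))" and X: "frechet_derivative f (at x0) X = 0"
  obtains \<gamma> e where "e > 0" "\<gamma> 0 = x0" "(\<gamma> has_derivative (\<lambda>t. t *\<^sub>R X)) (at 0)"
    "continuous_on {-e<..<e::real} \<gamma>" "\<And>t. t \<in> {-e<..<e} \<Longrightarrow> \<gamma> t \<in> S \<and> f (\<gamma> t) = f x0"
proof -
  define D where "D = (\<lambda>x. frechet_derivative f (at x))"
  have fD: "(f has_derivative D x) (at x)" if "x \<in> S" for x
    unfolding D_def using f that smooth_on_differentiable frechet_works by blast
  have blD: "bounded_linear (D x)" if "x \<in> S" for x using fD[OF that] by (rule has_derivative_bounded_linear)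
  have linD: "linear (D x0)" using blD S bounded_linear.linear by blast
  obtain L where L: "linear L" "D x0 \<circ> L = id"
    using linear_surjective_right_inverse[OF linD] surj unfolding D_def by blast
  have blL: "bounded_linear L" using L linear_conv_bounded_linear by blast
  have DL: "D x0 (L w) = w" for w using L by (metis comp_apply id_apply)
  define G where "G = (\<lambda>x. x + L (f x - f x0 - D x0 (x - x0)))"
  define G' where "G' = (\<lambda>x. Blinfun (\<lambda>v. v + L (D x v - D x0 v)))"
  have blG: "bounded_linear (\<lambda>v. v + L (D x v - D x0 v))" if "x \<in> S" for x
    using blD[OF that] blD[OF S(2)] blL
    by (intro bounded_linear_add bounded_linear_ident bounded_linear_compose[OF blL] bounded_linear_sub)
  have G'a: "blinfun_apply (G' x) = (\<lambda>v. v + L (D x v - D x0 v))" if "x \<in> S" for x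
    unfolding G'_def using blG[OF that] by (rule bounded_linear_Blinfun_apply)
  have derG: "(G has_derivative blinfun_apply (G' x)) (at x)" if "x \<in> S" for x
  proof -
    have "((\<lambda>y. f y - f x0 - D x0 (y - x0)) has_derivative (\<lambda>v. D x v - D x0 v)) (at x)"
      using fD[OF that] blD[OF S(2)]
      by (auto intro!: derivative_eq_intros bounded_linear.has_derivative[OF blD[OF S(2)]])
    then show ?thesis unfolding G'a[OF that] unfolding G_def
      by (intro has_derivative_add has_derivative_ident bounded_linear.has_derivative[OF blL])
  qed
  have contG: "continuous_on S G'"
  proof (rule continuous_on_blinfun_componentwise)
    fix i :: 'a assume "i \<in> Basis"
    have "continuous_on S (\<lambda>x. i + L (D x i - D x0 i))"
      unfolding D_def
      by (intro continuous_intros bounded_linear.continuous_on[OF blL] smooth_on_continuous[OF smooth_on_deriv[OF f]])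
    then show "continuous_on S (\<lambda>x. blinfun_apply (G' x) i)"
      by (rule continuous_on_eq) (simp add: G'a)
  qed
  have Gx0: "G x0 = x0" using linD L by (simp add: G_def linear_0)
  \<comment> \<open>The correction by \<open>L\<close> has derivative zero at \<open>x0\<close>, so
    \<open>G\<close> has the identity as derivative there and is invertible near
    \<open>x0\<close>.\<close>
  have "id_blinfun o\<^sub>L G' x0 = id_blinfun"
    using S L by (auto intro!: blinfun_eqI simp: G'a linear_0)
  from inverse_function_theorem[OF S(1) derG contG S(2) this]
  obtain U V g g' where U: "open U" "U \<subseteq> S" "x0 \<in> U" "open V" "G x0 \<in> V" "homeomorphism U V G g"
    "\<And>y. y \<in> V \<Longrightarrow> (g has_derivative (g' y)) (at y)"
    "\<And>y. y \<in> V \<Longrightarrow> g' y = inv (blinfun_apply (G' (g y)))" by metis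
  have gx0: "g x0 = x0" using U Gx0 by (metis homeomorphism_apply1)
  have "inv (blinfun_apply (G' x0)) = id"
    using S L by (simp add: G'a linear_0 inv_id[unfolded id_def] id_def)
  then have dg: "(g has_derivative id) (at x0)" using U(5) U(7)[of x0] U(8)[of x0] Gx0 gx0 by simp
  have "continuous_on UNIV (\<lambda>t::real. x0 + t *\<^sub>R X)" by (intro continuous_intros)
  then have "open ((\<lambda>t::real. x0 + t *\<^sub>R X) -` V)" using U(4) open_vimage by blast
  moreover have "0 \<in> (\<lambda>t::real. x0 + t *\<^sub>R X) -` V" using U Gx0 by simp
  ultimately obtain e where e: "e > 0" "ball 0 e \<subseteq> (\<lambda>t::real. x0 + t *\<^sub>R X) -` V"
    using open_contains_ball by blast
  then have eV: "x0 + t *\<^sub>R X \<in> V" if "t \<in> {-e<..<e}" for t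
    using that by (auto simp: subset_iff dist_real_def abs_less_iff)
  show ?thesis
  proof (rule that[of e "\<lambda>t. g (x0 + t *\<^sub>R X)"])
    show "((\<lambda>t. g (x0 + t *\<^sub>R X)) has_derivative (\<lambda>t. t *\<^sub>R X)) (at 0)"
      by (rule has_derivative_eq_rhs[OF has_derivative_compose[of "\<lambda>t. x0 + t *\<^sub>R X" "\<lambda>t. t *\<^sub>R X" 0 UNIV g id]])
        (use dg in \<open>auto intro!: derivative_eq_intros\<close>)
    show "continuous_on {-e<..<e} (\<lambda>t. g (x0 + t *\<^sub>R X))"
      by (rule continuous_on_compose2[of V g]) (use U eV in \<open>auto simp: homeomorphism_def intro!: continuous_intros\<close>)
    fix t assume t: "t \<in> {-e<..<e}"
    define y where "y = g (x0 + t *\<^sub>R X)"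
    have "y \<in> S" using U eV[OF t] by (auto simp: y_def homeomorphism_def)
    \<comment> \<open>As \<open>D x0 \<circ> L = id\<close>, the value \<open>D x0 (G y)\<close>
      equals \<open>D x0 x0 + (f y - f x0)\<close>. Along the line it is constantly
      \<open>D x0 x0\<close>, because \<open>X\<close> is in the kernel; hence
      \<open>f y = f x0\<close>.\<close>
    have "G y = x0 + t *\<^sub>R X" unfolding y_def using U eV[OF t] by (metis homeomorphism_apply2)
    then have "D x0 (G y) = D x0 x0 + t *\<^sub>R D x0 X" using linD by (simp add: linear_add linear_cmul)
    moreover have "D x0 X = 0" using X by (simp add: D_def)
    moreover have "D x0 (G y) = D x0 y + (f y - f x0 - D x0 y + D x0 x0)"
      using linD by (simp add: G_def linear_add linear_diff DL)
    ultimately show "g (x0 + t *\<^sub>R X) \<in> S \<and> f (g (x0 + t *\<^sub>R X)) = f x0"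
      using \<open>y \<in> S\<close> by (simp add: y_def)
  qed (use e gx0 in auto)
qed

section \<open>Gram matrices and traces over orthonormal frames\<close>

definition gram :: "(real^'q \<Rightarrow> real^'q \<Rightarrow> real) \<Rightarrow> real^'q^'q" where
  "gram b = (\<chi> i j. b (axis i 1) (axis j 1))"

lemma inner_product_eqI:
  assumes b: "inner_product b" and eq: "\<And>w. b x w = b y w"
  shows "x = y"
proof (rule ccontr)
  assume "x \<noteq> y"
  then have "b (x - y) (x - y) > 0" using b by (simp add: inner_product_def)
  moreover have "b (x - y) (x - y) = 0"
  proof -
    have "b (x - y) (x - y) = b x (x - y) - b y (x - y)"
      using b by (simp add: inner_product_def bilinear_lsub)
    then show ?thesis by (simp add: eq)
  qed
  ultimately show False by simp
qed

text \<open>The coefficients of \<open>z\<close> in an orthonormal basis must be the values of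
  \<open>l\<close> on it. This gives a meaning to the definite description in
  \<open>christoffel\<close>.\<close>

lemma inner_product_riesz:
  assumes b: "inner_product b" and l: "linear l"
  shows "\<exists>!z. \<forall>w. b z w = l w"
proof -
  obtain S where "S \<subseteq> UNIV" and S: "independent S" "span S = UNIV" "\<forall>s\<in>S. \<forall>t\<in>S. b s t = (if s = t then 1 else 0)"
    by (rule inner_product_basis[OF b subspace_UNIV])
  have fin: "finite S" using S(1) independent_bound by blast
  have bil: "bilinear b" using b by (simp add: inner_product_def)
  define z where "z = (\<Sum>s\<in>S. l s *\<^sub>R s)"
  have "b z t = l t" if "t \<in> S" for t
  proof -
    have "b z t = (\<Sum>s\<in>S. l s * b s t)"
      unfolding z_def using linear_sum[of "\<lambda>x. b x t" "\<lambda>s. l s *\<^sub>R s" S] bil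
      by (simp add: bilinear_def bilinear_lmul[OF bil])
    also have "\<dots> = (\<Sum>s\<in>S. if s = t then l s else 0)" using S(3) that by (intro sum.cong) auto
    finally show ?thesis using fin that by simp
  qed
  then have z: "\<forall>w. b z w = l w"
    using linear_eq_on_span[of "b z" l S] l bil S(2) by (auto simp: bilinear_def)
  moreover have "y = z" if "\<forall>w. b y w = l w" for y
    by (rule inner_product_eqI[OF b]) (simp add: that z)
  ultimately show ?thesis by blast
qed

lemma bilinear_axis_expand:
  fixes \<beta> :: "real^'q \<Rightarrow> real^'p \<Rightarrow> 'v::real_vector"
  assumes "bilinear \<beta>"
  shows "\<beta> u v = (\<Sum>i\<in>UNIV. \<Sum>j\<in>UNIV. (u $ i * v $ j) *\<^sub>R \<beta> (axis i 1) (axis j 1))"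
proof -
  have ex: "x = (\<Sum>i\<in>UNIV. x $ i *\<^sub>R axis i 1)" for x :: "real^'n"
    using basis_expansion[of x] by (simp add: scalar_mult_eq_scaleR)
  have lin: "linear (\<lambda>x. \<beta> x y)" "linear (\<beta> x)" for x y using assms by (auto simp: bilinear_def)
  have "\<beta> u v = \<beta> (\<Sum>i\<in>UNIV. u $ i *\<^sub>R axis i 1) v" using ex[of u] by simp
  also have "\<dots> = (\<Sum>i\<in>UNIV. u $ i *\<^sub>R \<beta> (axis i 1) v)"
    using linear_sum[OF lin(1)[of v], of "\<lambda>i. u $ i *\<^sub>R axis i 1" UNIV] linear_cmul[OF lin(1)[of v]] by simp
  also have "\<dots> = (\<Sum>i\<in>UNIV. u $ i *\<^sub>R (\<Sum>j\<in>UNIV. v $ j *\<^sub>R \<beta> (axis i 1) (axis j 1)))"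
  proof -
    have "\<beta> w v = (\<Sum>j\<in>UNIV. v $ j *\<^sub>R \<beta> w (axis j 1))" for w
      using linear_sum[OF lin(2)[of w], of "\<lambda>j. v $ j *\<^sub>R axis j 1" UNIV] linear_cmul[OF lin(2)[of w]]
        ex[of v] by simp
    then show ?thesis by simp
  qed
  finally show ?thesis by (simp add: scaleR_sum_right)
qed

lemma gram_bilinear:
  assumes "bilinear b"
  shows "b u v = u \<bullet> (gram b *v v)"
  unfolding bilinear_axis_expand[OF assms, of u v]
  by (simp add: gram_def inner_vec_def matrix_vector_mult_def sum_distrib_left ac_simps)

lemma invertible_gram:
  assumes "inner_product b"
  shows "invertible (gram b)"
proof -
  have "x = 0" if "gram b *v x = 0" for x
  proof (rule ccontr)
    assume "x \<noteq> 0"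
    then have "b x x > 0" using assms by (simp add: inner_product_def)
    then show False using gram_bilinear[of b x x] assms that by (simp add: inner_product_def)
  qed
  then show ?thesis by (simp add: invertible_left_inverse matrix_left_invertible_ker)
qed

lemma transpose_gram: "inner_product b \<Longrightarrow> transpose (gram b) = gram b"
  by (simp add: gram_def transpose_def inner_product_def vec_eq_iff)

lemma transpose_matrix_inv_gram:
  assumes "inner_product b"
  shows "transpose (matrix_inv (gram b)) = matrix_inv (gram b)"
proof -
  have "matrix_inv (gram b) ** gram b = mat 1"
    using assms by (simp add: invertible_gram matrix_inv_right_left)
  then have "transpose (gram b) ** transpose (matrix_inv (gram b)) = mat 1"
    by (metis matrix_transpose_mul transpose_mat)
  then show ?thesis using matrix_inv_unique transpose_gram[OF assms] by metis
qed

text \<open>It ensures that the choice in \<open>transv_tension\<close> returns a genuine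
  orthonormal frame.\<close>

lemma inner_product_frame:
  fixes b :: "real^'q \<Rightarrow> real^'q \<Rightarrow> real"
  assumes "inner_product b"
  shows "\<exists>e :: 'q \<Rightarrow> real^'q. \<forall>i j. b (e i) (e j) = (if i = j then 1 else 0)"
proof -
  obtain S where "S \<subseteq> UNIV" and S: "independent S" "span S = UNIV" "\<forall>s\<in>S. \<forall>t\<in>S. b s t = (if s = t then 1 else 0)"
    by (rule inner_product_basis[OF assms subspace_UNIV])
  have "card S = CARD('q)" "finite S"
    using dim_eq_card[of S UNIV] S independent_bound[of S] by (auto simp: dim_UNIV)
  then obtain e where e: "bij_betw e (UNIV :: 'q set) S"
    using finite_same_card_bij[of "UNIV :: 'q set" S] by auto
  have "b (e i) (e j) = (if i = j then 1 else 0)" for i j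
    using S(3) e by (auto simp: bij_betw_def inj_eq)
  then show ?thesis by blast
qed

text \<open>If \<open>E\<close> has the columns \<open>e a\<close>, orthonormality reads
  \<open>transpose E ** gram b ** E = mat 1\<close>, so the inverse Gram matrix is
  \<open>E ** transpose E\<close>. The right-hand side does not mention \<open>e\<close>: the trace
  is the same for all frames, in particular for \<open>e\<close> and \<open>J e\<close>.\<close>

lemma frame_trace:
  fixes b :: "real^'q \<Rightarrow> real^'q \<Rightarrow> real" and e :: "'q \<Rightarrow> real^'q" and \<beta> :: "real^'q \<Rightarrow> real^'q \<Rightarrow> 'v::real_vector"
  assumes b: "bilinear b" and e: "\<And>i j. b (e i) (e j) = (if i = j then 1 else 0)"
    and \<beta>: "bilinear \<beta>"
  shows "(\<Sum>a\<in>UNIV. \<beta> (e a) (e a)) =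
    (\<Sum>i\<in>UNIV. \<Sum>j\<in>UNIV. matrix_inv (gram b) $ i $ j *\<^sub>R \<beta> (axis i 1) (axis j 1))"
proof -
  define E :: "real^'q^'q" where "E = (\<chi> i a. e a $ i)"
  have Ecol: "E *v axis a 1 = e a" for a
    by (simp add: E_def matrix_vector_mult_basis column_def vec_eq_iff)
  have "(transpose E ** (gram b ** E)) $ i $ j = e i \<bullet> (gram b *v e j)" for i j
    by (simp add: matrix_matrix_mult_def inner_vec_def transpose_def E_def matrix_vector_mult_def)
  then have "transpose E ** (gram b ** E) = mat 1"
    using e by (simp add: vec_eq_iff gram_bilinear[OF b] mat_def)
  then have "(transpose E ** gram b) ** E = mat 1" by (simp add: matrix_mul_assoc)
  then have "E ** (transpose E ** gram b) = mat 1" using matrix_left_right_inverse by blast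
  then have "(E ** transpose E) ** gram b = mat 1" by (simp add: matrix_mul_assoc)
  then have "gram b ** (E ** transpose E) = mat 1" using matrix_left_right_inverse by blast
  then have inv: "matrix_inv (gram b) = E ** transpose E" by (rule matrix_inv_unique)
  have "(\<Sum>a\<in>UNIV. \<beta> (e a) (e a)) =
      (\<Sum>a\<in>UNIV. \<Sum>i\<in>UNIV. \<Sum>j\<in>UNIV. (e a $ i * e a $ j) *\<^sub>R \<beta> (axis i 1) (axis j 1))"
    by (intro sum.cong refl bilinear_axis_expand[OF \<beta>])
  also have "\<dots> = (\<Sum>i\<in>UNIV. \<Sum>a\<in>UNIV. \<Sum>j\<in>UNIV. (e a $ i * e a $ j) *\<^sub>R \<beta> (axis i 1) (axis j 1))"
    by (rule sum.swap)
  also have "\<dots> = (\<Sum>i\<in>UNIV. \<Sum>j\<in>UNIV. \<Sum>a\<in>UNIV. (e a $ i * e a $ j) *\<^sub>R \<beta> (axis i 1) (axis j 1))"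
    by (intro sum.cong refl sum.swap)
  also have "\<dots> = (\<Sum>i\<in>UNIV. \<Sum>j\<in>UNIV. matrix_inv (gram b) $ i $ j *\<^sub>R \<beta> (axis i 1) (axis j 1))"
    by (simp add: inv matrix_matrix_mult_def E_def transpose_def scaleR_sum_left)
  finally show ?thesis .
qed

section \<open>The trace identity at a point\<close>

lemma bilinear_matrix_family:
  fixes B :: "'a::real_vector \<Rightarrow> real^'q^'r" and C :: "real^'p^'q"
  assumes "linear B"
  shows "bilinear (\<lambda>u v. B u *v (C *v v))"
  unfolding bilinear_def
proof (intro conjI allI)
  show "linear (\<lambda>v. B u *v (C *v v))" for u
    by (simp add: matrix_vector_mul_assoc)
  show "linear (\<lambda>u. B u *v (C *v v))" for v
    using linear_add[OF assms] linear_cmul[OF assms]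
    by (intro linearI) (simp_all add: matrix_vector_mult_add_rdistrib scaleR_matrix_vector_assoc)
qed

text \<open>Dictionary: \<open>b\<close> is the metric, \<open>B u\<close>, \<open>V u\<close> and
  \<open>K u\<close> are the covariant derivatives of \<open>A\<close>, \<open>P\<close> and
  \<open>J\<close> along \<open>u\<close>, and \<open>K0\<close> says that \<open>J\<close> is
  divergence-free. The cancellations rest on one device: a trace over \<open>e\<close> may be
  computed over \<open>J e\<close> instead, and for each unwanted sum this returns its own
  negative.\<close>

lemma tension_core:
  fixes b :: "real^'q \<Rightarrow> real^'q \<Rightarrow> real" and e :: "'q \<Rightarrow> real^'q" and J :: "real^'q^'q" and A :: "real^'q^'r" and P :: "real^'r^'r"
  assumes b: "bilinear b" and e: "\<And>i j. b (e i) (e j) = (if i = j then 1 else 0)"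
    and Jb: "\<And>u v. b (J *v u) (J *v v) = b u v"
    and J2: "J ** J = - mat 1" and P2: "P ** P = - mat 1"
    and lin: "linear B" "linear V"
    and AJ: "A ** J = P ** A"
    and comm: "\<And>u. B u ** J + A ** K u = V u ** A + P ** B u"
    and sym: "\<And>u v. B u *v v = B v *v u"
    and VJ: "\<And>u. V (J *v u) = - (P ** V u)"
    and VP: "\<And>u. V u ** P = - (P ** V u)"
    and KJ: "\<And>u. K u ** J = - (J ** K u)"
    and K0: "(\<Sum>a\<in>UNIV. K (e a) *v e a) = 0"
  shows "(\<Sum>a\<in>UNIV. B (e a) *v e a) = 0"
proof -
  have neg: "(- X) *v x = - (X *v x)" for X :: "real^'n^'m" and x
    using matrix_vector_mult_diff_rdistrib[of 0 X x] by simp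
  have zero: "x = - x \<Longrightarrow> x = 0" for x :: "real^'r" by (simp add: vec_eq_iff)
  have J2v: "J *v (J *v x) = - x" for x by (simp add: matrix_vector_mul_assoc J2 neg)
  have P2v: "P *v (P *v x) = - x" for x by (simp add: matrix_vector_mul_assoc P2 neg)
  have AJv: "A *v (J *v x) = P *v (A *v x)" for x by (simp add: matrix_vector_mul_assoc AJ)
  have VPv: "V u *v (P *v x) = - (P *v (V u *v x))" for u x
    by (simp add: matrix_vector_mul_assoc VP neg)
  have KJv: "K u *v (J *v x) = - (J *v (K u *v x))" for u x
    by (simp add: matrix_vector_mul_assoc KJ neg)
  have Je: "b (J *v e i) (J *v e j) = (if i = j then 1 else 0)" for i j by (simp add: Jb e)
  have inv: "(\<Sum>a\<in>UNIV. \<beta> (J *v e a) (J *v e a)) = (\<Sum>a\<in>UNIV. \<beta> (e a) (e a))"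
    if "bilinear \<beta>" for \<beta> :: "real^'q \<Rightarrow> real^'q \<Rightarrow> real^'r"
    using frame_trace[OF b e that] frame_trace[OF b Je that] by metis
  \<comment> \<open>Passing to \<open>J e\<close> gives terms
    \<open>B (J e) (J (J e)) = - B (J e) e\<close>, and the symmetry of \<open>B\<close> turns these
    into \<open>- B e (J e)\<close>.\<close>
  have BJ: "(\<Sum>a\<in>UNIV. B (e a) *v (J *v e a)) = 0"
  proof -
    have "(\<Sum>a\<in>UNIV. B (e a) *v (J *v e a)) = (\<Sum>a\<in>UNIV. B (J *v e a) *v (J *v (J *v e a)))"
      using inv[OF bilinear_matrix_family[OF lin(1), of J]] by simp
    also have "\<dots> = (\<Sum>a\<in>UNIV. - (B (e a) *v (J *v e a)))"
      by (intro sum.cong refl) (metis J2v sym vec.neg)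
    finally have "(\<Sum>a\<in>UNIV. B (e a) *v (J *v e a)) = - (\<Sum>a\<in>UNIV. B (e a) *v (J *v e a))"
      by (simp add: sum_negf)
    then show ?thesis by (rule zero)
  qed
  \<comment> \<open>Here \<open>V (J e) A J e = - P V P A e\<close>. Moving \<open>P\<close> through
    \<open>V\<close> costs a sign and \<open>P^2 = -1\<close> another, so the result is
    \<open>- V A e\<close>.\<close>
  have VA: "(\<Sum>a\<in>UNIV. V (e a) *v (A *v e a)) = 0"
  proof -
    have "(\<Sum>a\<in>UNIV. V (e a) *v (A *v e a)) = (\<Sum>a\<in>UNIV. V (J *v e a) *v (A *v (J *v e a)))"
      using inv[OF bilinear_matrix_family[OF lin(2), of A]] by simp
    also have "\<dots> = (\<Sum>a\<in>UNIV. - (V (e a) *v (A *v e a)))"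
    proof (intro sum.cong refl)
      fix a
      have "V (J *v e a) *v (A *v (J *v e a)) = - (P *v (V (e a) *v (P *v (A *v e a))))"
        by (simp add: VJ AJv neg flip: matrix_vector_mul_assoc)
      then show "V (J *v e a) *v (A *v (J *v e a)) = - (V (e a) *v (A *v e a))"
        by (simp add: VPv P2v vec.neg)
    qed
    finally have "(\<Sum>a\<in>UNIV. V (e a) *v (A *v e a)) = - (\<Sum>a\<in>UNIV. V (e a) *v (A *v e a))"
      by (simp add: sum_negf)
    then show ?thesis by (rule zero)
  qed
  \<comment> \<open>This is \<open>comm\<close> evaluated on \<open>J e\<close>, with every
    \<open>J\<close> and \<open>P\<close> moved to the left; its summed form contains the two traces
    just shown to vanish.\<close>
  have eq: "- (B (e a) *v e a) - A *v (J *v (K (e a) *v e a)) =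
      - (P *v (V (e a) *v (A *v e a))) + P *v (B (e a) *v (J *v e a))" for a
  proof -
    have "(B (e a) ** J + A ** K (e a)) *v (J *v e a) = (V (e a) ** A + P ** B (e a)) *v (J *v e a)"
      by (simp only: comm)
    then have "B (e a) *v (J *v (J *v e a)) + A *v (K (e a) *v (J *v e a)) =
        V (e a) *v (A *v (J *v e a)) + P *v (B (e a) *v (J *v e a))"
      by (simp add: matrix_vector_mult_add_rdistrib matrix_vector_mul_assoc[symmetric])
    then show ?thesis by (simp add: J2v KJv AJv VPv vec.neg)
  qed
  have sumP: "(\<Sum>a\<in>UNIV. X *v f a) = X *v (\<Sum>a\<in>UNIV. f a)" for X :: "real^'n^'m" and f :: "'q \<Rightarrow> real^'n"
    by (simp add: linear_sum)
  have "(\<Sum>a\<in>UNIV. - (B (e a) *v e a) - A *v (J *v (K (e a) *v e a))) =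
    (\<Sum>a\<in>UNIV. - (P *v (V (e a) *v (A *v e a))) + P *v (B (e a) *v (J *v e a)))"
    by (simp only: eq)
  then have "- (\<Sum>a\<in>UNIV. B (e a) *v e a) = 0"
    by (simp add: sum_subtractf sum.distrib sum_negf sumP K0 VA BJ)
  then show ?thesis by simp
qed

text \<open>Read \<open>d u v w\<close> as the derivative of \<open>h v w\<close> in direction
  \<open>u\<close>, for constant \<open>v\<close> and \<open>w\<close>. Adding the Koszul formulas
  for \<open>h (\<Gamma> u v) w\<close> and \<open>h v (\<Gamma> u w)\<close> leaves
  \<open>d u v w\<close>, since the other terms cancel by the symmetry of \<open>d u\<close>; this
  is metric compatibility. Symmetry of \<open>\<Gamma>\<close> is the absence of torsion.\<close>

lemma koszul:
  fixes h :: "real^'q \<Rightarrow> real^'q \<Rightarrow> real" and d :: "real^'q \<Rightarrow> real^'q \<Rightarrow> real^'q \<Rightarrow> real"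
  defines "\<Gamma> \<equiv> \<lambda>u v. THE z. \<forall>w. h z w = (d u v w + d v u w - d w u v) / 2"
  assumes h: "inner_product h"
    and d: "\<And>v w. linear (\<lambda>u. d u v w)" "\<And>u. bilinear (d u)" "\<And>u v w. d u v w = d u w v"
  shows "\<Gamma> u v = \<Gamma> v u" "d u v w = h (\<Gamma> u v) w + h v (\<Gamma> u w)" "bilinear \<Gamma>"
proof -
  have dl: "linear (\<lambda>w. d u v w)" "linear (\<lambda>v. d u v w)" for u v w using d(2) by (auto simp: bilinear_def)
  have lin: "linear (\<lambda>w. (d u v w + d v u w - d w u v) / 2)" for u v
    by (intro linearI) (simp_all add: linear_add[OF dl(1)] linear_add[OF d(1)] linear_cmul[OF dl(1)]
        linear_cmul[OF d(1)] field_simps)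
  have \<Gamma>: "h (\<Gamma> u v) w = (d u v w + d v u w - d w u v) / 2" for u v w
    unfolding \<Gamma>_def using theI'[OF inner_product_riesz[OF h lin]] by blast
  have hs: "h u v = h v u" for u v using h by (simp add: inner_product_def)
  have hb: "bilinear h" using h by (simp add: inner_product_def)
  show sym: "\<Gamma> u v = \<Gamma> v u" for u v
    by (rule inner_product_eqI[OF h]) (simp add: \<Gamma> d(3)[of _ u v])
  show "d u v w = h (\<Gamma> u v) w + h v (\<Gamma> u w)"
    by (subst hs[of v]) (simp add: \<Gamma> d(3)[of u w v] d(3)[of v] d(3)[of w] add_divide_distrib diff_divide_distrib)
  have l: "linear (\<lambda>u. \<Gamma> u v)" for v
  proof (intro linearI; rule inner_product_eqI[OF h])
    show "h (\<Gamma> (x + y) v) w = h (\<Gamma> x v + \<Gamma> y v) w" for x y w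
      by (simp add: bilinear_ladd[OF hb] \<Gamma> linear_add[OF dl(1)] linear_add[OF dl(2)] linear_add[OF d(1)] field_simps)
    show "h (\<Gamma> (c *\<^sub>R x) v) w = h (c *\<^sub>R \<Gamma> x v) w" for c x w
      by (simp add: bilinear_lmul[OF hb] \<Gamma> linear_cmul[OF dl(1)] linear_cmul[OF dl(2)] linear_cmul[OF d(1)] field_simps)
  qed
  moreover have "linear (\<Gamma> u)" for u using l[of u] sym by (metis (no_types, lifting) ext)
  ultimately show "bilinear \<Gamma>" by (simp add: bilinear_def)
qed

section \<open>The fundamental 2-vector and its divergence at a point\<close>

text \<open>Multiplying the orthogonality relation by \<open>J\<close> from the right and using
  \<open>J^2 = -1\<close> gives skewness. The last form is the same for the inverse metric, which is
  what enters the 2-vector.\<close>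

lemma inner_product_orthogonal_matrix:
  fixes b :: "real^'q \<Rightarrow> real^'q \<Rightarrow> real"
  assumes b: "inner_product b" and J: "\<And>u v. b (J *v u) (J *v v) = b u v" and J2: "J ** J = - mat 1"
  shows "transpose J ** gram b ** J = gram b" "transpose J ** gram b = - (gram b ** J)"
    "matrix_inv (gram b) ** transpose J = - (J ** matrix_inv (gram b))"
proof -
  have bil: "bilinear b" using b by (simp add: inner_product_def)
  have "(transpose J ** gram b ** J) *v v = gram b *v v" for v
  proof (rule vector_eq_rdot[THEN iffD1], intro allI)
    fix u
    have "(J *v u) \<bullet> (gram b *v (J *v v)) = u \<bullet> (gram b *v v)"
      using J[of u v] by (simp add: gram_bilinear[OF bil])
    then show "((transpose J ** gram b ** J) *v v) \<bullet> u = (gram b *v v) \<bullet> u"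
      by (metis dot_lmul_matrix inner_commute matrix_vector_mul_assoc transpose_matrix_vector vector_transpose_matrix)
  qed
  then show 1: "transpose J ** gram b ** J = gram b" by (simp add: matrix_eq)
  have "transpose J ** gram b ** (J ** J) = gram b ** J"
    using 1 by (metis matrix_mul_assoc)
  moreover have "X ** (- mat 1) = - X" for X :: "real^'q^'q"
    using linear_neg[OF linear_matrix_mult_right, of X "mat 1"] by simp
  ultimately have "- (transpose J ** gram b) = gram b ** J" by (simp add: J2)
  then show 2: "transpose J ** gram b = - (gram b ** J)" by (metis minus_minus)
  have inv: "gram b ** matrix_inv (gram b) = mat 1" "matrix_inv (gram b) ** gram b = mat 1"
    using matrix_inv_right_left[OF invertible_gram[OF b]] by auto
  have "matrix_inv (gram b) ** transpose J = matrix_inv (gram b) ** (transpose J ** gram b) ** matrix_inv (gram b)"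
    by (metis inv(1) matrix_mul_assoc matrix_mul_rid)
  also have "\<dots> = - (matrix_inv (gram b) ** gram b ** J ** matrix_inv (gram b))"
    unfolding 2 using linear_neg[OF linear_matrix_mult_right] linear_neg[OF linear_matrix_mult_left]
    by (metis matrix_mul_assoc)
  also have "\<dots> = - (J ** matrix_inv (gram b))" by (simp add: inv)
  finally show "matrix_inv (gram b) ** transpose J = - (J ** matrix_inv (gram b))" .
qed

text \<open>Since \<open>A\<close> is antisymmetric, \<open>X \<otimes> Y\<close> and
  \<open>- Y \<otimes> X\<close> contribute equally, which cancels the factor 1/2 in
  \<open>nmetric2\<close>.\<close>

lemma nmetric2_wedge:
  assumes b: "inner_product (nmetric F p)" and A: "transpose A = - A"
  defines "G \<equiv> gram (nmetric F p)"
  shows "nmetric2 F p A (wedge X Y) = (G *v X) \<bullet> (A *v (G *v Y))"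
proof -
  have g: "nmetric F p (axis i 1) (axis j 1) = G $ i $ j" for i j by (simp add: G_def gram_def)
  have quad: "(\<Sum>a\<in>UNIV. \<Sum>b\<in>UNIV. \<Sum>c\<in>UNIV. \<Sum>d\<in>UNIV. A $ a $ b * (X $ c * Y $ d) * G $ a $ c * G $ b $ d) =
      (G *v X) \<bullet> (A *v (G *v Y))" for X Y
  proof -
    have "(\<Sum>c\<in>UNIV. \<Sum>d\<in>UNIV. A $ a $ b * (X $ c * Y $ d) * G $ a $ c * G $ b $ d) =
      (G *v X) $ a * (A $ a $ b * (G *v Y) $ b)" for a b
    proof -
      have "(G *v X) $ a * (A $ a $ b * (G *v Y) $ b) =
        A $ a $ b * ((\<Sum>c\<in>UNIV. G $ a $ c * X $ c) * (\<Sum>d\<in>UNIV. G $ b $ d * Y $ d))"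
        by (simp add: matrix_vector_mult_def)
      also have "\<dots> = (\<Sum>c\<in>UNIV. \<Sum>d\<in>UNIV. A $ a $ b * (X $ c * Y $ d) * G $ a $ c * G $ b $ d)"
        by (subst sum_product) (simp add: sum_distrib_left algebra_simps)
      finally show ?thesis by simp
    qed
    then show ?thesis by (simp add: inner_vec_def matrix_vector_mult_def sum_distrib_left)
  qed
  have "nmetric2 F p A (wedge X Y) = ((G *v X) \<bullet> (A *v (G *v Y)) - (G *v Y) \<bullet> (A *v (G *v X))) / 2"
    unfolding quad[symmetric] nmetric2_def wedge_def g
    by (simp add: algebra_simps sum_subtractf)
  also have "(G *v Y) \<bullet> (A *v (G *v X)) = - ((G *v X) \<bullet> (A *v (G *v Y)))"
  proof -
    have "(G *v Y) \<bullet> (A *v (G *v X)) = (transpose A *v (G *v Y)) \<bullet> (G *v X)"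
      by (simp add: dot_lmul_matrix)
    then show ?thesis
      using matrix_vector_mult_diff_rdistrib[of 0 A "G *v Y"] by (simp add: A inner_commute)
  qed
  finally show ?thesis by simp
qed

text \<open>For this matrix the pairing with \<open>wedge X Y\<close> becomes
  \<open>- g(X, J Y)\<close>, which is \<open>g(J X, Y)\<close> because \<open>J\<close> is skew.
  Uniqueness holds because the Gram matrix is onto, so the pairings determine all entries.\<close>

lemma fundamental_2vector_eq:
  fixes F :: "('i, 'a, 't, 'q::finite) foliation"
  assumes b: "inner_product (nmetric F p)"
    and J: "\<And>u v. nmetric F p (J p *v u) (J p *v v) = nmetric F p u v" and J2: "J p ** J p = - mat 1"
  shows "fundamental_2vector F J p = - (J p ** matrix_inv (gram (nmetric F p)))"
    and "transpose (fundamental_2vector F J p) = - fundamental_2vector F J p"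
proof -
  let ?G = "gram (nmetric F p)"
  define A where "A = - (J p ** matrix_inv ?G)"
  note Jm = inner_product_orthogonal_matrix[OF b J J2]
  have inv: "?G ** matrix_inv ?G = mat 1" "matrix_inv ?G ** ?G = mat 1"
    using matrix_inv_right_left[OF invertible_gram[OF b]] by auto
  have tA: "transpose A = - A"
  proof -
    have "transpose A = - (transpose (J p ** matrix_inv ?G))" by (simp add: A_def transpose_def vec_eq_iff)
    also have "\<dots> = - (matrix_inv ?G ** transpose (J p))"
      by (simp add: matrix_transpose_mul transpose_matrix_inv_gram[OF b])
    finally show ?thesis by (simp add: Jm A_def)
  qed
  have bil: "bilinear (nmetric F p)" using b by (simp add: inner_product_def)
  have val: "nmetric2 F p A (wedge X Y) = nmetric F p (J p *v X) Y" for X Y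
  proof -
    have "nmetric2 F p A (wedge X Y) = (?G *v X) \<bullet> (A *v (?G *v Y))"
      by (rule nmetric2_wedge[OF b tA])
    also have "A *v (?G *v Y) = - (J p *v Y)"
    proof -
      have "A *v (?G *v Y) = - ((J p ** (matrix_inv ?G ** ?G)) *v Y)"
        using matrix_vector_mult_diff_rdistrib[of 0 "J p ** matrix_inv ?G" "?G *v Y"]
        by (simp add: A_def matrix_vector_mul_assoc matrix_mul_assoc)
      then show ?thesis by (simp add: inv)
    qed
    also have "(?G *v X) \<bullet> - (J p *v Y) = - nmetric F p (J p *v Y) X"
      by (simp add: gram_bilinear[OF bil] inner_commute)
    also have "nmetric F p (J p *v Y) X = - nmetric F p (J p *v X) Y"
    proof -
      have "nmetric F p (J p *v (J p *v Y)) (J p *v X) = nmetric F p (J p *v Y) X" by (rule J)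
      moreover have "J p *v (J p *v Y) = - Y"
        using matrix_vector_mult_diff_rdistrib[of 0 "mat 1" Y] by (simp add: matrix_vector_mul_assoc J2)
      ultimately show ?thesis using b bilinear_lneg[OF bil, of Y] unfolding inner_product_def by metis
    qed
    finally show ?thesis by simp
  qed
  have uniq: "B = A" if B: "transpose B = - B" "\<forall>X Y. nmetric2 F p B (wedge X Y) = nmetric F p (J p *v X) Y" for B
  proof -
    have surj: "?G *v (matrix_inv ?G *v Y) = Y" for Y by (simp add: matrix_vector_mul_assoc inv)
    have "(?G *v X) \<bullet> (B *v (?G *v Y)) = (?G *v X) \<bullet> (A *v (?G *v Y))" for X Y
      using B val nmetric2_wedge[OF b B(1)] nmetric2_wedge[OF b tA] by metis
    then have "X \<bullet> (B *v Y) = X \<bullet> (A *v Y)" for X Y using surj by metis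
    then have "B *v Y = A *v Y" for Y using vector_eq_ldot by blast
    then show ?thesis by (simp add: matrix_eq)
  qed
  have "fundamental_2vector F J p = A"
    unfolding fundamental_2vector_def
  proof (rule the_equality)
    show "transpose A = - A \<and> (\<forall>X Y. nmetric2 F p A (wedge X Y) = nmetric F p (J p *v X) Y)"
      using tA val by blast
  qed (use uniq in blast)
  then show "fundamental_2vector F J p = - (J p ** matrix_inv ?G)"
    "transpose (fundamental_2vector F J p) = - fundamental_2vector F J p"
    using tA by (simp_all add: A_def)
qed

text \<open>The tensor in \<open>nabla_fundamental\<close> is \<open>D\<close> with its argument
  index raised: the condition forces the slice \<open>N $ c\<close> to be the value of
  \<open>D\<close> at the vector whose metric dual is the coordinate \<open>c\<close>.\<close>

lemma metric_tensor_contraction: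
  fixes G :: "real^'q^'q" and D :: "real^'q \<Rightarrow> real^'q^'q"
  assumes G: "invertible G" and D: "linear D"
  shows "(THE N. \<forall>u. (\<Sum>c\<in>UNIV. (G *v u) $ c *\<^sub>R N $ c) = D u) = (\<chi> c. D (matrix_inv G *v axis c 1))"
proof (rule the_equality)
  note inv = matrix_inv_right_left[OF G]
  show "\<forall>u. (\<Sum>c\<in>UNIV. (G *v u) $ c *\<^sub>R (\<chi> c. D (matrix_inv G *v axis c 1)) $ c) = D u"
  proof
    fix u
    let ?L = "\<lambda>x. D (matrix_inv G *v x)"
    have L: "linear ?L" using linear_compose[OF matrix_vector_mul_linear D] by (simp add: o_def)
    have "(\<Sum>c\<in>UNIV. (G *v u) $ c *\<^sub>R ?L (axis c 1)) = ?L (\<Sum>c\<in>UNIV. (G *v u) $ c *\<^sub>R axis c 1)"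
      unfolding linear_sum[OF L] linear_cmul[OF L] ..
    also have "(\<Sum>c\<in>UNIV. (G *v u) $ c *\<^sub>R axis c 1) = G *v u"
      using basis_expansion[of "G *v u"] by (simp add: scalar_mult_eq_scaleR)
    finally show "(\<Sum>c\<in>UNIV. (G *v u) $ c *\<^sub>R (\<chi> c. ?L (axis c 1)) $ c) = D u"
      by (simp add: matrix_vector_mul_assoc inv)
  qed
  fix N assume N: "\<forall>u. (\<Sum>c\<in>UNIV. (G *v u) $ c *\<^sub>R N $ c) = D u"
  have "N $ d = D (matrix_inv G *v axis d 1)" for d
  proof -
    have "G *v (matrix_inv G *v axis d 1) = axis d 1" by (simp add: matrix_vector_mul_assoc inv)
    then have "D (matrix_inv G *v axis d 1) = (\<Sum>c\<in>UNIV. axis d 1 $ c *\<^sub>R N $ c)"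
      using N by metis
    also have "\<dots> = (\<Sum>c\<in>UNIV. if c = d then N $ c else 0)"
      by (intro sum.cong refl) (simp add: axis_def)
    finally show ?thesis by simp
  qed
  then show "N = (\<chi> c. D (matrix_inv G *v axis c 1))" by (simp add: vec_eq_iff)
qed

lemma sum_swap_last:
  fixes f :: "'i \<Rightarrow> 'j \<Rightarrow> 'k \<Rightarrow> 'v::comm_monoid_add"
  shows "(\<Sum>x\<in>X. \<Sum>y\<in>Y. \<Sum>z\<in>Z. f x y z) = (\<Sum>z\<in>Z. \<Sum>x\<in>X. \<Sum>y\<in>Y. f x y z)"
proof -
  have "(\<Sum>y\<in>Y. \<Sum>z\<in>Z. f x y z) = (\<Sum>z\<in>Z. \<Sum>y\<in>Y. f x y z)" for x by (rule sum.swap)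
  then have "(\<Sum>x\<in>X. \<Sum>y\<in>Y. \<Sum>z\<in>Z. f x y z) = (\<Sum>x\<in>X. \<Sum>z\<in>Z. \<Sum>y\<in>Y. f x y z)" by simp
  then show ?thesis using sum.swap[of "\<lambda>x z. \<Sum>y\<in>Y. f x y z" Z X] by simp
qed

lemma sum_swap_first:
  fixes f :: "'h \<Rightarrow> 'i \<Rightarrow> 'j \<Rightarrow> 'k \<Rightarrow> 'v::comm_monoid_add"
  shows "(\<Sum>a\<in>A. \<Sum>x\<in>X. \<Sum>y\<in>Y. \<Sum>z\<in>Z. f a x y z) = (\<Sum>x\<in>X. \<Sum>y\<in>Y. \<Sum>z\<in>Z. \<Sum>a\<in>A. f a x y z)"
proof -
  have "(\<Sum>x\<in>X. \<Sum>y\<in>Y. \<Sum>z\<in>Z. \<Sum>a\<in>A. f a x y z) = (\<Sum>x\<in>X. \<Sum>a\<in>A. \<Sum>y\<in>Y. \<Sum>z\<in>Z. f a x y z)"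
    by (intro sum.cong refl sum_swap_last)
  then show ?thesis using sum.swap[of "\<lambda>a x. \<Sum>y\<in>Y. \<Sum>z\<in>Z. f a x y z" X A] by simp
qed

text \<open>As \<open>J\<close> is \<open>g\<close>-orthogonal, contracting the first two projections with \<open>g\<close> gives \<open>(g \<plusminus> \<i> g J) / 2\<close>, and the
  imaginary parts of the two summands cancel.\<close>

lemma trace_D2_real:
  fixes N :: "real^'q^'q^'q" and J G :: "real^'q^'q"
  assumes J: "transpose J ** G ** J = G" "transpose J ** G = - (G ** J)"
  shows "(\<Sum>c\<in>UNIV. \<Sum>a\<in>UNIV. of_real (G $ c $ a) *
      (tensor3_apply (proj10 J) (proj01 J) (proj01 J) N + tensor3_apply (proj01 J) (proj10 J) (proj10 J) N) $ c $ a $ b)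
    = of_real ((\<Sum>c\<in>UNIV. \<Sum>a\<in>UNIV. G $ c $ a * N $ c $ a $ b) / 2 -
        (\<Sum>e\<in>UNIV. J $ b $ e * (\<Sum>c\<in>UNIV. \<Sum>a\<in>UNIV. (G ** J) $ c $ a * N $ c $ a $ e)) / 2)"
proof -
  have tGJ: "(\<Sum>c\<in>UNIV. J $ c $ x * G $ c $ y) = - (G ** J) $ x $ y" for x y
    using arg_cong[OF J(2), of "\<lambda>M. M $ x $ y"] by (simp add: matrix_matrix_mult_def transpose_def)
  have GJ: "(\<Sum>a\<in>UNIV. G $ x $ a * J $ a $ y) = (G ** J) $ x $ y" for x y
    by (simp add: matrix_matrix_mult_def)
  have JGJ: "(\<Sum>c\<in>UNIV. \<Sum>a\<in>UNIV. J $ c $ x * G $ c $ a * J $ a $ y) = G $ x $ y" for x y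
  proof -
    have "(\<Sum>c\<in>UNIV. \<Sum>a\<in>UNIV. J $ c $ x * G $ c $ a * J $ a $ y) = (transpose J ** G ** J) $ x $ y"
      unfolding matrix_matrix_mult_def transpose_def
      by (simp add: sum_distrib_right) (rule sum.swap)
    then show ?thesis by (simp only: J(1))
  qed
  define d :: "'q \<Rightarrow> 'q \<Rightarrow> complex" where "d = (\<lambda>a b. if a = b then 1 else 0)"
  have dsum: "(\<Sum>c\<in>UNIV. d c x * f c) = f x" for f x
  proof -
    have "d c x * f c = (if c = x then f c else 0)" for c by (simp add: d_def)
    then show ?thesis by simp
  qed
  \<comment> \<open>The sign \<open>s\<close> covers both type pairs: \<open>s = 1\<close> contracts
    \<open>proj10\<close> with \<open>proj01\<close>, and \<open>s = -1\<close> the reverse.\<close>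
  have contr: "(\<Sum>c\<in>UNIV. \<Sum>a\<in>UNIV. of_real (G $ c $ a) * ((d c x - s * \<i> * of_real (J $ c $ x)) / 2) *
      ((d a y + s * \<i> * of_real (J $ a $ y)) / 2)) = (of_real (G $ x $ y) + s * \<i> * of_real ((G ** J) $ x $ y)) / 2"
    if s: "s * s = 1" for s :: complex and x y
  proof -
    have "of_real (G $ c $ a) * ((d c x - s * \<i> * of_real (J $ c $ x)) / 2) * ((d a y + s * \<i> * of_real (J $ a $ y)) / 2)
      = (d c x * (d a y * of_real (G $ c $ a)) + s * \<i> * (d c x * of_real (G $ c $ a * J $ a $ y))
       - s * \<i> * (d a y * of_real (J $ c $ x * G $ c $ a)) + of_real (J $ c $ x * G $ c $ a * J $ a $ y)) / 4" for c a
    proof -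
      have "(s * \<i>) * (s * \<i>) = -1" using s by (simp add: algebra_simps)
      moreover have "g * ((p - t * j) / 2) * ((q + t * k) / 2) =
         (p * (q * g) + t * (p * (g * k)) - t * (q * (j * g)) + j * g * k) / 4" if "t * t = -1" for t g p q j k :: complex
      proof -
        have "g * ((p - t * j) / 2) * ((q + t * k) / 2) =
         (p * (q * g) + t * (p * (g * k)) - t * (q * (j * g)) - (t * t) * (j * g * k)) / 4"
          by (simp add: field_simps)
        then show ?thesis by (simp add: that)
      qed
      ultimately show ?thesis by simp
    qed
    then have e0: "(\<Sum>c\<in>UNIV. \<Sum>a\<in>UNIV. of_real (G $ c $ a) * ((d c x - s * \<i> * of_real (J $ c $ x)) / 2) *
      ((d a y + s * \<i> * of_real (J $ a $ y)) / 2)) =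
      ((\<Sum>c\<in>UNIV. d c x * (\<Sum>a\<in>UNIV. d a y * of_real (G $ c $ a)))
       + s * \<i> * (\<Sum>c\<in>UNIV. d c x * of_real (\<Sum>a\<in>UNIV. G $ c $ a * J $ a $ y))
       - s * \<i> * (\<Sum>a\<in>UNIV. d a y * of_real (\<Sum>c\<in>UNIV. J $ c $ x * G $ c $ a))
       + of_real (\<Sum>c\<in>UNIV. \<Sum>a\<in>UNIV. J $ c $ x * G $ c $ a * J $ a $ y)) / 4"
      by (simp add: sum.distrib sum_subtractf sum_distrib_left sum_divide_distrib[symmetric])
        (rule sum.swap)
    have e1: "(\<Sum>c\<in>UNIV. d c x * (\<Sum>a\<in>UNIV. d a y * of_real (G $ c $ a))) = of_real (G $ x $ y)"
    proof -
      have "(\<Sum>c\<in>UNIV. d c x * (\<Sum>a\<in>UNIV. d a y * of_real (G $ c $ a))) = (\<Sum>a\<in>UNIV. d a y * of_real (G $ x $ a))"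
        using dsum[of x "\<lambda>c. \<Sum>a\<in>UNIV. d a y * of_real (G $ c $ a)"] .
      also have "\<dots> = of_real (G $ x $ y)"
        using dsum[of y "\<lambda>a. of_real (G $ x $ a)"] .
      finally show ?thesis .
    qed
    have e2: "(\<Sum>c\<in>UNIV. d c x * of_real (\<Sum>a\<in>UNIV. G $ c $ a * J $ a $ y)) = of_real ((G ** J) $ x $ y)"
      using dsum[of x "\<lambda>c. of_real (\<Sum>a\<in>UNIV. G $ c $ a * J $ a $ y)"] unfolding GJ .
    have e3: "(\<Sum>a\<in>UNIV. d a y * of_real (\<Sum>c\<in>UNIV. J $ c $ x * G $ c $ a)) = - of_real ((G ** J) $ x $ y)"
      using dsum[of y "\<lambda>a. of_real (\<Sum>c\<in>UNIV. J $ c $ x * G $ c $ a)"] unfolding tGJ of_real_minus .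
    have e4: "(of_real (G $ x $ y) + s * \<i> * of_real ((G ** J) $ x $ y) - s * \<i> * - of_real ((G ** J) $ x $ y) +
        of_real (\<Sum>c\<in>UNIV. \<Sum>a\<in>UNIV. J $ c $ x * G $ c $ a * J $ a $ y)) / 4 =
      (of_real (G $ x $ y) + s * \<i> * of_real ((G ** J) $ x $ y)) / 2"
      unfolding JGJ by (simp add: field_simps)
    show ?thesis unfolding e0 e1 e2 e3 by (rule e4)
  qed
  have c1: "(\<Sum>c\<in>UNIV. \<Sum>a\<in>UNIV. of_real (G $ c $ a) * proj10 J $ c $ x * proj01 J $ a $ y) =
      (of_real (G $ x $ y) + \<i> * of_real ((G ** J) $ x $ y)) / 2" for x y
    using contr[of 1 x y] by (simp add: proj10_def proj01_def d_def)
  have c2: "(\<Sum>c\<in>UNIV. \<Sum>a\<in>UNIV. of_real (G $ c $ a) * proj01 J $ c $ x * proj10 J $ a $ y) =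
      (of_real (G $ x $ y) - \<i> * of_real ((G ** J) $ x $ y)) / 2" for x y
    using contr[of "-1" x y] by (simp add: proj10_def proj01_def d_def)
  have T: "(\<Sum>c\<in>UNIV. \<Sum>a\<in>UNIV. of_real (G $ c $ a) * tensor3_apply A B C N $ c $ a $ b) =
    (\<Sum>x\<in>UNIV. \<Sum>y\<in>UNIV. \<Sum>e\<in>UNIV. (\<Sum>c\<in>UNIV. \<Sum>a\<in>UNIV. of_real (G $ c $ a) * A $ c $ x * B $ a $ y)
      * C $ b $ e * of_real (N $ x $ y $ e))" for A B C
  proof -
    have "(\<Sum>c\<in>UNIV. \<Sum>a\<in>UNIV. of_real (G $ c $ a) * tensor3_apply A B C N $ c $ a $ b) =
      (\<Sum>c\<in>UNIV. \<Sum>a\<in>UNIV. \<Sum>x\<in>UNIV. \<Sum>y\<in>UNIV. \<Sum>e\<in>UNIV.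
        of_real (G $ c $ a) * A $ c $ x * B $ a $ y * C $ b $ e * of_real (N $ x $ y $ e))"
      by (simp add: tensor3_apply_def sum_distrib_left mult.assoc)
    also have "\<dots> = (\<Sum>c\<in>UNIV. \<Sum>x\<in>UNIV. \<Sum>y\<in>UNIV. \<Sum>e\<in>UNIV. \<Sum>a\<in>UNIV.
        of_real (G $ c $ a) * A $ c $ x * B $ a $ y * C $ b $ e * of_real (N $ x $ y $ e))"
      by (rule sum.cong[OF refl sum_swap_first])
    also have "\<dots> = (\<Sum>x\<in>UNIV. \<Sum>y\<in>UNIV. \<Sum>e\<in>UNIV. \<Sum>c\<in>UNIV. \<Sum>a\<in>UNIV.
        of_real (G $ c $ a) * A $ c $ x * B $ a $ y * C $ b $ e * of_real (N $ x $ y $ e))"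
      by (rule sum_swap_first)
    finally show ?thesis by (simp only: sum_distrib_right)
  qed
  have "(\<Sum>c\<in>UNIV. \<Sum>a\<in>UNIV. of_real (G $ c $ a) *
      (tensor3_apply (proj10 J) (proj01 J) (proj01 J) N + tensor3_apply (proj01 J) (proj10 J) (proj10 J) N) $ c $ a $ b)
    = (\<Sum>x\<in>UNIV. \<Sum>y\<in>UNIV. \<Sum>e\<in>UNIV.
        (of_real (G $ x $ y) + \<i> * of_real ((G ** J) $ x $ y)) / 2 * proj01 J $ b $ e * of_real (N $ x $ y $ e)
      + (of_real (G $ x $ y) - \<i> * of_real ((G ** J) $ x $ y)) / 2 * proj10 J $ b $ e * of_real (N $ x $ y $ e))"
    unfolding vector_add_component distrib_left sum.distrib T c1 c2 ..
  also have "\<dots> = (\<Sum>x\<in>UNIV. \<Sum>y\<in>UNIV. \<Sum>e\<in>UNIV.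
      of_real (((if b = e then G $ x $ y * N $ x $ y $ e else 0) - J $ b $ e * ((G ** J) $ x $ y * N $ x $ y $ e)) / 2))"
    by (intro sum.cong refl) (simp add: proj10_def proj01_def field_simps)
  also have "\<dots> = of_real (\<Sum>x\<in>UNIV. \<Sum>y\<in>UNIV. \<Sum>e\<in>UNIV.
      ((if b = e then G $ x $ y * N $ x $ y $ e else 0) - J $ b $ e * ((G ** J) $ x $ y * N $ x $ y $ e)) / 2)"
    by simp
  also have "(\<Sum>x\<in>UNIV. \<Sum>y\<in>UNIV. \<Sum>e\<in>UNIV.
      ((if b = e then G $ x $ y * N $ x $ y $ e else 0) - J $ b $ e * ((G ** J) $ x $ y * N $ x $ y $ e)) / 2) =
      (\<Sum>c\<in>UNIV. \<Sum>a\<in>UNIV. G $ c $ a * N $ c $ a $ b) / 2 -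
        (\<Sum>x\<in>UNIV. \<Sum>y\<in>UNIV. \<Sum>e\<in>UNIV. J $ b $ e * ((G ** J) $ x $ y * N $ x $ y $ e)) / 2"
    by (simp add: diff_divide_distrib sum_subtractf flip: sum_divide_distrib)
  also have "(\<Sum>x\<in>UNIV. \<Sum>y\<in>UNIV. \<Sum>e\<in>UNIV. J $ b $ e * ((G ** J) $ x $ y * N $ x $ y $ e)) =
    (\<Sum>e\<in>UNIV. J $ b $ e * (\<Sum>c\<in>UNIV. \<Sum>a\<in>UNIV. (G ** J) $ c $ a * N $ c $ a $ e))"
    unfolding sum_distrib_left by (rule sum_swap_last)
  finally show ?thesis .
qed

text \<open>Here \<open>D u\<close> stands for the derivative of \<open>F\<close> along
  \<open>u\<close>, \<open>K u\<close> for that of \<open>J\<close>, and \<open>N\<close> for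
  \<open>\<nabla>F\<close> with raised index. Only components of type (2,0) and (0,2) occur in the
  2-vector slots, because \<open>K u\<close> anticommutes with \<open>J\<close>. The part with equal
  types in derivative slot and 2-vector is trace-free, so the trace of \<open>D_2 F\<close> is the
  full trace \<open>T\<close>, which in turn is the divergence of \<open>J\<close>.\<close>

lemma divergence_of_cosymplectic:
  fixes G J :: "real^'q^'q" and D K :: "real^'q \<Rightarrow> real^'q^'q"
  assumes G: "invertible G" "transpose (matrix_inv G) = matrix_inv G"
    and J: "transpose J ** G ** J = G" "transpose J ** G = - (G ** J)"
      "matrix_inv G ** transpose J = - (J ** matrix_inv G)" "J ** J = - mat 1"
    and D: "linear D" "\<And>u. transpose (D u) = - D u" "\<And>u. D u = - (K u ** matrix_inv G)"
    and KJ: "\<And>u. K u ** J = - (J ** K u)"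
    and N: "N = (\<chi> c. D (matrix_inv G *v axis c 1))"
    and tr: "\<And>b. (\<Sum>c\<in>UNIV. \<Sum>a\<in>UNIV. of_real (G $ c $ a) *
      (tensor3_apply (proj10 J) (proj01 J) (proj01 J) N + tensor3_apply (proj01 J) (proj10 J) (proj10 J) N) $ c $ a $ b) = (0::complex)"
  shows "(\<Sum>i\<in>UNIV. \<Sum>j\<in>UNIV. matrix_inv G $ i $ j *\<^sub>R (K (axis i 1) *v axis j 1)) = 0"
proof -
  note inv = matrix_inv_right_left[OF G(1)]
  define H where "H = matrix_inv G"
  have tH: "H $ j $ i = H $ i $ j" for i j
    using arg_cong[OF G(2), of "\<lambda>M. M $ i $ j"] by (simp add: H_def transpose_def)
  have Nc: "N $ c = (\<Sum>i\<in>UNIV. H $ i $ c *\<^sub>R D (axis i 1))" for c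
  proof -
    have "matrix_inv G *v axis c 1 = (\<Sum>i\<in>UNIV. H $ i $ c *\<^sub>R axis i 1)"
      using basis_expansion[of "H *v axis c 1"]
      by (simp add: scalar_mult_eq_scaleR H_def matrix_vector_mult_basis column_def)
    then show ?thesis by (simp add: N linear_sum[OF D(1)] linear_cmul[OF D(1)])
  qed
  have contr: "(\<Sum>c\<in>UNIV. \<Sum>a\<in>UNIV. (G ** X) $ c $ a * N $ c $ a $ b) = (\<Sum>i\<in>UNIV. (X ** D (axis i 1)) $ i $ b)"
    for X b
  proof -
    have "(\<Sum>c\<in>UNIV. \<Sum>a\<in>UNIV. (G ** X) $ c $ a * N $ c $ a $ b) =
      (\<Sum>c\<in>UNIV. \<Sum>a\<in>UNIV. \<Sum>i\<in>UNIV. H $ i $ c * (G ** X) $ c $ a * D (axis i 1) $ a $ b)"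
      by (simp add: Nc sum_distrib_left sum_component algebra_simps)
    also have "\<dots> = (\<Sum>i\<in>UNIV. \<Sum>a\<in>UNIV. \<Sum>c\<in>UNIV. H $ i $ c * (G ** X) $ c $ a * D (axis i 1) $ a $ b)"
      unfolding sum_swap_last[where f = "\<lambda>c a i. H $ i $ c * (G ** X) $ c $ a * D (axis i 1) $ a $ b"]
      by (intro sum.cong refl sum.swap)
    also have "\<dots> = (\<Sum>i\<in>UNIV. \<Sum>a\<in>UNIV. (H ** (G ** X)) $ i $ a * D (axis i 1) $ a $ b)"
      by (simp add: matrix_matrix_mult_def[of H] sum_distrib_right)
    also have "H ** (G ** X) = X" by (simp add: matrix_mul_assoc H_def inv)
    finally show ?thesis by (simp add: matrix_matrix_mult_def)
  qed
  define T where "T = (\<lambda>b. \<Sum>i\<in>UNIV. D (axis i 1) $ i $ b)"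
  have neg: "(- X) ** Y = - (X ** Y)" "X ** (- Y) = - (X ** Y)" for X Y :: "real^'q^'q"
    using linear_neg[OF linear_matrix_mult_right, of X Y] linear_neg[OF linear_matrix_mult_left, of X Y] by auto
  \<comment> \<open>\<open>J\<close> acts in the same way on both slots of \<open>D u\<close>: this
    is the absence of a (1,1) component.\<close>
  have JD: "J ** D u = D u ** transpose J" for u
  proof -
    have "J ** D u = - (J ** K u ** H)" by (simp add: D neg H_def matrix_mul_assoc)
    also have "\<dots> = (K u ** J) ** H" by (simp add: KJ neg)
    also have "\<dots> = K u ** (J ** H)" by (simp add: matrix_mul_assoc)
    also have "J ** H = - (H ** transpose J)" by (simp add: H_def J)
    also have "K u ** (- (H ** transpose J)) = D u ** transpose J" by (simp add: D neg H_def matrix_mul_assoc)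
    finally show ?thesis .
  qed
  have T1: "(\<Sum>c\<in>UNIV. \<Sum>a\<in>UNIV. G $ c $ a * N $ c $ a $ b) = T b" for b
    using contr[of "mat 1" b] by (simp add: T_def)
  have T2: "(\<Sum>c\<in>UNIV. \<Sum>a\<in>UNIV. (G ** J) $ c $ a * N $ c $ a $ b) = (\<Sum>e\<in>UNIV. J $ b $ e * T e)" for b
  proof -
    have "(\<Sum>i\<in>UNIV. (D (axis i 1) ** transpose J) $ i $ b) = (\<Sum>e\<in>UNIV. J $ b $ e * T e)"
      unfolding T_def sum_distrib_left by (subst sum.swap) (simp add: matrix_matrix_mult_def transpose_def mult.commute)
    then show ?thesis unfolding contr JD .
  qed
  have "T b = 0" for b
  proof -
    \<comment> \<open>The second half is \<open>J (J T)\<close>, that is \<open>- T\<close>, so the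
      two halves add up to \<open>T\<close>.\<close>
    have "T b / 2 - (\<Sum>e\<in>UNIV. J $ b $ e * (\<Sum>f\<in>UNIV. J $ e $ f * T f)) / 2 = 0"
      using tr[of b] unfolding trace_D2_real[OF J(1,2)] T1 T2 of_real_eq_0_iff .
    moreover have "(\<Sum>e\<in>UNIV. J $ b $ e * (\<Sum>f\<in>UNIV. J $ e $ f * T f)) = (J *v (J *v vec_lambda T)) $ b"
      by (simp add: matrix_vector_mult_def)
    moreover have "J *v (J *v vec_lambda T) = - vec_lambda T"
      using matrix_vector_mult_diff_rdistrib[of 0 "mat 1" "vec_lambda T"] by (simp add: matrix_vector_mul_assoc J)
    ultimately show ?thesis by simp
  qed
  \<comment> \<open>Antisymmetry of \<open>D\<close> moves the contraction to the other slot; its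
    sign cancels the one in \<open>D u = - K u ** matrix_inv G\<close>.\<close>
  moreover have "T b = (\<Sum>i\<in>UNIV. \<Sum>j\<in>UNIV. H $ i $ j *\<^sub>R (K (axis i 1) *v axis j 1)) $ b" for b
  proof -
    have "T b = (\<Sum>i\<in>UNIV. - D (axis i 1) $ b $ i)"
      unfolding T_def
    proof (intro sum.cong refl)
      fix i show "D (axis i 1) $ i $ b = - D (axis i 1) $ b $ i"
        using arg_cong[OF D(2)[of "axis i 1"], of "\<lambda>M. M $ b $ i"] by (simp add: transpose_def)
    qed
    also have "\<dots> = (\<Sum>i\<in>UNIV. \<Sum>j\<in>UNIV. H $ i $ j * K (axis i 1) $ b $ j)"
      by (simp add: D(3) matrix_matrix_mult_def H_def[symmetric] tH mult.commute)
    finally show ?thesis by (simp add: sum_component matrix_vector_mult_basis column_def)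
  qed
  ultimately show ?thesis by (simp add: H_def vec_eq_iff)
qed

section \<open>Maps between manifolds at a point\<close>

lemma smooth_manifold_chart:
  assumes M: "smooth_manifold M" and C: "C \<in> atlas M"
  shows "openin (mtop M) (fst C)" "open (snd C ` fst C)"
    "homeomorphic_map (subtopology (mtop M) (fst C)) (top_of_set (snd C ` fst C)) (snd C)"
    "inj_on (snd C) (fst C)" "fst C \<subseteq> carrier_of M"
proof -
  obtain U c where Uc: "C = (U, c)" by (cases C)
  have "openin (mtop M) U \<and> open (c ` U) \<and>
      homeomorphic_map (subtopology (mtop M) U) (top_of_set (c ` U)) c"
    using M C unfolding smooth_manifold_def Uc by blast
  then show *: "openin (mtop M) (fst C)" "open (snd C ` fst C)"
    "homeomorphic_map (subtopology (mtop M) (fst C)) (top_of_set (snd C ` fst C)) (snd C)"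
    by (simp_all add: Uc)
  show sub: "fst C \<subseteq> carrier_of M" using *(1) openin_subset by blast
  show "inj_on (snd C) (fst C)"
    using homeomorphic_imp_injective_map[OF *(3)] sub by (simp add: topspace_subtopology Int_absorb1)
qed

lemma smooth_manifold_chart_at:
  assumes "smooth_manifold M" "p \<in> carrier_of M"
  shows "chart_at M p \<in> atlas M" "p \<in> fst (chart_at M p)"
  using assms unfolding smooth_manifold_def by blast+

lemma chart_inv_left:
  assumes "smooth_manifold M" "C \<in> atlas M" "p \<in> fst C"
  shows "chart_inv C (snd C p) = p"
  unfolding chart_inv_def using smooth_manifold_chart(4)[OF assms(1,2)] assms(3) by simp

lemma chart_inv_right:
  assumes "x \<in> snd C ` fst C"
  shows "snd C (chart_inv C x) = x" "chart_inv C x \<in> fst C"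
  unfolding chart_inv_def using f_inv_into_f[OF assms] inv_into_into[OF assms] by auto

lemma open_chart_image:
  assumes M: "smooth_manifold M" and C: "C \<in> atlas M" and W: "openin (mtop M) W"
  shows "open (snd C ` (fst C \<inter> W))"
proof -
  note ch = smooth_manifold_chart[OF M C]
  have "openin (subtopology (mtop M) (fst C)) (fst C \<inter> W)"
    using W by (auto simp: openin_subtopology)
  then have "openin (top_of_set (snd C ` fst C)) (snd C ` (fst C \<inter> W))"
    using homeomorphic_imp_open_map[OF ch(3)] unfolding open_map_def by blast
  then show ?thesis using ch(2) openin_open_trans by blast
qed

definition mcont :: "('a, 'e) mfd \<Rightarrow> ('b, 'f) mfd \<Rightarrow> ('a \<Rightarrow> 'b) \<Rightarrow> 'a \<Rightarrow> bool" where
  "mcont M N \<phi> p \<longleftrightarrow> (\<forall>V. openin (mtop N) V \<and> \<phi> p \<in> V \<longrightarrow> (\<exists>U. openin (mtop M) U \<and> p \<in> U \<and> \<phi> ` U \<subseteq> V))"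

text \<open>All pairs of charts of the two atlases are quantified over, so it can be used in any of
  them without a chart change. Continuity is kept apart in \<open>mcont\<close>:
  \<open>snd D\<close> is a total function with arbitrary values outside \<open>fst D\<close>, so
  differentiability of the coordinate expression does not force \<open>\<phi>\<close> to stay in
  \<open>fst D\<close> near \<open>p\<close>.\<close>

definition mdiff ::
  "('a, 'e::euclidean_space) mfd \<Rightarrow> ('b, 'f::euclidean_space) mfd \<Rightarrow> ('a \<Rightarrow> 'b) \<Rightarrow> 'a \<Rightarrow> bool" where
  "mdiff M N \<phi> p \<longleftrightarrow> p \<in> carrier_of M \<and> \<phi> p \<in> carrier_of N \<and>
     (\<forall>C\<in>atlas M. \<forall>D\<in>atlas N. p \<in> fst C \<longrightarrow> \<phi> p \<in> fst D \<longrightarrow>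
        (snd D \<circ> \<phi> \<circ> chart_inv C) differentiable (at (snd C p)))"

lemma smooth_map_on_smooth:
  assumes "smooth_map_on S M N \<phi>" "C \<in> atlas M" "D \<in> atlas N"
  shows "smooth_on (snd C ` {p \<in> S \<inter> fst C. \<phi> p \<in> fst D}) (snd D \<circ> \<phi> \<circ> chart_inv C)"
  using assms unfolding smooth_map_on_def by (cases C; cases D) fastforce

lemma smooth_map_on_mdiff:
  assumes \<phi>: "smooth_map_on S M N \<phi>" and S: "S \<subseteq> carrier_of M" and p: "p \<in> S"
  shows "mdiff M N \<phi> p"
  unfolding mdiff_def
proof (intro conjI ballI impI)
  show "p \<in> carrier_of M" using S p by blast
  show "\<phi> p \<in> carrier_of N"
    using \<phi> S p unfolding smooth_map_on_def continuous_map_def Pi_iff topspace_subtopology by blast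
  fix C D assume "C \<in> atlas M" "D \<in> atlas N" "p \<in> fst C" "\<phi> p \<in> fst D"
  then show "(snd D \<circ> \<phi> \<circ> chart_inv C) differentiable (at (snd C p))"
    using smooth_map_on_smooth[OF \<phi>] p smooth_on_differentiable by (metis (mono_tags, lifting) IntI imageI mem_Collect_eq)
qed

lemma openin_smooth_map_preimage:
  assumes \<phi>: "smooth_map_on S M N \<phi>" and S: "openin (mtop M) S" and V: "openin (mtop N) V"
  shows "openin (mtop M) {p \<in> S. \<phi> p \<in> V}"
proof -
  have "openin (subtopology (mtop M) S) {p \<in> topspace (subtopology (mtop M) S). \<phi> p \<in> V}"
    using \<phi> V openin_continuous_map_preimage unfolding smooth_map_on_def by blast
  moreover have "topspace (subtopology (mtop M) S) = S" using openin_subset[OF S] by auto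
  ultimately show ?thesis using openin_trans_full S by metis
qed

lemma smooth_map_on_mcont:
  assumes \<phi>: "smooth_map_on S M N \<phi>" and S: "openin (mtop M) S" and p: "p \<in> S"
  shows "mcont M N \<phi> p"
  unfolding mcont_def using openin_smooth_map_preimage[OF \<phi> S] p by blast

lemma mcont_id: "mcont M M (\<lambda>x. x) p"
  unfolding mcont_def by auto

lemma mcont_chart_neighbourhood:
  assumes M: "smooth_manifold M" and C: "C \<in> atlas M" "p \<in> fst C"
    and \<phi>: "mcont M N \<phi> p" and V: "openin (mtop N) V" "\<phi> p \<in> V"
  obtains S where "open S" "snd C p \<in> S" "S \<subseteq> snd C ` fst C" "\<And>x. x \<in> S \<Longrightarrow> \<phi> (chart_inv C x) \<in> V"
proof -
  obtain U where U: "openin (mtop M) U" "p \<in> U" "\<phi> ` U \<subseteq> V" using \<phi> V unfolding mcont_def by blast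
  show ?thesis
  proof (rule that[of "snd C ` (fst C \<inter> U)"])
    show "open (snd C ` (fst C \<inter> U))" by (rule open_chart_image[OF M C(1) U(1)])
    fix x assume "x \<in> snd C ` (fst C \<inter> U)"
    then obtain q where "q \<in> fst C" "q \<in> U" "x = snd C q" by blast
    then show "\<phi> (chart_inv C x) \<in> V" using U chart_inv_left[OF M C(1)] by auto
  qed (use C U in auto)
qed

text \<open>The coordinate expression of the composite equals the composite of the coordinate
  expressions only where \<open>\<phi>\<close> takes values in \<open>fst D\<close>;
  \<open>mcont\<close> provides a neighbourhood where it does.\<close>

lemma chart_chain_rule:
  assumes M: "smooth_manifold M" and N: "smooth_manifold N"
    and C: "C \<in> atlas M" "p \<in> fst C" and D: "D \<in> atlas N" "\<phi> p \<in> fst D" and \<phi>: "mcont M N \<phi> p"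
    and A: "((snd D \<circ> \<phi> \<circ> chart_inv C) has_derivative A) (at (snd C p))"
    and B: "((f \<circ> chart_inv D) has_derivative B) (at (snd D (\<phi> p)))"
  shows "((f \<circ> \<phi> \<circ> chart_inv C) has_derivative (B \<circ> A)) (at (snd C p))"
proof -
  obtain S where S: "open S" "snd C p \<in> S" "\<And>x. x \<in> S \<Longrightarrow> \<phi> (chart_inv C x) \<in> fst D"
    using mcont_chart_neighbourhood[OF M C \<phi> smooth_manifold_chart(1)[OF N D(1)] D(2)] by metis
  have "(snd D \<circ> \<phi> \<circ> chart_inv C) (snd C p) = snd D (\<phi> p)" by (simp add: chart_inv_left[OF M C])
  then have "((f \<circ> chart_inv D) \<circ> (snd D \<circ> \<phi> \<circ> chart_inv C) has_derivative B \<circ> A) (at (snd C p))"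
    using B by (intro diff_chain_at[OF A]) simp
  then show ?thesis
    by (rule has_derivative_transform_within_open[OF _ S(1,2)]) (simp add: chart_inv_left[OF N D(1)] S(3))
qed

lemma chart_change_differentiable:
  assumes M: "smooth_manifold M" and C: "C \<in> atlas M" "p \<in> fst C" and D: "D \<in> atlas M" "p \<in> fst D"
  shows "(snd D \<circ> chart_inv C) differentiable (at (snd C p))"
proof -
  have "smooth_on (snd C ` (fst C \<inter> fst D)) (snd D \<circ> chart_inv C)"
    using M C D unfolding smooth_manifold_def by (cases C; cases D) fastforce
  then show ?thesis using smooth_on_differentiable C D by blast
qed

lemma has_derivative_to_coord:
  assumes M: "smooth_manifold M" and C: "C \<in> atlas M" "p \<in> fst C"
  shows "((snd C \<circ> chart_inv (chart_at M p)) has_derivative to_coord M C p) (at (snd (chart_at M p) p))"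
proof -
  have "p \<in> carrier_of M" using smooth_manifold_chart(5)[OF M C(1)] C(2) by blast
  note at = smooth_manifold_chart_at[OF M this]
  show ?thesis unfolding to_coord_def dir_deriv_def
    by (rule frechet_works[OF chart_change_differentiable[OF M at C]])
qed

lemma has_derivative_from_coord:
  assumes M: "smooth_manifold M" and C: "C \<in> atlas M" "p \<in> fst C"
  shows "((snd (chart_at M p) \<circ> chart_inv C) has_derivative from_coord M C p) (at (snd C p))"
proof -
  have "p \<in> carrier_of M" using smooth_manifold_chart(5)[OF M C(1)] C(2) by blast
  note at = smooth_manifold_chart_at[OF M this]
  show ?thesis unfolding from_coord_def
    by (rule frechet_works[OF chart_change_differentiable[OF M C at]])
qed

lemma has_derivative_chart_id:
  assumes M: "smooth_manifold M" and C: "C \<in> atlas M" "p \<in> fst C"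
  shows "((snd C \<circ> chart_inv C) has_derivative id) (at (snd C p))"
proof -
  have "open (snd C ` fst C)" by (rule smooth_manifold_chart(2)[OF M C(1)])
  then show ?thesis
    by (rule has_derivative_transform_within_open[OF has_derivative_id[unfolded id_def[symmetric]]])
      (use C in \<open>auto simp: chart_inv_left[OF M C(1)]\<close>)
qed

lemma to_from_coord:
  assumes M: "smooth_manifold M" and C: "C \<in> atlas M" "p \<in> fst C"
  shows "to_coord M C p \<circ> from_coord M C p = id" "from_coord M C p \<circ> to_coord M C p = id"
    "linear (to_coord M C p)" "linear (from_coord M C p)"
proof -
  have p: "p \<in> carrier_of M" using smooth_manifold_chart(5)[OF M C(1)] C by blast
  note at = smooth_manifold_chart_at[OF M p]
  have "((snd C \<circ> (\<lambda>x. x) \<circ> chart_inv C) has_derivative to_coord M C p \<circ> from_coord M C p) (at (snd C p))"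
    by (rule chart_chain_rule[OF M M C at(1) _ mcont_id])
      (use at has_derivative_to_coord[OF M C] has_derivative_from_coord[OF M C] in \<open>auto simp: o_def\<close>)
  then show "to_coord M C p \<circ> from_coord M C p = id"
    using has_derivative_unique[OF _ has_derivative_chart_id[OF M C]] by (simp add: o_def)
  have "((snd (chart_at M p) \<circ> (\<lambda>x. x) \<circ> chart_inv (chart_at M p)) has_derivative from_coord M C p \<circ> to_coord M C p)
    (at (snd (chart_at M p) p))"
    by (rule chart_chain_rule[OF M M at C(1) _ mcont_id])
      (use C has_derivative_to_coord[OF M C] has_derivative_from_coord[OF M C] in \<open>auto simp: o_def\<close>)
  then show "from_coord M C p \<circ> to_coord M C p = id"
    using has_derivative_unique[OF _ has_derivative_chart_id[OF M at]] by (simp add: o_def)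
  show "linear (to_coord M C p)" "linear (from_coord M C p)"
    using has_derivative_linear[OF has_derivative_to_coord[OF M C]] has_derivative_linear[OF has_derivative_from_coord[OF M C]] by auto
qed

lemma to_coord_chart_at:
  assumes M: "smooth_manifold M" and p: "p \<in> carrier_of M"
  shows "to_coord M (chart_at M p) p = id" "from_coord M (chart_at M p) p = id"
proof -
  note at = smooth_manifold_chart_at[OF M p]
  show "to_coord M (chart_at M p) p = id"
    by (rule has_derivative_unique[OF has_derivative_to_coord[OF M at] has_derivative_chart_id[OF M at]])
  show "from_coord M (chart_at M p) p = id"
    by (rule has_derivative_unique[OF has_derivative_from_coord[OF M at] has_derivative_chart_id[OF M at]])
qed

lemma has_derivative_mderiv:
  assumes M: "smooth_manifold M" and N: "smooth_manifold N" and \<phi>: "mdiff M N \<phi> p"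
  shows "((snd (chart_at N (\<phi> p)) \<circ> \<phi> \<circ> chart_inv (chart_at M p)) has_derivative mderiv M N \<phi> p)
    (at (snd (chart_at M p) p))"
  unfolding mderiv_def dir_deriv_def
  using \<phi> smooth_manifold_chart_at[OF M] smooth_manifold_chart_at[OF N]
  by (intro frechet_works) (auto simp: mdiff_def)

lemma linear_mderiv:
  assumes "smooth_manifold M" "smooth_manifold N" "mdiff M N \<phi> p"
  shows "linear (mderiv M N \<phi> p)"
  using has_derivative_mderiv[OF assms] has_derivative_linear by blast

lemma has_derivative_mderiv_coord:
  assumes M: "smooth_manifold M" and N: "smooth_manifold N" and \<phi>: "mdiff M N \<phi> p" "mcont M N \<phi> p"
    and C: "C \<in> atlas M" "p \<in> fst C" and D: "D \<in> atlas N" "\<phi> p \<in> fst D"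
  shows "((snd D \<circ> \<phi> \<circ> chart_inv C) has_derivative (\<lambda>v. to_coord N D (\<phi> p) (mderiv M N \<phi> p (from_coord M C p v))))
    (at (snd C p))"
proof -
  have p: "p \<in> carrier_of M" "\<phi> p \<in> carrier_of N" using \<phi> by (auto simp: mdiff_def)
  note atM = smooth_manifold_chart_at[OF M p(1)] and atN = smooth_manifold_chart_at[OF N p(2)]
  have "((snd D \<circ> \<phi> \<circ> chart_inv (chart_at M p)) has_derivative to_coord N D (\<phi> p) \<circ> mderiv M N \<phi> p)
    (at (snd (chart_at M p) p))"
    by (rule chart_chain_rule[OF M N atM atN \<phi>(2) has_derivative_mderiv[OF M N \<phi>(1)] has_derivative_to_coord[OF N D]])
  from chart_chain_rule[OF M M C atM(1) _ mcont_id _ this]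
  have "((snd D \<circ> \<phi> \<circ> (\<lambda>x. x) \<circ> chart_inv C) has_derivative to_coord N D (\<phi> p) \<circ> mderiv M N \<phi> p \<circ> from_coord M C p) (at (snd C p))"
    using atM(2) has_derivative_from_coord[OF M C] by (simp add: o_def)
  then show ?thesis by (simp add: o_def)
qed

lemma mderiv_comp:
  assumes M: "smooth_manifold M" and N: "smooth_manifold N" and K: "smooth_manifold K"
    and \<phi>: "mdiff M N \<phi> p" "mcont M N \<phi> p" and \<theta>: "mdiff N K \<theta> (\<phi> p)"
  shows "mderiv M K (\<theta> \<circ> \<phi>) p = mderiv N K \<theta> (\<phi> p) \<circ> mderiv M N \<phi> p"
proof -
  have p: "p \<in> carrier_of M" "\<phi> p \<in> carrier_of N" using \<phi> by (auto simp: mdiff_def)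
  note atM = smooth_manifold_chart_at[OF M p(1)] and atN = smooth_manifold_chart_at[OF N p(2)]
  have "((snd (chart_at K (\<theta> (\<phi> p))) \<circ> \<theta> \<circ> \<phi> \<circ> chart_inv (chart_at M p)) has_derivative mderiv N K \<theta> (\<phi> p) \<circ> mderiv M N \<phi> p)
    (at (snd (chart_at M p) p))"
    by (rule chart_chain_rule[OF M N atM atN \<phi>(2) has_derivative_mderiv[OF M N \<phi>(1)] has_derivative_mderiv[OF N K \<theta>]])
  then show ?thesis
    using frechet_derivative_at by (force simp: mderiv_def[of M K] dir_deriv_def o_assoc)
qed

lemma mderiv_cong:
  assumes M: "smooth_manifold M" and W: "openin (mtop M) W" "p \<in> W" and eq: "\<And>y. y \<in> W \<Longrightarrow> \<phi> y = \<theta> y"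
  shows "mderiv M N \<phi> p = mderiv M N \<theta> p"
proof -
  have p: "p \<in> carrier_of M" using W openin_subset by blast
  note atM = smooth_manifold_chart_at[OF M p]
  show ?thesis unfolding mderiv_def dir_deriv_def eq[OF W(2)]
    by (rule frechet_derivative_cong_open[OF open_chart_image[OF M atM(1) W(1)]])
      (use atM W eq chart_inv_left[OF M atM(1)] in auto)
qed

section \<open>The Levi-Civita connection in a chart\<close>

lemma inner_product_metric:
  assumes "riemannian_manifold M g" "p \<in> carrier_of M"
  shows "inner_product (g p)"
  using assms unfolding riemannian_manifold_def inner_product_def by blast

lemma inner_product_metric_in_chart:
  assumes M: "riemannian_manifold M g" and C: "C \<in> atlas M" and x: "x \<in> snd C ` fst C"
  shows "inner_product (metric_in_chart M g C x)"
proof -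
  have sm: "smooth_manifold M" using M by (simp add: riemannian_manifold_def)
  define p where "p = chart_inv C x"
  have p: "p \<in> fst C" using chart_inv_right(2)[OF x] by (simp add: p_def)
  then have "p \<in> carrier_of M" using smooth_manifold_chart(5)[OF sm C] by blast
  then have gp: "inner_product (g p)" by (rule inner_product_metric[OF M])
  have lin: "linear (from_coord M C p)" by (rule to_from_coord(4)[OF sm C p])
  have inj: "u = 0" if "from_coord M C p u = 0" for u
  proof -
    have "u = to_coord M C p (from_coord M C p u)" using to_from_coord(1)[OF sm C p] by (simp add: fun_eq_iff)
    then show ?thesis using that linear_0[OF to_from_coord(3)[OF sm C p]] by simp
  qed
  have lg: "linear (g p u)" "linear (\<lambda>u. g p u v)" for u v
    using gp by (auto simp: inner_product_def bilinear_def)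
  have "bilinear (\<lambda>u v. g p (from_coord M C p u) (from_coord M C p v))"
    unfolding bilinear_def
    by (intro allI conjI linearI)
      (simp_all add: linear_add[OF lin] linear_cmul[OF lin] linear_add[OF lg(1)] linear_cmul[OF lg(1)]
        linear_add[OF lg(2)] linear_cmul[OF lg(2)])
  moreover have "0 < g p (from_coord M C p u) (from_coord M C p u)" if "u \<noteq> 0" for u
    using gp inj that unfolding inner_product_def by blast
  moreover have "g p (from_coord M C p u) (from_coord M C p v) = g p (from_coord M C p v) (from_coord M C p u)" for u v
    using gp unfolding inner_product_def by blast
  ultimately show ?thesis
    unfolding inner_product_def metric_in_chart_def Let_def p_def[symmetric] by blast
qed

lemma metric_in_chart_to_coord:
  assumes M: "smooth_manifold M" and C: "C \<in> atlas M" and p: "p \<in> fst C"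
  shows "metric_in_chart M g C (snd C p) (to_coord M C p u) (to_coord M C p v) = g p u v"
  using to_from_coord(2)[OF M C p] by (simp add: metric_in_chart_def Let_def chart_inv_left[OF M C p] fun_eq_iff)

definition metric_matrix :: "('t, real^'q::finite) mfd \<Rightarrow> ('t, real^'q) metric \<Rightarrow> ('t, real^'q) chart \<Rightarrow> real^'q \<Rightarrow> real^'q^'q" where
  "metric_matrix T h C x = gram (metric_in_chart T h C x)"

definition christoffel_matrix ::
  "('t, real^'q::finite) mfd \<Rightarrow> ('t, real^'q) metric \<Rightarrow> ('t, real^'q) chart \<Rightarrow> real^'q \<Rightarrow> real^'q \<Rightarrow> real^'q^'q" where
  "christoffel_matrix T h C x u = matrix (christoffel T h C x u)"

text \<open>The Koszul algebra applied to the first derivatives of the metric coefficients in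
  \<open>C\<close>. The third claim is compatibility of metric and connection in matrix form; it is
  what removes the derivatives of the metric when the fundamental 2-vector is
  differentiated.\<close>

lemma
  fixes T :: "('t, real^'q::finite) mfd"
  assumes T: "riemannian_manifold T h" and C: "C \<in> atlas T" and x: "x \<in> snd C ` fst C"
  defines "\<Gamma> \<equiv> christoffel_matrix T h C x" and "G \<equiv> metric_matrix T h C"
  shows christoffel_matrix_symmetric: "\<Gamma> u *v v = \<Gamma> v *v u"
    and linear_christoffel_matrix: "linear \<Gamma>"
    and has_derivative_metric_matrix: "(G has_derivative (\<lambda>u. transpose (\<Gamma> u) ** G x + G x ** \<Gamma> u)) (at x)"
proof -
  have sm: "smooth_manifold T" using T by (simp add: riemannian_manifold_def)
  have opn: "open (snd C ` fst C)" by (rule smooth_manifold_chart(2)[OF sm C])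
  have ip: "inner_product (metric_in_chart T h C y)" if "y \<in> snd C ` fst C" for y
    by (rule inner_product_metric_in_chart[OF T C that])
  have Gv: "metric_in_chart T h C y v w = v \<bullet> (G y *v w)" if "y \<in> snd C ` fst C" for y v w
    unfolding G_def metric_matrix_def using ip[OF that] by (intro gram_bilinear) (simp add: inner_product_def)
  have "(\<lambda>x. metric_in_chart T h C x u v) differentiable (at x)" for u v
  proof -
    have "smooth_on (snd C ` fst C) (\<lambda>x. metric_in_chart T h C x u v)"
      using T C unfolding riemannian_manifold_def by (cases C) fastforce
    then show ?thesis using smooth_on_differentiable x by blast
  qed
  then have "G differentiable (at x)"
    unfolding G_def metric_matrix_def gram_def by (intro differentiable_vec_lambda)
  then obtain G' where G': "(G has_derivative G') (at x)" unfolding differentiable_def by blast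
  have linG': "linear G'" using G' has_derivative_linear by blast
  define d where "d = (\<lambda>u v w. frechet_derivative (\<lambda>y. metric_in_chart T h C y v w) (at x) u)"
  have d: "d u v w = v \<bullet> (G' u *v w)" for u v w
  proof -
    have "((\<lambda>y. v \<bullet> (G y *v w)) has_derivative (\<lambda>u. v \<bullet> (G' u *v w))) (at x)"
      by (intro has_derivative_inner_right
          bounded_linear.has_derivative[OF bounded_bilinear.bounded_linear_left[OF bounded_bilinear_matrix_vector_mult] G'])
    then have "((\<lambda>y. metric_in_chart T h C y v w) has_derivative (\<lambda>u. v \<bullet> (G' u *v w))) (at x)"
      by (rule has_derivative_transform_within_open[OF _ opn x]) (simp add: Gv)
    from frechet_derivative_at[OF this] show ?thesis by (simp add: d_def fun_eq_iff)
  qed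
  have chr: "christoffel T h C x u v = (THE z. \<forall>w. metric_in_chart T h C x z w = (d u v w + d v u w - d w u v) / 2)"
    for u v
    by (simp add: christoffel_def Let_def d_def)
  have d1: "linear (\<lambda>u. d u v w)" for v w
    unfolding d by (intro linearI)
      (simp_all add: linear_add[OF linG'] linear_cmul[OF linG'] matrix_vector_mult_add_rdistrib inner_right_distrib
        scaleR_matrix_vector_assoc[symmetric])
  have d2: "bilinear (d u)" for u
    unfolding d bilinear_def
    by (auto intro!: linearI simp: inner_left_distrib inner_right_distrib matrix_vector_right_distrib matrix_vector_mult_scaleR)
  have d3: "d u v w = d u w v" for u v w
  proof -
    have "frechet_derivative (\<lambda>y. metric_in_chart T h C y v w) (at x) = frechet_derivative (\<lambda>y. metric_in_chart T h C y w v) (at x)"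
      by (rule frechet_derivative_cong_open[OF opn x]) (use ip in \<open>auto simp: inner_product_def\<close>)
    then show ?thesis by (simp add: d_def)
  qed
  note k = koszul[OF ip[OF x] d1 d2 d3, folded chr]
  have \<Gamma>: "\<Gamma> u *v v = christoffel T h C x u v" for u v
    using k(3) unfolding \<Gamma>_def christoffel_matrix_def by (intro matrix_apply) (simp add: bilinear_def)
  show "\<Gamma> u *v v = \<Gamma> v *v u" unfolding \<Gamma> by (rule k(1))
  show "linear \<Gamma>"
  proof (intro linearI)
    have l: "linear (\<lambda>u. christoffel T h C x u v)" for v using k(3) by (simp add: bilinear_def)
    show "\<Gamma> (a + b) = \<Gamma> a + \<Gamma> b" for a b
      by (rule matrix_eq[THEN iffD2]) (simp add: \<Gamma> matrix_vector_mult_add_rdistrib linear_add[OF l])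
    show "\<Gamma> (c *\<^sub>R a) = c *\<^sub>R \<Gamma> a" for c a
      by (rule matrix_eq[THEN iffD2]) (simp add: \<Gamma> scaleR_matrix_vector_assoc[symmetric] linear_cmul[OF l])
  qed
  have "G' u = transpose (\<Gamma> u) ** G x + G x ** \<Gamma> u" for u
  proof -
    have "v \<bullet> (G' u *v w) = v \<bullet> ((transpose (\<Gamma> u) ** G x + G x ** \<Gamma> u) *v w)" for v w
    proof -
      have "v \<bullet> (G' u *v w) = metric_in_chart T h C x (\<Gamma> u *v v) w + metric_in_chart T h C x v (\<Gamma> u *v w)"
        using k(2)[of u v w] by (simp add: d \<Gamma>)
      also have "\<dots> = (\<Gamma> u *v v) \<bullet> (G x *v w) + v \<bullet> (G x *v (\<Gamma> u *v w))"
        by (simp add: Gv[OF x])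
      also have "(\<Gamma> u *v v) \<bullet> (G x *v w) = v \<bullet> (transpose (\<Gamma> u) *v (G x *v w))"
        using dot_lmul_matrix[of "G x *v w" "\<Gamma> u" v] by (simp add: inner_commute)
      finally show ?thesis
        by (simp add: matrix_vector_mult_add_rdistrib matrix_vector_mul_assoc inner_right_distrib del: transpose_matrix_vector)
    qed
    then have "G' u *v w = (transpose (\<Gamma> u) ** G x + G x ** \<Gamma> u) *v w" for w using vector_eq_ldot by blast
    then show ?thesis by (simp only: matrix_eq) blast
  qed
  then have "G' = (\<lambda>u. transpose (\<Gamma> u) ** G x + G x ** \<Gamma> u)" by blast
  then show "(G has_derivative (\<lambda>u. transpose (\<Gamma> u) ** G x + G x ** \<Gamma> u)) (at x)"
    using G' by simp
qed

section \<open>Foliated manifolds\<close>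

text \<open>Vanishing on the kernel makes \<open>L\<close> constant on the fibres of
  \<open>q\<close>, which is what gives the definite description a value.\<close>

lemma on_quotient_eq:
  assumes "linear q" "linear L" "\<And>X. q X = 0 \<Longrightarrow> L X = 0"
  shows "on_quotient q L (q X) = L X"
proof -
  have "L Y = L X" if "q Y = q X" for Y
    using assms(3)[of "Y - X"] that by (simp add: linear_diff[OF assms(1)] linear_diff[OF assms(2)])
  then show ?thesis unfolding on_quotient_def by (intro the_equality allI impI) blast+
qed

lemma linear_on_quotient:
  assumes q: "linear q" "surj q" and L: "linear L" "\<And>X. q X = 0 \<Longrightarrow> L X = 0"
  shows "linear (on_quotient q L)"
proof (rule linearI)
  have e: "on_quotient q L (q X) = L X" for X
    by (rule on_quotient_eq[OF q(1) L(1)]) (rule L(2))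
  fix u v c
  obtain X Y where XY: "u = q X" "v = q Y" using q(2) by (metis surjD)
  show "on_quotient q L (u + v) = on_quotient q L u + on_quotient q L v"
    unfolding XY linear_add[OF q(1), symmetric] e by (rule linear_add[OF L(1)])
  show "on_quotient q L (c *\<^sub>R u) = c *\<^sub>R on_quotient q L u"
    unfolding XY linear_cmul[OF q(1), symmetric] e by (rule linear_cmul[OF L(1)])
qed

lemma orthogonal_projection:
  assumes b: "inner_product b" and K: "subspace K"
  shows "\<exists>Y\<in>K. \<forall>Z\<in>K. b (x - Y) Z = 0"
proof -
  obtain S where S: "S \<subseteq> K" "independent S" "span S = K" "\<forall>s\<in>S. \<forall>t\<in>S. b s t = (if s = t then 1 else 0)"
    by (rule inner_product_basis[OF b K])
  have fin: "finite S" using S(2) independent_bound by blast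
  have bil: "bilinear b" using b by (simp add: inner_product_def)
  define Y where "Y = (\<Sum>s\<in>S. b x s *\<^sub>R s)"
  have "Y \<in> K" unfolding Y_def S(3)[symmetric] by (intro span_sum span_scale span_base)
  have "b (x - Y) t = 0" if "t \<in> S" for t
  proof -
    have "b Y t = (\<Sum>s\<in>S. b x s * b s t)"
      unfolding Y_def using linear_sum[of "\<lambda>x. b x t" "\<lambda>s. b x s *\<^sub>R s" S] bil
      by (simp add: bilinear_def bilinear_lmul[OF bil])
    also have "\<dots> = (\<Sum>s\<in>S. if s = t then b x s else 0)" using S(4) that by (intro sum.cong) auto
    finally show ?thesis using fin that by (simp add: bilinear_lsub[OF bil])
  qed
  then have "b (x - Y) Z = 0" if "Z \<in> K" for Z
    using linear_eq_0_on_span[of "b (x - Y)" S Z] bil that S(3) by (auto simp: bilinear_def)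
  then show ?thesis using \<open>Y \<in> K\<close> by blast
qed

section \<open>The normal bundle of a foliated manifold\<close>

locale foliated_manifold =
  fixes M :: "('a, 'e::euclidean_space) mfd" and g :: "('a, 'e) metric"
    and F :: "('i, 'a, 't, 'q::finite) foliation"
  assumes foliated: "foliated_riemannian M g F"
begin

abbreviation "T \<equiv> fol_model F"
abbreviation "h \<equiv> fol_metric F"
abbreviation "D i \<equiv> mderiv M T (fol_map F i)"

lemmas foliated_unfolded = foliated[unfolded foliated_riemannian_def Let_def]

lemma riemannian: "riemannian_manifold M g" "riemannian_manifold T h"
  by (rule foliated_unfolded[THEN conjunct1], rule foliated_unfolded[THEN conjunct2, THEN conjunct1])

lemma smooth: "smooth_manifold M" "smooth_manifold T"
  using riemannian unfolding riemannian_manifold_def by blast+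

lemma dom_open: "i \<in> fol_index F \<Longrightarrow> openin (mtop M) (fol_dom F i)"
  by (rule foliated_unfolded[THEN conjunct2, THEN conjunct2, THEN conjunct1, THEN bspec])

lemma dom_Union: "(\<Union>i\<in>fol_index F. fol_dom F i) = carrier_of M"
  by (rule foliated_unfolded[THEN conjunct2, THEN conjunct2, THEN conjunct2, THEN conjunct1])

lemma
  assumes "p \<in> carrier_of M"
  shows at_index: "fol_at F p \<in> fol_index F" and at_dom: "p \<in> fol_dom F (fol_at F p)"
  using foliated_unfolded[THEN conjunct2, THEN conjunct2, THEN conjunct2, THEN conjunct2, THEN conjunct1,
      THEN bspec, OF assms] by simp_all

lemma
  assumes "i \<in> fol_index F"
  shows fol_map_smooth: "smooth_map_on (fol_dom F i) M T (fol_map F i)"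
    and surj_D: "p \<in> fol_dom F i \<Longrightarrow> surj (D i p)"
    and plaque_connected: "connectedin (mtop M) {p \<in> fol_dom F i. fol_map F i p = t}"
  using foliated_unfolded[THEN conjunct2, THEN conjunct2, THEN conjunct2, THEN conjunct2, THEN conjunct2,
      THEN conjunct1, THEN bspec, OF assms] by simp_all

lemma riemannian_submersion:
  assumes "i \<in> fol_index F" "p \<in> fol_dom F i"
    and "\<And>k. D i p k = 0 \<Longrightarrow> g p u k = 0 \<and> g p v k = 0"
  shows "h (fol_map F i p) (D i p u) (D i p v) = g p u v"
  by (rule foliated_unfolded[THEN conjunct2, THEN conjunct2, THEN conjunct2, THEN conjunct2, THEN conjunct2,
      THEN conjunct2, THEN conjunct1, THEN bspec, THEN bspec, THEN spec, THEN spec, THEN mp, OF assms(1,2)])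
    (use assms(3) in blast)

lemma transition_exists:
  assumes "i \<in> fol_index F" "j \<in> fol_index F"
  shows "\<exists>k. (\<forall>p\<in>fol_dom F i \<inter> fol_dom F j. fol_map F i p = k (fol_map F j p)) \<and>
    smooth_map_on (fol_map F j ` (fol_dom F i \<inter> fol_dom F j)) T T k"
proof -
  note tr = foliated_unfolded[THEN conjunct2, THEN conjunct2, THEN conjunct2, THEN conjunct2, THEN conjunct2,
      THEN conjunct2, THEN conjunct2, THEN bspec, THEN bspec, OF assms]
  then obtain k where "\<forall>p\<in>fol_dom F i \<inter> fol_dom F j. fol_map F i p = k (fol_map F j p)"
    "smooth_map_on (fol_map F j ` (fol_dom F i \<inter> fol_dom F j)) T T k"
    by (elim exE conjE)
  then show ?thesis by blast
qed

definition transition :: "'i \<Rightarrow> 'i \<Rightarrow> 't \<Rightarrow> 't" where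
  "transition i j = (SOME k. (\<forall>p\<in>fol_dom F i \<inter> fol_dom F j. fol_map F i p = k (fol_map F j p)) \<and>
    smooth_map_on (fol_map F j ` (fol_dom F i \<inter> fol_dom F j)) T T k)"

lemma transition:
  assumes "i \<in> fol_index F" "j \<in> fol_index F"
  shows "p \<in> fol_dom F i \<Longrightarrow> p \<in> fol_dom F j \<Longrightarrow> fol_map F i p = transition i j (fol_map F j p)"
    "smooth_map_on (fol_map F j ` (fol_dom F i \<inter> fol_dom F j)) T T (transition i j)"
  using someI_ex[OF transition_exists[OF assms]] unfolding transition_def[symmetric] by blast+

lemma dom_subset: "i \<in> fol_index F \<Longrightarrow> fol_dom F i \<subseteq> carrier_of M"
  using dom_open openin_subset by blast

lemma fol_map_mdiff: "i \<in> fol_index F \<Longrightarrow> p \<in> fol_dom F i \<Longrightarrow> mdiff M T (fol_map F i) p"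
  by (rule smooth_map_on_mdiff[OF fol_map_smooth dom_subset])

lemma fol_map_mcont: "i \<in> fol_index F \<Longrightarrow> p \<in> fol_dom F i \<Longrightarrow> mcont M T (fol_map F i) p"
  by (rule smooth_map_on_mcont[OF fol_map_smooth dom_open])

lemma fol_map_carrier: "i \<in> fol_index F \<Longrightarrow> p \<in> fol_dom F i \<Longrightarrow> fol_map F i p \<in> carrier_of T"
  using fol_map_mdiff unfolding mdiff_def by blast

lemma linear_D: "i \<in> fol_index F \<Longrightarrow> p \<in> fol_dom F i \<Longrightarrow> linear (D i p)"
  by (rule linear_mderiv[OF smooth fol_map_mdiff])

lemma D_transition:
  assumes i: "i \<in> fol_index F" "p \<in> fol_dom F i" and j: "j \<in> fol_index F" "p \<in> fol_dom F j"
  shows "D i p X = mderiv T T (transition i j) (fol_map F j p) (D j p X)"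
proof -
  have "mdiff T T (transition i j) (fol_map F j p)"
    by (rule smooth_map_on_mdiff[OF transition(2)[OF i(1) j(1)]]) (use i j fol_map_carrier in auto)
  then have "mderiv M T (transition i j \<circ> fol_map F j) p = mderiv T T (transition i j) (fol_map F j p) \<circ> D j p"
    using mderiv_comp[OF smooth(1) smooth(2) smooth(2) fol_map_mdiff[OF j] fol_map_mcont[OF j]] by blast
  moreover have "D i p = mderiv M T (transition i j \<circ> fol_map F j) p"
    by (rule mderiv_cong[OF smooth(1), of "fol_dom F i \<inter> fol_dom F j"])
      (use i j dom_open transition(1)[OF i(1) j(1)] in auto)
  ultimately show ?thesis by simp
qed

text \<open>The transition maps show that the tangent space of the foliation does not depend on the
  submersion. Therefore every \<open>ntriv M F i p\<close> is well defined on
  \<open>Q\<close>.\<close>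

lemma kernel_D:
  assumes "i \<in> fol_index F" "p \<in> fol_dom F i" "j \<in> fol_index F" "p \<in> fol_dom F j" "D j p X = 0"
  shows "D i p X = 0"
proof -
  have "D i p X = D i p 0"
    unfolding D_transition[OF assms(1-4)] using assms(5) linear_0[OF linear_D[OF assms(3,4)]] by simp
  then show ?thesis using linear_0[OF linear_D[OF assms(1,2)]] by simp
qed

lemma nproj_eq: "nproj M F p = D (fol_at F p) p"
  by (simp add: nproj_def)

lemma linear_nproj: "p \<in> carrier_of M \<Longrightarrow> linear (nproj M F p)"
  and surj_nproj: "p \<in> carrier_of M \<Longrightarrow> surj (nproj M F p)"
  using linear_D surj_D at_index at_dom by (auto simp: nproj_eq)

lemma nproj_kernel:
  assumes "i \<in> fol_index F" "p \<in> fol_dom F i"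
  shows "nproj M F p X = 0 \<longleftrightarrow> D i p X = 0"
  using kernel_D[of i p "fol_at F p" X] kernel_D[of "fol_at F p" p i X] assms at_index at_dom dom_subset
  unfolding nproj_eq by blast

lemma ntriv_nproj:
  assumes i: "i \<in> fol_index F" "p \<in> fol_dom F i"
  shows "ntriv M F i p (nproj M F p X) = D i p X"
  unfolding ntriv_def
  using on_quotient_eq linear_nproj linear_D[OF i] nproj_kernel[OF i] dom_subset[OF i(1)] i(2) by blast

lemma nproj_obtain:
  assumes "p \<in> carrier_of M"
  obtains X where "u = nproj M F p X"
  using surj_nproj[OF assms] by (metis surjD)

lemma ntriv_linear:
  assumes i: "i \<in> fol_index F" "p \<in> fol_dom F i"
  shows "linear (ntriv M F i p)"
  unfolding ntriv_def
  using linear_on_quotient linear_nproj surj_nproj linear_D[OF i] nproj_kernel[OF i] dom_subset[OF i(1)] i(2) by blast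

lemma ntriv_inj:
  assumes i: "i \<in> fol_index F" "p \<in> fol_dom F i" and 0: "ntriv M F i p u = 0"
  shows "u = 0"
proof -
  have p: "p \<in> carrier_of M" using dom_subset i by blast
  obtain X where X: "u = nproj M F p X" by (rule nproj_obtain[OF p])
  then show ?thesis using 0 nproj_kernel[OF i] ntriv_nproj[OF i] by simp
qed

lemma ntriv_at:
  assumes p: "p \<in> carrier_of M"
  shows "ntriv M F (fol_at F p) p u = u"
proof -
  obtain X where X: "u = nproj M F p X" by (rule nproj_obtain[OF p])
  then show ?thesis using ntriv_nproj[OF at_index[OF p] at_dom[OF p]] by (simp add: nproj_eq)
qed

lemma ntriv_transition:
  assumes i: "i \<in> fol_index F" "p \<in> fol_dom F i" and j: "j \<in> fol_index F" "p \<in> fol_dom F j"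
  shows "ntriv M F i p u = mderiv T T (transition i j) (fol_map F j p) (ntriv M F j p u)"
proof -
  have p: "p \<in> carrier_of M" using dom_subset i by blast
  obtain X where X: "u = nproj M F p X" by (rule nproj_obtain[OF p])
  then show ?thesis using ntriv_nproj[OF i] ntriv_nproj[OF j] D_transition[OF i j] by simp
qed

lemma horizontal_lift:
  assumes i: "i \<in> fol_index F" "p \<in> fol_dom F i"
  shows "\<exists>X. D i p X = u \<and> (\<forall>Y. D i p Y = 0 \<longrightarrow> g p X Y = 0)"
proof -
  have p: "p \<in> carrier_of M" using dom_subset i by blast
  note lin = linear_D[OF i]
  have gp: "inner_product (g p)" by (rule inner_product_metric[OF riemannian(1) p])
  obtain X where X: "D i p X = u" using surj_D[OF i] by (metis surjD)
  have "subspace {Y. D i p Y = 0}" by (rule linear_subspace_kernel[OF lin])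
  from orthogonal_projection[OF gp this, of X] obtain Y where
    Y: "D i p Y = 0" "\<And>Z. D i p Z = 0 \<Longrightarrow> g p (X - Y) Z = 0" by blast
  then show ?thesis using X linear_diff[OF lin, of X Y] by (intro exI[of _ "X - Y"]) simp
qed

text \<open>Two horizontal lifts of \<open>u\<close> differ by a vector in the kernel that is
  orthogonal to itself, so the description in \<open>nlift\<close> is unambiguous.\<close>

lemma nproj_nlift:
  assumes p: "p \<in> carrier_of M"
  shows "nproj M F p (nlift M g F p u) = u"
proof -
  note i = at_index[OF p] at_dom[OF p]
  note lin = linear_D[OF i]
  have gp: "inner_product (g p)" by (rule inner_product_metric[OF riemannian(1) p])
  then have bil: "bilinear (g p)" by (simp add: inner_product_def)
  let ?P = "\<lambda>X. nproj M F p X = u \<and> (\<forall>Y. nproj M F p Y = 0 \<longrightarrow> g p X Y = 0)"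
  have uniq: "X = X'" if "?P X" "?P X'" for X X'
  proof (rule ccontr)
    assume "X \<noteq> X'"
    then have "g p (X - X') (X - X') > 0" using gp by (simp add: inner_product_def)
    moreover have "nproj M F p (X - X') = 0" using that linear_diff[OF lin] by (simp add: nproj_eq)
    then have "g p X (X - X') = 0" "g p X' (X - X') = 0" using that by blast+
    ultimately show False by (simp add: bilinear_lsub[OF bil])
  qed
  obtain X where "?P X" using horizontal_lift[OF i, of u] unfolding nproj_eq by blast
  then have "?P (nlift M g F p u)"
    unfolding nlift_def using uniq by (intro theI[of ?P X]) blast+
  then show ?thesis by blast
qed

text \<open>Both sides equal \<open>g\<close> on horizontal lifts. The submersion \<open>i\<close>
  and the preferred one have the same kernel at \<open>p\<close>, hence the same horizontal vectors,
  and both are Riemannian submersions.\<close>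

lemma nmetric_ntriv:
  assumes i: "i \<in> fol_index F" "p \<in> fol_dom F i"
  shows "nmetric F p u v = h (fol_map F i p) (ntriv M F i p u) (ntriv M F i p v)"
proof -
  have p: "p \<in> carrier_of M" using dom_subset i by blast
  note a = at_index[OF p] at_dom[OF p]
  obtain X where X: "nproj M F p X = u" "\<And>Y. nproj M F p Y = 0 \<Longrightarrow> g p X Y = 0"
    using horizontal_lift[OF a, of u] unfolding nproj_eq by blast
  obtain X' where X': "nproj M F p X' = v" "\<And>Y. nproj M F p Y = 0 \<Longrightarrow> g p X' Y = 0"
    using horizontal_lift[OF a, of v] unfolding nproj_eq by blast
  have "nmetric F p u v = g p X X'"
    unfolding nmetric_def X(1)[symmetric] X'(1)[symmetric] nproj_eq
    by (rule riemannian_submersion[OF a]) (use X X' in \<open>auto simp: nproj_eq\<close>)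
  also have "g p X X' = h (fol_map F i p) (D i p X) (D i p X')"
    by (rule riemannian_submersion[OF i, symmetric]) (use X X' nproj_kernel[OF i] in auto)
  finally show ?thesis using ntriv_nproj[OF i] X(1) X'(1) by metis
qed

lemma inner_product_nmetric: "p \<in> carrier_of M \<Longrightarrow> inner_product (nmetric F p)"
  unfolding nmetric_def using inner_product_metric[OF riemannian(2)] fol_map_carrier at_index at_dom by blast

lemma nframe_apply:
  assumes i: "i \<in> fol_index F" "p \<in> fol_dom F i" and C: "C \<in> atlas T" "fol_map F i p \<in> fst C"
  shows "nframe M F i C p *v u = to_coord T C (fol_map F i p) (ntriv M F i p u)"
    "invertible (nframe M F i C p)"
proof -
  have lin: "linear (to_coord T C (fol_map F i p) \<circ> ntriv M F i p)"
    using ntriv_linear[OF i] to_from_coord(3)[OF smooth(2) C] linear_compose by blast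
  show e: "nframe M F i C p *v u = to_coord T C (fol_map F i p) (ntriv M F i p u)" for u
    unfolding nframe_def using matrix_apply[OF lin] by simp
  have "u = 0" if "nframe M F i C p *v u = 0" for u
  proof -
    have "ntriv M F i p u = from_coord T C (fol_map F i p) 0"
      using that e[of u] to_from_coord(2)[OF smooth(2) C] by (metis comp_apply id_apply)
    then have "ntriv M F i p u = 0" using linear_0[OF to_from_coord(4)[OF smooth(2) C]] by simp
    then show ?thesis by (rule ntriv_inj[OF i])
  qed
  then show "invertible (nframe M F i C p)"
    by (simp add: invertible_left_inverse matrix_left_invertible_ker)
qed

lemma invertible_ntriv:
  assumes i: "i \<in> fol_index F" "p \<in> fol_dom F i"
  shows "invertible (matrix (ntriv M F i p))" "matrix (ntriv M F i p) *v u = ntriv M F i p u"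
proof -
  show e: "matrix (ntriv M F i p) *v u = ntriv M F i p u" for u by (rule matrix_apply[OF ntriv_linear[OF i]])
  show "invertible (matrix (ntriv M F i p))"
    using ntriv_inj[OF i] by (simp add: invertible_left_inverse matrix_left_invertible_ker e)
qed

lemma nframe_matrix:
  assumes i: "i \<in> fol_index F" "p \<in> fol_dom F i" and C: "C \<in> atlas T" "fol_map F i p \<in> fst C"
  shows "nframe M F i C p = matrix (to_coord T C (fol_map F i p)) ** matrix (ntriv M F i p)"
    "invertible (matrix (to_coord T C (fol_map F i p)))"
proof -
  note tc = to_from_coord[OF smooth(2) C]
  show "nframe M F i C p = matrix (to_coord T C (fol_map F i p)) ** matrix (ntriv M F i p)"
    by (rule matrix_eq[THEN iffD2])
      (simp add: nframe_apply[OF i C] invertible_ntriv[OF i] matrix_apply[OF tc(3)] flip: matrix_vector_mul_assoc)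
  have "matrix (from_coord T C (fol_map F i p)) ** matrix (to_coord T C (fol_map F i p)) = mat 1"
    by (rule matrix_eq[THEN iffD2])
      (use tc(2) in \<open>simp add: matrix_apply[OF tc(3)] matrix_apply[OF tc(4)] fun_eq_iff flip: matrix_vector_mul_assoc\<close>)
  then show "invertible (matrix (to_coord T C (fol_map F i p)))"
    using invertible_left_inverse by blast
qed

end

section \<open>Leaves of the lifted foliation\<close>

text \<open>By \<open>tr\<close>, all points of \<open>U i\<close> on one plaque of
  \<open>f m\<close> lie on one plaque of \<open>f i\<close>. So one more link of a chain inside
  \<open>I0\<close> reaches, in each \<open>U i\<close>, at most one value per index
  \<open>m\<close> and value of \<open>f m\<close> reached before; induction on the length keeps the
  set countable. The hypothesis \<open>conn\<close> replaces an arbitrary link by a chain inside the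
  countable \<open>I0\<close>.\<close>

lemma countable_plaque_values:
  assumes I0: "countable I0"
    and tr: "\<And>i j w w'. i \<in> I \<Longrightarrow> j \<in> I \<Longrightarrow> w \<in> U i \<Longrightarrow> w \<in> U j \<Longrightarrow> w' \<in> U i \<Longrightarrow> w' \<in> U j \<Longrightarrow>
      f j w = f j w' \<Longrightarrow> f i w = f i w'"
    and sub: "I0 \<subseteq> I"
    and conn: "\<And>i w w'. i \<in> I \<Longrightarrow> w \<in> U i \<Longrightarrow> w' \<in> U i \<Longrightarrow> f i w = f i w' \<Longrightarrow> plaque_chain I0 U f w w'"
    and i: "i \<in> I"
  shows "countable {f i w | w. w \<in> U i \<and> plaque_chain I U f w0 w}"
proof -
  define R where "R = (\<lambda>p q. \<exists>i\<in>I0. p \<in> U i \<and> q \<in> U i \<and> f i p = f i q)"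
  define S where "S = (\<lambda>n. {w. (R ^^ n) w0 w})"
  have chain: "plaque_chain I0 U f w0 w" if "plaque_chain I U f w0 w" for w
    using that unfolding plaque_chain_def[of I]
  proof (induction rule: rtranclp_induct)
    case base
    then show ?case by (simp add: plaque_chain_def)
  next
    case (step y z)
    then have "plaque_chain I0 U f y z" using conn by blast
    with step.IH show ?case unfolding plaque_chain_def by (rule rtranclp_trans)
  qed
  have cnt: "countable (f i ` (S n \<inter> U i))" if "i \<in> I" for n i
    using that
  proof (induction n arbitrary: i)
    case 0
    have "S 0 \<inter> U i \<subseteq> {w0}" by (auto simp: S_def)
    then show ?case using countable_finite finite_subset by (metis countable_image finite.emptyI finite.insertI)
  next
    case (Suc n)
    \<comment> \<open>The transition from values of \<open>f m\<close> to values of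
      \<open>f i\<close>, read off at any point with the given \<open>f m\<close> value.\<close>
    define K where "K = (\<lambda>m v. f i (SOME w. w \<in> U i \<inter> U m \<and> f m w = v))"
    have "f i ` (S (Suc n) \<inter> U i) \<subseteq> (\<Union>m\<in>I0. K m ` (f m ` (S n \<inter> U m)))"
    proof (rule image_subsetI)
      fix w assume w: "w \<in> S (Suc n) \<inter> U i"
      then obtain w' m where w': "w' \<in> S n" "m \<in> I0" "w' \<in> U m" "w \<in> U m" "f m w' = f m w"
        by (auto simp: S_def R_def)
      define v where "v = (SOME x. x \<in> U i \<inter> U m \<and> f m x = f m w')"
      have "v \<in> U i \<inter> U m \<and> f m v = f m w'"
        unfolding v_def by (rule someI[of _ w]) (use w w' in simp)
      then have "f i v = f i w" using tr[of i m v w] Suc.prems w' w sub by auto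
      then have "f i w = K m (f m w')" by (simp add: K_def v_def)
      then show "f i w \<in> (\<Union>m\<in>I0. K m ` (f m ` (S n \<inter> U m)))" using w' by blast
    qed
    moreover have "countable (K m ` (f m ` (S n \<inter> U m)))" if "m \<in> I0" for m
      by (rule countable_image, rule Suc.IH) (use that sub in blast)
    then have "countable (\<Union>m\<in>I0. K m ` (f m ` (S n \<inter> U m)))"
      using I0 by (intro countable_UN) auto
    ultimately show ?case by (rule countable_subset)
  qed
  have "{f i w | w. w \<in> U i \<and> plaque_chain I U f w0 w} \<subseteq> (\<Union>n. f i ` (S n \<inter> U i))"
  proof
    fix x assume "x \<in> {f i w | w. w \<in> U i \<and> plaque_chain I U f w0 w}"
    then obtain w where w: "x = f i w" "w \<in> U i" "plaque_chain I U f w0 w" by blast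
    from chain[OF w(3)] have "R\<^sup>*\<^sup>* w0 w" unfolding plaque_chain_def R_def .
    then obtain n where "w \<in> S n" unfolding S_def rtranclp_power by blast
    then show "x \<in> (\<Union>n. f i ` (S n \<inter> U i))" using w by blast
  qed
  moreover have "countable (\<Union>n. f i ` (S n \<inter> U i))" using cnt[OF i] by blast
  ultimately show ?thesis by (rule countable_subset)
qed

context foliated_manifold
begin

text \<open>Second countability of the manifold enters here, through the Lindelof property.\<close>

lemma countable_subcover:
  obtains I0 where "countable I0" "I0 \<subseteq> fol_index F" "(\<Union>i\<in>I0. fol_dom F i) = carrier_of M"
proof -
  have "second_countable (mtop M)" using smooth(1) by (simp add: smooth_manifold_def)
  then have L: "Lindelof_space (mtop M)" by (rule second_countable_imp_Lindelof_space)
  have "\<exists>\<V>. countable \<V> \<and> \<V> \<subseteq> fol_dom F ` fol_index F \<and> \<Union>\<V> = carrier_of M"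
    by (rule Lindelof_spaceD[OF L]) (use dom_open dom_Union in auto)
  then obtain \<V> where V: "countable \<V>" "\<V> \<subseteq> fol_dom F ` fol_index F" "\<Union>\<V> = carrier_of M"
    by (elim exE conjE)
  then obtain I0 where I0: "countable I0" "I0 \<subseteq> fol_index F" "\<V> = fol_dom F ` I0"
    using countable_subset_image[of \<V> "fol_dom F" "fol_index F"] by metis
  show ?thesis by (rule that[OF I0(1,2)]) (use V(3) I0(3) in simp)
qed

abbreviation "twist_dom i \<equiv> {w \<in> twistor_bundle M F. fst w \<in> fol_dom F i}"

text \<open>Passing from \<open>j\<close> to \<open>i\<close> conjugates by the derivative of the
  transition map at \<open>f_j(z)\<close>. That matrix is the same at all points with the same value
  under \<open>f_j\<close>, so equal images under one twistor submersion give equal images under the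
  other.\<close>

lemma twistor_submersion_transition:
  assumes i: "i \<in> fol_index F" and j: "j \<in> fol_index F"
    and w: "fst w \<in> fol_dom F i" "fst w \<in> fol_dom F j" and w': "fst w' \<in> fol_dom F i" "fst w' \<in> fol_dom F j"
    and eq: "twistor_submersion M F j w = twistor_submersion M F j w'"
  shows "twistor_submersion M F i w = twistor_submersion M F i w'"
proof -
  obtain y P where wy: "w = (y, P)" by (cases w)
  obtain y' P' where wy': "w' = (y', P')" by (cases w')
  define N where "N = (\<lambda>i z. matrix (ntriv M F i z))"
  have t: "fol_map F j y = fol_map F j y'" and
    PP: "N j y ** P ** matrix_inv (N j y) = N j y' ** P' ** matrix_inv (N j y')"
    using eq by (auto simp: wy wy' twistor_submersion_def N_def)
  \<comment> \<open>This matrix is shown to represent the derivative of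
    \<open>transition i j\<close>, which depends on \<open>z\<close> through
    \<open>fol_map F j z\<close> only.\<close>
  define L where "L = (\<lambda>z. N i z ** matrix_inv (N j z))"
  have inv: "invertible (N k z)" if "k \<in> fol_index F" "z \<in> fol_dom F k" for k z
    using invertible_ntriv[OF that] by (simp add: N_def)
  have Lz: "L z *v v = mderiv T T (transition i j) (fol_map F j z) v"
    if z: "z \<in> fol_dom F i" "z \<in> fol_dom F j" for z v
  proof -
    have "L z *v v = ntriv M F i z (matrix_inv (N j z) *v v)"
      by (simp add: L_def N_def invertible_ntriv[OF i z(1)] flip: matrix_vector_mul_assoc)
    also have "\<dots> = mderiv T T (transition i j) (fol_map F j z) (ntriv M F j z (matrix_inv (N j z) *v v))"
      by (rule ntriv_transition[OF i z(1) j z(2)])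
    also have "ntriv M F j z (matrix_inv (N j z) *v v) = (N j z ** matrix_inv (N j z)) *v v"
      by (simp add: N_def invertible_ntriv[OF j z(2)] flip: matrix_vector_mul_assoc)
    finally show ?thesis by (simp add: matrix_inv_right_left[OF inv[OF j z(2)]])
  qed
  have LL: "L y = L y'"
    by (rule matrix_eq[THEN iffD2]) (use Lz w w' t in \<open>simp add: wy wy'\<close>)
  have conj: "N i z ** Q ** matrix_inv (N i z) = L z ** (N j z ** Q ** matrix_inv (N j z)) ** matrix_inv (L z)"
    if z: "z \<in> fol_dom F i" "z \<in> fol_dom F j" for z Q
  proof -
    note ij = matrix_inv_right_left[OF inv[OF j z(2)]] and ii = matrix_inv_right_left[OF inv[OF i z(1)]]
    have Ni: "N i z = L z ** N j z"
      by (simp add: L_def ij flip: matrix_mul_assoc)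
    have "L z ** (N j z ** matrix_inv (N i z)) = mat 1"
      using ii(1) by (simp add: Ni[symmetric] matrix_mul_assoc)
    then have Li: "matrix_inv (L z) = N j z ** matrix_inv (N i z)" by (rule matrix_inv_unique)
    have "L z ** (N j z ** Q ** matrix_inv (N j z)) ** matrix_inv (L z) =
      (L z ** N j z) ** Q ** (matrix_inv (N j z) ** N j z) ** matrix_inv (N i z)"
      unfolding Li by (simp only: matrix_mul_assoc)
    then show ?thesis by (simp add: ij Ni[symmetric])
  qed
  have "fol_map F i y = fol_map F i y'"
    using transition(1)[OF i j] w w' t by (simp add: wy wy')
  moreover have "N i y ** P ** matrix_inv (N i y) = N i y' ** P' ** matrix_inv (N i y')"
    using conj[of y P] conj[of y' P'] w w' LL PP by (simp add: wy wy')
  ultimately show ?thesis by (simp add: wy wy' twistor_submersion_def N_def)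
qed

text \<open>Over every point \<open>z\<close> of the plaque of \<open>fst w\<close> there is a
  complex structure with the same image in \<open>Z(T)\<close> as \<open>w\<close>. It is orthogonal
  because \<open>df_i\<close> identifies both normal spaces isometrically with the same tangent
  space of the model.\<close>

lemma twistor_lift:
  assumes i: "i \<in> fol_index F" and w: "w \<in> twist_dom i" and z: "z \<in> fol_dom F i" "fol_map F i z = fol_map F i (fst w)"
  defines "N \<equiv> matrix (ntriv M F i z)"
  defines "lw \<equiv> (z, matrix_inv N ** snd (twistor_submersion M F i w) ** N)"
  shows "lw \<in> twist_dom i" "twistor_submersion M F i lw = twistor_submersion M F i w"
proof -
  obtain y P where wy: "w = (y, P)" by (cases w)
  have y: "y \<in> fol_dom F i" and yP: "P ** P = - mat 1" "\<And>u v. nmetric F y (P *v u) (P *v v) = nmetric F y u v"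
    using w by (auto simp: wy twistor_bundle_def)
  define N' where "N' = matrix (ntriv M F i y)"
  define P0 where "P0 = N' ** P ** matrix_inv N'"
  have tw: "twistor_submersion M F i w = (fol_map F i y, P0)"
    by (simp add: wy twistor_submersion_def P0_def N'_def)
  note iN = invertible_ntriv[OF i z(1), folded N_def] and iN' = invertible_ntriv[OF i y, folded N'_def]
  note inv = matrix_inv_right_left[OF iN(1)] and inv' = matrix_inv_right_left[OF iN'(1)]
  define Q where "Q = matrix_inv N ** P0 ** N"
  have lw: "lw = (z, Q)" by (simp add: lw_def tw Q_def)
  have neg: "X ** (- mat 1) = - X" "(- X) ** Y = - (X ** Y)" for X Y :: "real^'q^'q"
    using linear_neg[OF linear_matrix_mult_right, of X "mat 1"] linear_neg[OF linear_matrix_mult_left, of X Y] by auto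
  have "P0 ** P0 = N' ** P ** (matrix_inv N' ** N') ** P ** matrix_inv N'"
    unfolding P0_def by (simp only: matrix_mul_assoc)
  also have "\<dots> = N' ** (P ** P) ** matrix_inv N'" by (simp add: inv' matrix_mul_assoc)
  also have "\<dots> = - mat 1" by (simp add: yP neg inv')
  finally have P02: "P0 ** P0 = - mat 1" .
  have "Q ** Q = matrix_inv N ** P0 ** (N ** matrix_inv N) ** P0 ** N"
    unfolding Q_def by (simp only: matrix_mul_assoc)
  also have "\<dots> = matrix_inv N ** (P0 ** P0) ** N" by (simp add: inv matrix_mul_assoc)
  also have "\<dots> = - mat 1" by (simp add: P02 neg inv)
  finally have Q2: "Q ** Q = - mat 1" .
  have hy: "nmetric F y u v = h (fol_map F i y) (N' *v u) (N' *v v)" for u v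
    using nmetric_ntriv[OF i y, of u v] by (simp add: iN'(2))
  have hz: "nmetric F z u v = h (fol_map F i y) (N *v u) (N *v v)" for u v
    using nmetric_ntriv[OF i z(1), of u v] z(2) by (simp add: iN(2) wy)
  have hP0: "h (fol_map F i y) (P0 *v a) (P0 *v b) = h (fol_map F i y) a b" for a b
  proof -
    have ab: "P0 *v x = N' *v (P *v (matrix_inv N' *v x))" "N' *v (matrix_inv N' *v x) = x" for x
      by (simp_all add: P0_def inv' matrix_vector_mul_assoc matrix_mul_assoc)
    have "h (fol_map F i y) (P0 *v a) (P0 *v b) = nmetric F y (P *v (matrix_inv N' *v a)) (P *v (matrix_inv N' *v b))"
      by (simp add: hy ab)
    also have "\<dots> = nmetric F y (matrix_inv N' *v a) (matrix_inv N' *v b)" by (rule yP)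
    also have "\<dots> = h (fol_map F i y) a b" by (simp add: hy ab)
    finally show ?thesis .
  qed
  have "nmetric F z (Q *v u) (Q *v v) = nmetric F z u v" for u v
  proof -
    have "N *v (Q *v x) = P0 *v (N *v x)" for x
      by (simp add: Q_def matrix_vector_mul_assoc matrix_mul_assoc inv)
    then show ?thesis by (simp add: hz hP0)
  qed
  then show "lw \<in> twist_dom i"
    using z dom_subset[OF i] Q2 by (auto simp: lw twistor_bundle_def)
  have "N ** Q ** matrix_inv N = (N ** matrix_inv N) ** P0 ** (N ** matrix_inv N)"
    unfolding Q_def by (simp only: matrix_mul_assoc)
  then show "twistor_submersion M F i lw = twistor_submersion M F i w"
    using z by (simp add: lw tw twistor_submersion_def N_def[symmetric] N'_def[symmetric] P0_def[symmetric] inv wy)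
qed

lemma twistor_lift_unique:
  assumes i: "i \<in> fol_index F" "fst w \<in> fol_dom F i" and N: "N = matrix (ntriv M F i (fst w))"
  shows "w = (fst w, matrix_inv N ** snd (twistor_submersion M F i w) ** N)"
proof -
  obtain y P where wy: "w = (y, P)" by (cases w)
  have "invertible N" using invertible_ntriv(1)[OF i] by (simp add: N)
  note inv = matrix_inv_right_left[OF this]
  have "matrix_inv N ** (N ** P ** matrix_inv N) ** N = (matrix_inv N ** N) ** P ** (matrix_inv N ** N)"
    by (simp only: matrix_mul_assoc)
  then show ?thesis by (simp add: wy twistor_submersion_def N inv[unfolded N wy fst_conv])
qed

text \<open>Lift the base plaque \<open>Pl\<close> through \<open>w\<close>. Inside one domain of
  the subcover all lifted points share a plaque, so reachability from \<open>w\<close> by links in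
  \<open>I0\<close> is constant on each such domain within \<open>Pl\<close>; connectedness of
  \<open>Pl\<close> then carries it to \<open>w'\<close>.\<close>

lemma twistor_plaque_chain:
  assumes I0: "I0 \<subseteq> fol_index F" "(\<Union>i\<in>I0. fol_dom F i) = carrier_of M"
    and i: "i \<in> fol_index F" and w: "w \<in> twist_dom i" and w': "w' \<in> twist_dom i"
    and eq: "twistor_submersion M F i w = twistor_submersion M F i w'"
  shows "plaque_chain I0 twist_dom (twistor_submersion M F) w w'"
proof -
  define Pl where "Pl = {z \<in> fol_dom F i. fol_map F i z = fol_map F i (fst w)}"
  define N where "N = (\<lambda>z. matrix (ntriv M F i z))"
  define lift where "lift = (\<lambda>z. (z, matrix_inv (N z) ** snd (twistor_submersion M F i w) ** N z))"
  have lift: "lift z \<in> twist_dom i" "twistor_submersion M F i (lift z) = twistor_submersion M F i w" if "z \<in> Pl" for z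
    using twistor_lift[OF i w, of z] that unfolding Pl_def lift_def N_def by blast+
  have fst_lift: "fst (lift z) = z" for z by (simp add: lift_def)
  have fst_eq: "fol_map F i (fst w) = fol_map F i (fst w')"
    using eq by (cases w; cases w') (simp add: twistor_submersion_def)
  have yPl: "fst w \<in> Pl" "fst w' \<in> Pl" using w w' fst_eq by (auto simp: Pl_def)
  have lw: "lift (fst w) = w" "lift (fst w') = w'"
    using twistor_lift_unique[OF i, of w "N (fst w)"] twistor_lift_unique[OF i, of w' "N (fst w')"] w w' eq
    by (simp_all add: lift_def N_def)
  define A where "A = {z \<in> Pl. plaque_chain I0 twist_dom (twistor_submersion M F) w (lift z)}"
  have refl: "fst w \<in> A" using yPl by (simp add: A_def lw plaque_chain_def)
  have spread: "z' \<in> A" if n: "n \<in> I0" and z: "z \<in> A" "z \<in> fol_dom F n" and z': "z' \<in> Pl" "z' \<in> fol_dom F n" for n z z'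
  proof -
    have zPl: "z \<in> Pl" using z by (simp add: A_def)
    have "twistor_submersion M F n (lift z) = twistor_submersion M F n (lift z')"
      by (rule twistor_submersion_transition[of n i])
        (use n I0 i z z' zPl lift fst_lift in \<open>auto simp: Pl_def\<close>)
    moreover have "lift z \<in> twist_dom n" "lift z' \<in> twist_dom n"
      using lift(1)[OF zPl] lift(1)[OF z'(1)] z z' fst_lift by auto
    ultimately have "plaque_chain I0 twist_dom (twistor_submersion M F) (lift z) (lift z')"
      unfolding plaque_chain_def using n by (intro r_into_rtranclp) blast
    then show ?thesis using z z'(1) unfolding A_def plaque_chain_def by (auto intro: rtranclp_trans)
  qed
  \<comment> \<open>Domains that contain a reached point against those that contain none. On
    \<open>Pl\<close> they cannot overlap, since every point of \<open>Pl\<close> in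
    \<open>E1\<close> is itself reached.\<close>
  define E1 where "E1 = (\<Union>n\<in>{n \<in> I0. fol_dom F n \<inter> A \<noteq> {}}. fol_dom F n)"
  define E2 where "E2 = (\<Union>n\<in>{n \<in> I0. fol_dom F n \<inter> A = {}}. fol_dom F n)"
  have op: "openin (mtop M) E1" "openin (mtop M) E2"
    unfolding E1_def E2_def using I0 dom_open by (auto intro!: openin_Union)
  have cov: "Pl \<subseteq> E1 \<union> E2"
  proof
    fix z assume "z \<in> Pl"
    then have "z \<in> (\<Union>i\<in>I0. fol_dom F i)" unfolding I0(2) using dom_subset[OF i] by (auto simp: Pl_def)
    then obtain n where n: "n \<in> I0" "z \<in> fol_dom F n" by blast
    show "z \<in> E1 \<union> E2"
    proof (cases "fol_dom F n \<inter> A = {}")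
      case True
      then have "z \<in> E2" unfolding E2_def using n by blast
      then show ?thesis ..
    next
      case False
      then have "z \<in> E1" unfolding E1_def using n by blast
      then show ?thesis ..
    qed
  qed
  have E1A: "z \<in> A" if "z \<in> Pl" "z \<in> E1" for z using that spread unfolding E1_def by blast
  have disj: "E1 \<inter> E2 \<inter> Pl = {}"
  proof (rule ccontr)
    assume "E1 \<inter> E2 \<inter> Pl \<noteq> {}"
    then obtain z where "z \<in> E1" "z \<in> E2" "z \<in> Pl" by blast
    moreover from this have "z \<in> A" using E1A by blast
    ultimately show False unfolding E2_def by blast
  qed
  have "E1 \<inter> Pl \<noteq> {}"
  proof -
    have "fst w \<in> (\<Union>i\<in>I0. fol_dom F i)" unfolding I0(2) using w dom_subset[OF i] by auto
    then obtain n where "n \<in> I0" "fst w \<in> fol_dom F n" by blast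
    then have "fst w \<in> E1" unfolding E1_def using refl by blast
    then show ?thesis using yPl by blast
  qed
  moreover have "connectedin (mtop M) Pl"
    unfolding Pl_def by (rule plaque_connected[OF i])
  then have "\<nexists>E1 E2. openin (mtop M) E1 \<and> openin (mtop M) E2 \<and> Pl \<subseteq> E1 \<union> E2 \<and> E1 \<inter> E2 \<inter> Pl = {} \<and>
      E1 \<inter> Pl \<noteq> {} \<and> E2 \<inter> Pl \<noteq> {}"
    unfolding connectedin by (rule conjunct2)
  ultimately have "E2 \<inter> Pl = {}"
  proof (intro ccontr[of "E2 \<inter> Pl = {}"])
    assume E1: "E1 \<inter> Pl \<noteq> {}" and E2: "E2 \<inter> Pl \<noteq> {}"
      and no: "\<nexists>E1 E2. openin (mtop M) E1 \<and> openin (mtop M) E2 \<and> Pl \<subseteq> E1 \<union> E2 \<and> E1 \<inter> E2 \<inter> Pl = {} \<and>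
        E1 \<inter> Pl \<noteq> {} \<and> E2 \<inter> Pl \<noteq> {}"
    show False by (rule notE[OF no]) (intro exI[of _ E1] exI[of _ E2] conjI op cov disj E1 E2)
  qed
  then have "fst w' \<in> A" using cov yPl(2) E1A by blast
  then show ?thesis by (simp add: A_def lw)
qed

lemma countable_twistor_leaf:
  assumes i: "i \<in> fol_index F"
  shows "countable {twistor_submersion M F i w | w. w \<in> twist_dom i \<and> twistor_same_leaf M F w0 w}"
proof -
  obtain I0 where I0: "countable I0" "I0 \<subseteq> fol_index F" "(\<Union>i\<in>I0. fol_dom F i) = carrier_of M"
    by (rule countable_subcover)
  show ?thesis unfolding twistor_same_leaf_def
    by (rule countable_plaque_values[OF I0(1) _ I0(2) twistor_plaque_chain[OF I0(2,3)] i])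
      (auto intro: twistor_submersion_transition)
qed

lemma twistor_same_leaf_fst:
  assumes "twistor_same_leaf M F w w'"
  shows "same_leaf F (fst w) (fst w')"
  using assms unfolding twistor_same_leaf_def same_leaf_def plaque_chain_def
proof (induction rule: rtranclp_induct)
  case (step y z)
  then obtain i where "i \<in> fol_index F" "fst y \<in> fol_dom F i" "fst z \<in> fol_dom F i"
    "twistor_submersion M F i y = twistor_submersion M F i z" by blast
  moreover from this have "fol_map F i (fst y) = fol_map F i (fst z)"
    by (cases y; cases z) (simp add: twistor_submersion_def)
  ultimately show ?case using step.IH by (auto intro: rtranclp.rtrancl_into_rtrancl)
qed simp

end

section \<open>Foliated maps into the twistor bundle\<close>

context foliated_manifold
begin

section \<open>The total space of the endomorphism bundle\<close>

abbreviation "EB \<equiv> endo_bundle M F"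

lemma endo_bundle_simps:
  "atlas EB = endo_atlas M F"
  "chart_at EB w = endo_chart M F (chart_at M (fst w)) (fol_at F (fst w)) (chart_at T (fol_map F (fol_at F (fst w)) (fst w)))"
  by (auto simp: endo_bundle_def split: prod.splits)

lemma endo_atlasI:
  "C \<in> atlas M \<Longrightarrow> i \<in> fol_index F \<Longrightarrow> Z \<in> atlas T \<Longrightarrow> endo_chart M F C i Z \<in> endo_atlas M F"
  unfolding endo_atlas_def by blast

lemma openin_endo_chart_preimage:
  assumes "E \<in> endo_atlas M F" "open S"
  shows "openin (mtop EB) {w \<in> fst E. snd E w \<in> S}"
  unfolding endo_bundle_def using assms
  by (cases E) (auto intro!: topology_generated_by_Basis)

lemma openin_endo_chart: "E \<in> endo_atlas M F \<Longrightarrow> openin (mtop EB) (fst E)"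
  using openin_endo_chart_preimage[of E UNIV] by simp

lemma fst_endo_chart: "fst (snd (endo_chart M F C i Z) w) = snd C (fst w)"
  by (cases w) (simp add: endo_chart_def)

lemma mem_endo_chart:
  "w \<in> fst (endo_chart M F C i Z) \<longleftrightarrow> fst w \<in> fst C \<and> fst w \<in> fol_dom F i \<and> fol_map F i (fst w) \<in> fst Z"
  by (cases w) (simp add: endo_chart_def)

lemma endo_chart_cover:
  assumes C: "C \<in> atlas M" and w: "fst w \<in> fst C"
  obtains i Z where "i \<in> fol_index F" "Z \<in> atlas T" "w \<in> fst (endo_chart M F C i Z)"
proof -
  have y: "fst w \<in> carrier_of M" using C w smooth_manifold_chart(5)[OF smooth(1)] by blast
  note a = at_index[OF y] at_dom[OF y]
  note t = smooth_manifold_chart_at[OF smooth(2) fol_map_carrier[OF a]]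
  show ?thesis by (rule that[OF a(1) t(1)]) (use a t w in \<open>simp add: mem_endo_chart\<close>)
qed

lemma topspace_endo_bundle: "topspace (mtop EB) = {w. fst w \<in> carrier_of M}"
proof -
  have "w \<in> topspace (mtop EB)" if "fst w \<in> carrier_of M" for w
  proof -
    note C = smooth_manifold_chart_at[OF smooth(1) that]
    obtain i Z where "i \<in> fol_index F" "Z \<in> atlas T" "w \<in> fst (endo_chart M F (chart_at M (fst w)) i Z)"
      by (rule endo_chart_cover[OF C])
    moreover from this C have "endo_chart M F (chart_at M (fst w)) i Z \<in> endo_atlas M F"
      unfolding endo_atlas_def by blast
    ultimately show ?thesis using openin_endo_chart openin_subset by blast
  qed
  moreover have "fst w \<in> carrier_of M" if w: "w \<in> topspace (mtop EB)" for w
  proof -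
    from w obtain W c where "(W, c) \<in> endo_atlas M F" "w \<in> W"
      by (auto simp: endo_bundle_def)
    then obtain C i Z where C: "C \<in> atlas M" "(W, c) = endo_chart M F C i Z"
      unfolding endo_atlas_def by blast
    then have "w \<in> fst (endo_chart M F C i Z)" using \<open>w \<in> W\<close> by (metis fst_conv)
    then show ?thesis using smooth_manifold_chart(5)[OF smooth(1) C(1)] by (auto simp: mem_endo_chart)
  qed
  ultimately show ?thesis by blast
qed

lemma continuous_map_fst_endo_bundle: "continuous_map (mtop EB) (mtop M) fst"
  unfolding continuous_map_def
proof (intro conjI allI impI)
  show "fst \<in> topspace (mtop EB) \<rightarrow> carrier_of M" by (auto simp: topspace_endo_bundle)
  fix V assume V: "openin (mtop M) V"
  show "openin (mtop EB) {w \<in> topspace (mtop EB). fst w \<in> V}"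
  proof (subst openin_subopen, intro ballI)
    fix w assume w: "w \<in> {w \<in> topspace (mtop EB). fst w \<in> V}"
    then have y: "fst w \<in> carrier_of M" by (simp add: topspace_endo_bundle)
    note C = smooth_manifold_chart_at[OF smooth(1) y]
    let ?C = "chart_at M (fst w)"
    obtain i Z where iD: "i \<in> fol_index F" "Z \<in> atlas T" "w \<in> fst (endo_chart M F ?C i Z)"
      by (rule endo_chart_cover[OF C])
    let ?E = "endo_chart M F ?C i Z"
    have E: "?E \<in> endo_atlas M F" using iD C unfolding endo_atlas_def by blast
    let ?S = "(snd ?C ` (fst ?C \<inter> V)) \<times> (UNIV :: (real^'q^'q) set)"
    have S: "open ?S" using open_chart_image[OF smooth(1) C(1) V] by (intro open_Times) auto
    show "\<exists>W. openin (mtop EB) W \<and> w \<in> W \<and> W \<subseteq> {w \<in> topspace (mtop EB). fst w \<in> V}"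
    proof (intro exI conjI)
      show "openin (mtop EB) {v \<in> fst ?E. snd ?E v \<in> ?S}" by (rule openin_endo_chart_preimage[OF E S])
      show "w \<in> {v \<in> fst ?E. snd ?E v \<in> ?S}"
        using w iD C by (auto simp: mem_Times_iff fst_endo_chart)
      show "{v \<in> fst ?E. snd ?E v \<in> ?S} \<subseteq> {w \<in> topspace (mtop EB). fst w \<in> V}"
      proof (intro subsetI CollectI conjI)
        fix v assume v: "v \<in> {v \<in> fst ?E. snd ?E v \<in> ?S}"
        then show "v \<in> topspace (mtop EB)" using openin_subset[OF openin_endo_chart[OF E]] by blast
        from v have "fst v \<in> fst ?C" "snd ?C (fst v) \<in> snd ?C ` (fst ?C \<inter> V)"
          by (auto simp: mem_Times_iff fst_endo_chart mem_endo_chart)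
        then show "fst v \<in> V"
          using smooth_manifold_chart(4)[OF smooth(1) C(1)] by (auto dest: inj_onD)
      qed
    qed
  qed
qed

lemma endo_chart_at:
  assumes "fst w \<in> carrier_of M"
  shows "chart_at EB w \<in> endo_atlas M F" "w \<in> fst (chart_at EB w)"
proof -
  note C = smooth_manifold_chart_at[OF smooth(1) assms]
  note a = at_index[OF assms] at_dom[OF assms]
  note t = smooth_manifold_chart_at[OF smooth(2) fol_map_carrier[OF a]]
  show "chart_at EB w \<in> endo_atlas M F" "w \<in> fst (chart_at EB w)"
    unfolding endo_bundle_simps using C a t by (auto simp: mem_endo_chart intro: endo_atlasI)
qed

text \<open>The preferred bundle chart is built over the preferred chart of the base, so in
  coordinates \<open>fst\<close> is a linear projection. The derivative is computed directly in
  these charts, because \<open>EB\<close> has not been shown to satisfy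
  \<open>smooth_manifold\<close> and the chain rules above do not apply to it.\<close>

lemma mderiv_fst_endo_bundle:
  assumes y: "fst w \<in> carrier_of M"
  shows "mderiv EB M fst w \<xi> = fst \<xi>"
proof -
  note C = smooth_manifold_chart_at[OF smooth(1) y]
  note a = at_index[OF y] at_dom[OF y]
  note t = smooth_manifold_chart_at[OF smooth(2) fol_map_carrier[OF a]]
  let ?C = "chart_at M (fst w)" and ?i = "fol_at F (fst w)"
  let ?Z = "chart_at T (fol_map F ?i (fst w))"
  let ?E = "endo_chart M F ?C ?i ?Z"
  define W where "W = {z \<in> fol_dom F ?i. fol_map F ?i z \<in> fst ?Z}"
  have W: "openin (mtop M) W"
    unfolding W_def using smooth_manifold_chart(1)[OF smooth(2) t(1)]
    by (rule openin_smooth_map_preimage[OF fol_map_smooth[OF a(1)] dom_open[OF a(1)]])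
  let ?O = "(snd ?C ` (fst ?C \<inter> W)) \<times> (UNIV :: (real^'q^'q) set)"
  have opn: "open ?O" using open_chart_image[OF smooth(1) C(1) W] by (intro open_Times) auto
  have inO: "snd ?E w \<in> ?O" using C a t by (auto simp: mem_Times_iff fst_endo_chart W_def)
  have eq: "(snd ?C \<circ> fst \<circ> chart_inv ?E) x = fst x" if x: "x \<in> ?O" for x
  proof -
    obtain z where z: "z \<in> fst ?C" "z \<in> W" "fst x = snd ?C z" using x by (auto simp: mem_Times_iff)
    define R where "R = nframe M F ?i ?Z z"
    have "invertible R"
      unfolding R_def using nframe_apply(2)[OF a(1) _ t(1)] z by (simp add: W_def)
    note inv = matrix_inv_right_left[OF this]
    \<comment> \<open>Conjugating \<open>snd x\<close> back shows that every matrix is attained in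
      the fibre, so the open box lies in the chart image and \<open>chart_inv\<close> is a true
      inverse on it.\<close>
    have "R ** (matrix_inv R ** snd x ** R) ** matrix_inv R = (R ** matrix_inv R) ** snd x ** (R ** matrix_inv R)"
      by (simp only: matrix_mul_assoc)
    then have "snd ?E (z, matrix_inv R ** snd x ** R) = x"
      using z by (simp add: endo_chart_def R_def[symmetric] inv prod_eq_iff)
    moreover have "(z, matrix_inv R ** snd x ** R) \<in> fst ?E"
      using z by (simp add: mem_endo_chart W_def)
    ultimately have "x \<in> snd ?E ` fst ?E" by (metis image_eqI)
    from chart_inv_right(1)[OF this] show ?thesis
      by (metis comp_apply fst_endo_chart)
  qed
  have "mderiv EB M fst w = frechet_derivative (snd ?C \<circ> fst \<circ> chart_inv ?E) (at (snd ?E w))"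
    by (simp add: mderiv_def dir_deriv_def endo_bundle_simps)
  also have "\<dots> = frechet_derivative fst (at (snd ?E w))"
    by (rule frechet_derivative_cong_open[OF opn inO eq])
  also have "\<dots> = fst"
    by (rule frechet_derivative_at[symmetric]) (rule bounded_linear_imp_has_derivative[OF bounded_linear_fst])
  finally show ?thesis by simp
qed

end

section \<open>Maps into the twistor bundle and their derivative along leaves\<close>

locale foliated_twistor_map =
  foliated_manifold M g F + N: foliated_manifold N g' F'
  for M :: "('a, 'e::euclidean_space) mfd" and g :: "('a, 'e) metric"
    and F :: "('i, 'a, 't, 'q::finite) foliation"
    and N :: "('b, 'f::euclidean_space) mfd" and g' :: "('b, 'f) metric"
    and F' :: "('j, 'b, 's, 'r::finite) foliation" +
  fixes \<psi> :: "'a \<Rightarrow> 'b \<times> (real^'r^'r)"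
  assumes twistor_foliated: "twistor_foliated_map M F N F' \<psi>"
begin

abbreviation "\<phi> \<equiv> fst \<circ> \<psi>"

lemma \<psi>_smooth: "smooth_map_on (carrier_of M) M N.EB \<psi>"
  and \<psi>_leaf: "p \<in> carrier_of M \<Longrightarrow> q \<in> carrier_of M \<Longrightarrow> same_leaf F p q \<Longrightarrow> twistor_same_leaf N F' (\<psi> p) (\<psi> q)"
  and \<psi>_twistor: "p \<in> carrier_of M \<Longrightarrow> \<psi> p \<in> twistor_bundle N F'"
  using twistor_foliated unfolding twistor_foliated_map_def by auto

lemma \<phi>_carrier: "p \<in> carrier_of M \<Longrightarrow> \<phi> p \<in> carrier_of N"
  using \<psi>_twistor[of p] by (auto simp: twistor_bundle_def)

text \<open>Bundle charts over a fixed base chart cover the part of the bundle above it. On the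
  piece belonging to one bundle chart, the coordinate expression of \<open>\<phi>\<close> is the
  first component of that of \<open>\<psi>\<close>.\<close>

lemma \<phi>_smooth: "smooth_map_on (carrier_of M) M N \<phi>"
  unfolding smooth_map_on_def
proof (intro conjI)
  have "continuous_map (subtopology (mtop M) (carrier_of M)) (mtop N.EB) \<psi>"
    using \<psi>_smooth unfolding smooth_map_on_def by blast
  then show "continuous_map (subtopology (mtop M) (carrier_of M)) (mtop N) \<phi>"
    by (rule continuous_map_compose[OF _ N.continuous_map_fst_endo_bundle])
  show "\<forall>(U, c)\<in>atlas M. \<forall>(V, d)\<in>atlas N.
      smooth_on (c ` {p \<in> carrier_of M \<inter> U. \<phi> p \<in> V}) (d \<circ> \<phi> \<circ> chart_inv (U, c))"
  proof (clarify)
    fix U c V d assume C: "(U, c) \<in> atlas M" and D: "(V, d) \<in> atlas N"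
    define A where "A = {endo_chart N F' (V, d) i X | i X. i \<in> fol_index F' \<and> X \<in> atlas N.T}"
    define S where "S = (\<lambda>E :: ('b \<times> (real^'r^'r), 'f \<times> (real^'r^'r)) chart. c ` {p \<in> carrier_of M \<inter> U. \<psi> p \<in> fst E})"
    have A: "E \<in> endo_atlas N F'" if "E \<in> A" for E using that D unfolding A_def endo_atlas_def by blast
    have openS: "open (S E)" if "E \<in> A" for E
    proof -
      have "openin (mtop M) {p \<in> carrier_of M. \<psi> p \<in> fst E}"
        by (rule openin_smooth_map_preimage[OF \<psi>_smooth openin_topspace N.openin_endo_chart[OF A[OF that]]])
      from open_chart_image[OF smooth(1) C this] show ?thesis
        by (simp add: S_def Int_def conj_ac)
    qed
    have cover: "c ` {p \<in> carrier_of M \<inter> U. \<phi> p \<in> V} = (\<Union>E\<in>A. S E)"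
    proof (intro equalityI subsetI)
      fix x assume "x \<in> c ` {p \<in> carrier_of M \<inter> U. \<phi> p \<in> V}"
      then obtain p where p: "p \<in> carrier_of M" "p \<in> U" "\<phi> p \<in> V" "x = c p" by blast
      have "fst (\<psi> p) \<in> fst (V, d)" using p by simp
      from N.endo_chart_cover[OF D this] obtain i X where
        "i \<in> fol_index F'" "X \<in> atlas N.T" "\<psi> p \<in> fst (endo_chart N F' (V, d) i X)" .
      then show "x \<in> (\<Union>E\<in>A. S E)" using p unfolding A_def S_def by blast
    next
      fix x assume "x \<in> (\<Union>E\<in>A. S E)"
      then obtain i X p where "p \<in> carrier_of M" "p \<in> U" "x = c p" "\<psi> p \<in> fst (endo_chart N F' (V, d) i X)"
        unfolding A_def S_def by blast
      then show "x \<in> c ` {p \<in> carrier_of M \<inter> U. \<phi> p \<in> V}"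
        by (auto simp: N.mem_endo_chart)
    qed
    show "smooth_on (c ` {p \<in> carrier_of M \<inter> U. \<phi> p \<in> V}) (d \<circ> \<phi> \<circ> chart_inv (U, c))"
      unfolding smooth_on_def cover
    proof (intro allI Ck_on_UN openS)
      fix k E assume E: "E \<in> A"
      then obtain i X where iX: "E = endo_chart N F' (V, d) i X" unfolding A_def by blast
      have "smooth_on (S E) (snd E \<circ> \<psi> \<circ> chart_inv (U, c))"
        using smooth_map_on_smooth[OF \<psi>_smooth C, of E] A[OF E] by (simp add: S_def N.endo_bundle_simps)
      then have "Ck_on k (S E) (snd E \<circ> \<psi> \<circ> chart_inv (U, c))" by (simp add: smooth_on_def)
      from Ck_on_bounded_linear[OF bounded_linear_fst openS[OF E] this]
      show "Ck_on k (S E) (d \<circ> \<phi> \<circ> chart_inv (U, c))"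
        by (simp add: iX N.fst_endo_chart o_def)
    qed
  qed
qed

lemma \<phi>_foliated: "foliated_map M F N F' \<phi>"
  unfolding foliated_map_def using \<phi>_smooth \<psi>_leaf N.twistor_same_leaf_fst by auto

lemma \<phi>_mdiff: "p \<in> carrier_of M \<Longrightarrow> mdiff M N \<phi> p"
  by (rule smooth_map_on_mdiff[OF \<phi>_smooth subset_refl])

lemma \<phi>_mcont: "p \<in> carrier_of M \<Longrightarrow> mcont M N \<phi> p"
  by (rule smooth_map_on_mcont[OF \<phi>_smooth openin_topspace])

lemma has_derivative_\<psi>:
  assumes p: "p \<in> carrier_of M"
  shows "((snd (chart_at N.EB (\<psi> p)) \<circ> \<psi> \<circ> chart_inv (chart_at M p)) has_derivative mderiv M N.EB \<psi> p)
    (at (snd (chart_at M p) p))"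
proof -
  have "mdiff M N.EB \<psi> p" by (rule smooth_map_on_mdiff[OF \<psi>_smooth subset_refl p])
  moreover note smooth_manifold_chart_at[OF smooth(1) p] N.endo_chart_at[of "\<psi> p"] \<phi>_carrier[OF p]
  ultimately show ?thesis
    unfolding mderiv_def dir_deriv_def by (intro frechet_works) (auto simp: mdiff_def N.endo_bundle_simps(1))
qed

lemma mderiv_\<phi>:
  assumes p: "p \<in> carrier_of M"
  shows "mderiv M N \<phi> p X = fst (mderiv M N.EB \<psi> p X)"
proof -
  have "((\<lambda>x. fst ((snd (chart_at N.EB (\<psi> p)) \<circ> \<psi> \<circ> chart_inv (chart_at M p)) x)) has_derivative
    (\<lambda>X. fst (mderiv M N.EB \<psi> p X))) (at (snd (chart_at M p) p))"
    by (rule has_derivative_fst[OF has_derivative_\<psi>[OF p]])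
  moreover have "(\<lambda>x. fst ((snd (chart_at N.EB (\<psi> p)) \<circ> \<psi> \<circ> chart_inv (chart_at M p)) x)) =
    snd (chart_at N (\<phi> p)) \<circ> \<phi> \<circ> chart_inv (chart_at M p)"
    by (simp add: fun_eq_iff N.endo_bundle_simps N.fst_endo_chart)
  ultimately show ?thesis
    using has_derivative_unique[OF has_derivative_mderiv[OF smooth(1) N.smooth(1) \<phi>_mdiff[OF p]]] by metis
qed

text \<open>The second claim concerns the raw fibre component in the bundle chart. It agrees with
  the vertical part for such \<open>X\<close>, because the connection term is linear in the
  transverse velocity, which is zero by the first claim.\<close>

lemma leafwise_derivative:
  assumes p: "p \<in> carrier_of M" and X: "nproj M F p X = 0"
  shows "nproj N F' (\<phi> p) (mderiv M N \<phi> p X) = 0" "snd (mderiv M N.EB \<psi> p X) = 0"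
proof -
  let ?c = "chart_at M p" and ?i = "fol_at F p"
  let ?CT = "chart_at T (fol_map F ?i p)"
  let ?CN = "chart_at N (\<phi> p)" and ?j = "fol_at F' (\<phi> p)"
  let ?CT' = "chart_at N.T (fol_map F' ?j (\<phi> p))"
  let ?E = "endo_chart N F' ?CN ?j ?CT'"
  note c = smooth_manifold_chart_at[OF smooth(1) p]
  note a = at_index[OF p] at_dom[OF p]
  note ct = smooth_manifold_chart_at[OF smooth(2) fol_map_carrier[OF a]]
  note q = \<phi>_carrier[OF p]
  note cn = smooth_manifold_chart_at[OF N.smooth(1) q]
  note b = N.at_index[OF q] N.at_dom[OF q]
  note ct' = smooth_manifold_chart_at[OF N.smooth(2) N.fol_map_carrier[OF b]]
  have E: "?E \<in> endo_atlas N F'" by (rule N.endo_atlasI[OF cn(1) b(1) ct'(1)])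
  have Eat: "chart_at N.EB (\<psi> p) = ?E" by (simp add: N.endo_bundle_simps)
  have pE: "\<psi> p \<in> fst ?E" using cn b ct' by (simp add: N.mem_endo_chart)
  define x0 where "x0 = snd ?c p"
  define W where "W = {z \<in> fol_dom F ?i. fol_map F ?i z \<in> fst ?CT} \<inter> {z \<in> carrier_of M. \<psi> z \<in> fst ?E}"
  have W: "openin (mtop M) W" unfolding W_def
    by (intro openin_Int openin_smooth_map_preimage[OF fol_map_smooth[OF a(1)] dom_open[OF a(1)]]
        openin_smooth_map_preimage[OF \<psi>_smooth openin_topspace] smooth_manifold_chart(1)[OF smooth(2) ct(1)]
        N.openin_endo_chart E)
  define S where "S = snd ?c ` (fst ?c \<inter> W)"
  have S: "open S" unfolding S_def by (rule open_chart_image[OF smooth(1) c(1) W])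
  have x0S: "x0 \<in> S" using c a ct p pE by (auto simp: S_def x0_def W_def)
  have inv: "chart_inv ?c x \<in> fst ?c \<inter> W" "snd ?c (chart_inv ?c x) = x" if "x \<in> S" for x
    using that chart_inv_left[OF smooth(1) c(1)] by (auto simp: S_def)
  have cx0: "chart_inv ?c x0 = p" using chart_inv_left[OF smooth(1) c] by (simp add: x0_def)
  define f where "f = snd ?CT \<circ> fol_map F ?i \<circ> chart_inv ?c"
  define \<kappa> where "\<kappa> = snd ?E \<circ> \<psi> \<circ> chart_inv ?c"
  define H where "H = snd ?CT' \<circ> fol_map F' ?j \<circ> \<phi> \<circ> chart_inv ?c"
  have sub: "smooth_on S f" "continuous_on S \<kappa>"
  proof -
    have "smooth_on (snd ?c ` {z \<in> fol_dom F ?i \<inter> fst ?c. fol_map F ?i z \<in> fst ?CT}) f"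
      unfolding f_def by (rule smooth_map_on_smooth[OF fol_map_smooth[OF a(1)] c(1) ct(1)])
    moreover have "S \<subseteq> snd ?c ` {z \<in> fol_dom F ?i \<inter> fst ?c. fol_map F ?i z \<in> fst ?CT}"
      unfolding S_def W_def by blast
    ultimately show "smooth_on S f" unfolding smooth_on_def using Ck_on_subset by blast
    have "smooth_on (snd ?c ` {z \<in> carrier_of M \<inter> fst ?c. \<psi> z \<in> fst ?E}) \<kappa>"
      unfolding \<kappa>_def by (rule smooth_map_on_smooth[OF \<psi>_smooth c(1)]) (use E in \<open>simp add: N.endo_bundle_simps\<close>)
    then show "continuous_on S \<kappa>"
      by (rule continuous_on_subset[OF smooth_on_continuous]) (auto simp: S_def W_def)
  qed
  have df: "frechet_derivative f (at x0) = nproj M F p"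
    unfolding f_def x0_def nproj_eq
    by (rule frechet_derivative_at[symmetric]) (rule has_derivative_mderiv[OF smooth fol_map_mdiff[OF a]])
  obtain \<gamma> e where e: "e > 0" "\<gamma> 0 = x0" and d\<gamma>: "(\<gamma> has_derivative (\<lambda>t. t *\<^sub>R X)) (at 0)"
    and cont\<gamma>: "continuous_on {-e<..<e::real} \<gamma>" and \<gamma>: "\<And>t. t \<in> {-e<..<e} \<Longrightarrow> \<gamma> t \<in> S \<and> f (\<gamma> t) = f x0"
    by (rule curve_in_fibre[OF sub(1) S x0S, of X]) (use df X surj_nproj[OF p] in auto)
  \<comment> \<open>Transverse coordinates of \<open>\<psi>\<close>: the coordinates of
    \<open>f_j \<circ> \<phi>\<close> in the model and the matrix of \<open>P\<close> in the frame.
    They stay constant on a plaque of the lifted foliation and have values in a Euclidean space,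
    where derivatives make sense.\<close>
  define Z where "Z = (\<lambda>x. (H x, snd (\<kappa> x)))"
  have contH: "continuous_on S H"
  proof -
    let ?fN = "snd ?CT' \<circ> fol_map F' ?j \<circ> chart_inv ?CN"
    let ?SN = "snd ?CN ` {z \<in> fol_dom F' ?j \<inter> fst ?CN. fol_map F' ?j z \<in> fst ?CT'}"
    have fN: "continuous_on ?SN ?fN"
      by (rule smooth_on_continuous[OF smooth_map_on_smooth[OF N.fol_map_smooth[OF b(1)] cn(1) ct'(1)]])
    have im: "fst (\<kappa> x) = snd ?CN (\<phi> (chart_inv ?c x))" for x
      by (simp add: \<kappa>_def N.fst_endo_chart)
    have mem: "\<phi> (chart_inv ?c x) \<in> fst ?CN \<and> \<phi> (chart_inv ?c x) \<in> fol_dom F' ?j \<and>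
        fol_map F' ?j (\<phi> (chart_inv ?c x)) \<in> fst ?CT'" if "x \<in> S" for x
      using inv(1)[OF that] by (auto simp: W_def N.mem_endo_chart)
    have "continuous_on S (\<lambda>x. ?fN (fst (\<kappa> x)))"
    proof (rule continuous_on_compose2[OF fN continuous_on_fst[OF sub(2)]])
      show "(\<lambda>x. fst (\<kappa> x)) ` S \<subseteq> ?SN"
        unfolding im using mem by (intro image_subsetI imageI) blast
    qed
    then show ?thesis
      by (rule continuous_on_eq) (use mem chart_inv_left[OF N.smooth(1) cn(1)] in \<open>simp add: im H_def\<close>)
  qed
  have contZ: "continuous_on {-e<..<e} (\<lambda>t. Z (\<gamma> t))"
  proof -
    have "\<gamma> ` {-e<..<e} \<subseteq> S" using \<gamma> by blast
    then show ?thesis unfolding Z_def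
      by (intro continuous_on_Pair continuous_on_snd continuous_on_compose2[OF contH cont\<gamma>]
          continuous_on_compose2[OF sub(2) cont\<gamma>])
  qed
  \<comment> \<open>The coordinates on \<open>Z(T)\<close> induced by the model chart; through
    \<open>G\<close>, the values of \<open>Z\<close> are functions of the plaque alone.\<close>
  define G where "G = (\<lambda>(s, Q). (snd ?CT' s, matrix (to_coord N.T ?CT' s) ** Q ** matrix_inv (matrix (to_coord N.T ?CT' s))))"
  have ZG: "Z x = G (twistor_submersion N F' ?j (\<psi> (chart_inv ?c x)))" if x: "x \<in> S" for x
  proof -
    obtain z P where zP: "\<psi> (chart_inv ?c x) = (z, P)" by (cases "\<psi> (chart_inv ?c x)")
    have z: "z \<in> fol_dom F' ?j" "fol_map F' ?j z \<in> fst ?CT'"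
      using inv(1)[OF x] zP by (auto simp: W_def N.mem_endo_chart)
    note nf = N.nframe_matrix[OF b(1) z(1) ct'(1) z(2)]
    let ?R = "nframe N F' ?j ?CT' z" and ?K = "matrix (to_coord N.T ?CT' (fol_map F' ?j z))"
      and ?B = "matrix (ntriv N F' ?j z)"
    have "?R ** P ** matrix_inv ?R = ?K ** (?B ** P ** matrix_inv ?B) ** matrix_inv ?K"
      by (simp only: nf(1) matrix_inv_matrix_mult[OF nf(2) N.invertible_ntriv(1)[OF b(1) z(1)]] matrix_mul_assoc)
    then show ?thesis
      by (simp add: Z_def H_def \<kappa>_def G_def zP twistor_submersion_def endo_chart_def)
  qed
  have "(\<lambda>t. Z (\<gamma> t)) ` {-e<..<e} \<subseteq>
    G ` {twistor_submersion N F' ?j w | w. w \<in> N.twist_dom ?j \<and> twistor_same_leaf N F' (\<psi> p) w}"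
  proof (rule image_subsetI)
    fix t assume t: "t \<in> {-e<..<e}"
    define z where "z = chart_inv ?c (\<gamma> t)"
    have z: "z \<in> fol_dom F ?i" "fol_map F ?i z \<in> fst ?CT" "z \<in> carrier_of M" "\<psi> z \<in> fst ?E"
      using inv(1)[of "\<gamma> t"] \<gamma>[OF t] by (auto simp: z_def W_def)
    have "snd ?CT (fol_map F ?i z) = snd ?CT (fol_map F ?i p)"
      using \<gamma>[OF t] by (simp add: f_def z_def cx0)
    then have "fol_map F ?i z = fol_map F ?i p"
      using smooth_manifold_chart(4)[OF smooth(2) ct(1)] z(2) ct(2) by (auto dest: inj_onD)
    then have "same_leaf F p z"
      unfolding same_leaf_def plaque_chain_def using a z(1) by (intro r_into_rtranclp) auto
    then have "twistor_same_leaf N F' (\<psi> p) (\<psi> z)" by (rule \<psi>_leaf[OF p z(3)])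
    moreover have "\<psi> z \<in> N.twist_dom ?j" using \<psi>_twistor[OF z(3)] z(4) by (simp add: N.mem_endo_chart)
    ultimately show "Z (\<gamma> t) \<in> G ` {twistor_submersion N F' ?j w | w. w \<in> N.twist_dom ?j \<and> twistor_same_leaf N F' (\<psi> p) w}"
      using ZG \<gamma>[OF t] unfolding z_def by blast
  qed
  moreover have "countable (G ` {twistor_submersion N F' ?j w | w. w \<in> N.twist_dom ?j \<and> twistor_same_leaf N F' (\<psi> p) w})"
    by (rule countable_image[OF N.countable_twistor_leaf[OF b(1)]])
  ultimately have cnt: "countable ((\<lambda>t. Z (\<gamma> t)) ` {-e<..<e})" by (rule countable_subset)
  have "connected ((\<lambda>t. Z (\<gamma> t)) ` {-e<..<e})"
    by (rule connected_continuous_image[OF contZ]) simp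
  note conn = this
  \<comment> \<open>The image of the curve under \<open>Z\<close> is connected and countable, and a
    connected set with two distinct points is uncountable.\<close>
  have const: "Z (\<gamma> t) = Z x0" if t: "t \<in> {-e<..<e}" for t
  proof (rule ccontr)
    assume "Z (\<gamma> t) \<noteq> Z x0"
    then have "uncountable ((\<lambda>t. Z (\<gamma> t)) ` {-e<..<e})"
      using e(1) by (intro connected_uncountable[OF conn imageI[OF t] imageI[of 0]]) (auto simp: e(2))
    with cnt show False by blast
  qed
  have dH: "(H has_derivative (\<lambda>v. nproj N F' (\<phi> p) (mderiv M N \<phi> p v))) (at x0)"
    using chart_chain_rule[OF smooth(1) N.smooth(1) c cn \<phi>_mcont[OF p]
      has_derivative_mderiv[OF smooth(1) N.smooth(1) \<phi>_mdiff[OF p]]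
      has_derivative_mderiv[OF N.smooth N.fol_map_mdiff[OF b]]]
    unfolding H_def x0_def N.nproj_eq by (simp add: o_def)
  have d\<kappa>: "(\<kappa> has_derivative mderiv M N.EB \<psi> p) (at x0)"
    using has_derivative_\<psi>[OF p] unfolding Eat \<kappa>_def x0_def .
  have "(Z has_derivative (\<lambda>v. (nproj N F' (\<phi> p) (mderiv M N \<phi> p v), snd (mderiv M N.EB \<psi> p v)))) (at (\<gamma> 0))"
    unfolding Z_def e(2) by (intro has_derivative_Pair has_derivative_snd dH d\<kappa>)
  from diff_chain_at[OF d\<gamma> this]
  have "((\<lambda>t. Z (\<gamma> t)) has_derivative (\<lambda>t. (nproj N F' (\<phi> p) (mderiv M N \<phi> p (t *\<^sub>R X)), snd (mderiv M N.EB \<psi> p (t *\<^sub>R X))))) (at 0)"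
    by (simp add: o_def)
  moreover have "((\<lambda>t. Z (\<gamma> t)) has_derivative (\<lambda>t. 0)) (at 0)"
    by (rule has_derivative_transform_within_open[OF has_derivative_const[of "Z x0"], of "{-e<..<e}"])
      (use const e in auto)
  ultimately have "(\<lambda>t. (nproj N F' (\<phi> p) (mderiv M N \<phi> p (t *\<^sub>R X)), snd (mderiv M N.EB \<psi> p (t *\<^sub>R X)))) = (\<lambda>t. 0)"
    by (rule has_derivative_unique)
  from fun_cong[OF this, of 1] show "nproj N F' (\<phi> p) (mderiv M N \<phi> p X) = 0" "snd (mderiv M N.EB \<psi> p X) = 0"
    by (simp_all add: zero_prod_def)
qed

end

section \<open>The normal connection in a frame\<close>

lemma bounded_linear_transpose: "bounded_linear (transpose :: real^'n^'m \<Rightarrow> real^'m^'n)"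
  by (intro linear_conv_bounded_linear[THEN iffD1] linearI) (simp_all add: transpose_def vec_eq_iff)

text \<open>Second-order differentiability of a composite is all that is needed, and it is obtained
  without closing \<open>smooth_on\<close> under composition: expanding the chain rule in a basis
  gives a finite sum of products of functions differentiable at \<open>x\<close>.\<close>

lemma differentiable_deriv_comp:
  fixes k :: "'a::euclidean_space \<Rightarrow> 'b::euclidean_space" and f :: "'b \<Rightarrow> 'c::euclidean_space"
  assumes k: "smooth_on S k" and f: "smooth_on S' f" and S: "open S" "k ` S \<subseteq> S'" and x: "x \<in> S"
  shows "(\<lambda>y. frechet_derivative (f \<circ> k) (at y) w) differentiable (at x)"
    and "y \<in> S \<Longrightarrow> ((f \<circ> k) has_derivative frechet_derivative (f \<circ> k) (at y)) (at y)"
proof -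
  have dk: "(k has_derivative frechet_derivative k (at y)) (at y)" if "y \<in> S" for y
    by (rule frechet_works[OF smooth_on_differentiable[OF k that]])
  have df: "(f has_derivative frechet_derivative f (at (k y))) (at (k y))" if "y \<in> S" for y
    by (rule frechet_works[OF smooth_on_differentiable[OF f]]) (use S that in blast)
  have dfk: "((f \<circ> k) has_derivative (frechet_derivative f (at (k y)) \<circ> frechet_derivative k (at y))) (at y)" if "y \<in> S" for y
    by (rule diff_chain_at[OF dk[OF that] df[OF that]])
  then show "y \<in> S \<Longrightarrow> ((f \<circ> k) has_derivative frechet_derivative (f \<circ> k) (at y)) (at y)"
    using frechet_works differentiableI by blast
  have eq: "frechet_derivative (f \<circ> k) (at y) w =
      (\<Sum>b\<in>Basis. (frechet_derivative k (at y) w \<bullet> b) *\<^sub>R frechet_derivative f (at (k y)) b)" if "y \<in> S" for y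
  proof -
    have lin: "linear (frechet_derivative f (at (k y)))" using df[OF that] has_derivative_linear by blast
    have "frechet_derivative (f \<circ> k) (at y) w = frechet_derivative f (at (k y)) (frechet_derivative k (at y) w)"
      using frechet_derivative_at[OF dfk[OF that]] by (metis comp_apply)
    also have "\<dots> = frechet_derivative f (at (k y)) (\<Sum>b\<in>Basis. (frechet_derivative k (at y) w \<bullet> b) *\<^sub>R b)"
      by (simp add: euclidean_representation)
    finally show ?thesis by (simp add: linear_sum[OF lin] linear_cmul[OF lin])
  qed
  have "(\<lambda>y. frechet_derivative f (at (k y)) b) differentiable (at x)" for b
  proof -
    have "(\<lambda>z. frechet_derivative f (at z) b) differentiable (at (k x))"
      by (rule smooth_on_differentiable[OF smooth_on_deriv[OF f]]) (use S x in blast)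
    then obtain D where "((\<lambda>z. frechet_derivative f (at z) b) has_derivative D) (at (k x))"
      unfolding differentiable_def by blast
    from diff_chain_at[OF dk[OF x] this] show ?thesis unfolding differentiable_def o_def by blast
  qed
  moreover have "(\<lambda>y. frechet_derivative k (at y) w \<bullet> b) differentiable (at x)" for b
    by (rule differentiable_inner[OF smooth_on_differentiable[OF smooth_on_deriv[OF k] x] differentiable_const])
  ultimately have "(\<lambda>y. \<Sum>b\<in>Basis. (frechet_derivative k (at y) w \<bullet> b) *\<^sub>R frechet_derivative f (at (k y)) b) differentiable (at x)"
    by (intro differentiable_sum differentiable_scaleR) auto
  then obtain D where D: "((\<lambda>y. \<Sum>b\<in>Basis. (frechet_derivative k (at y) w \<bullet> b) *\<^sub>R frechet_derivative f (at (k y)) b) has_derivative D) (at x)"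
    unfolding differentiable_def by blast
  have "((\<lambda>y. frechet_derivative (f \<circ> k) (at y) w) has_derivative D) (at x)"
    by (rule has_derivative_transform_within_open[OF D S(1) x]) (simp add: eq)
  then show "(\<lambda>y. frechet_derivative (f \<circ> k) (at y) w) differentiable (at x)" unfolding differentiable_def by blast
qed

text \<open>Differentiate \<open>H' = A f'\<close> and use the symmetry of the second derivatives of \<open>H\<close> and \<open>f\<close>.\<close>

lemma coefficient_derivative_symmetric:
  fixes f :: "'a::euclidean_space \<Rightarrow> real^'q" and H :: "'a \<Rightarrow> real^'r" and A :: "'a \<Rightarrow> real^'q^'r"
  assumes S: "open S" "x \<in> S"
    and f: "\<And>y. y \<in> S \<Longrightarrow> (f has_derivative f' y) (at y)" "\<And>w. (\<lambda>y. f' y w) differentiable (at x)"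
    and H: "\<And>y. y \<in> S \<Longrightarrow> (H has_derivative H' y) (at y)" "\<And>w. (\<lambda>y. H' y w) differentiable (at x)"
    and A: "\<And>y w. y \<in> S \<Longrightarrow> H' y w = A y *v f' y w" and surj: "surj (f' x)"
  obtains A' where "(A has_derivative A') (at x)" "\<forall>u v. A' u *v f' x v = A' v *v f' x u"
proof -
  have linf: "linear (f' x)" using f(1)[OF S(2)] has_derivative_linear by blast
  obtain L where L: "linear L" "f' x \<circ> L = id" using linear_surjective_right_inverse[OF linf surj] by blast
  \<comment> \<open>\<open>m\<close> and \<open>Q\<close> are the matrices of \<open>f' y\<close>
    and \<open>H' y\<close> restricted along the right inverse \<open>L\<close> of
    \<open>f' x\<close>. Since \<open>m x = mat 1\<close>, near \<open>x\<close> one has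
    \<open>A = Q m^{-1}\<close>, and this makes \<open>A\<close> differentiable.\<close>
  define m where "m = (\<lambda>y. (\<chi> i j. f' y (L (axis j 1)) $ i) :: real^'q^'q)"
  define Q where "Q = (\<lambda>y. (\<chi> i j. H' y (L (axis j 1)) $ i) :: real^'q^'r)"
  have "m x = mat 1"
    using L(2) by (simp add: m_def vec_eq_iff mat_def fun_eq_iff axis_def)
  then have inv: "invertible (m x)" by (metis invertible_def matrix_mul_lid)
  have dm: "m differentiable (at x)"
    unfolding m_def by (intro differentiable_vec_lambda differentiable_vec_nth f(2))
  have dQ: "Q differentiable (at x)"
    unfolding Q_def by (intro differentiable_vec_lambda differentiable_vec_nth H(2))
  have Q: "Q y = A y ** m y" if "y \<in> S" for y
    by (simp add: Q_def m_def A[OF that] matrix_matrix_mult_def matrix_vector_mult_def)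
  note minv = differentiable_matrix_inv[OF dm inv]
  obtain U where U: "open U" "x \<in> U" "\<And>y. y \<in> U \<Longrightarrow> invertible (m y)"
    using minv(2) by (auto simp: eventually_nhds)
  obtain Q' where Q': "(Q has_derivative Q') (at x)" using dQ unfolding differentiable_def by blast
  obtain n' where n': "((\<lambda>y. matrix_inv (m y)) has_derivative n') (at x)" using minv(1) unfolding differentiable_def by blast
  have AQ: "Q y ** matrix_inv (m y) = A y" if "y \<in> S \<inter> U" for y
    using that U(3) by (simp add: Q matrix_inv_right_left flip: matrix_mul_assoc)
  obtain A' where A': "(A has_derivative A') (at x)"
    using has_derivative_transform_within_open[OF has_derivative_matrix_mult[OF Q' n'], of "S \<inter> U"] S U AQ by blast
  have "A' u *v f' x v = A' v *v f' x u" for u v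
  proof -
    obtain fu where fu: "((\<lambda>y. f' y u) has_derivative fu) (at x)" using f(2) unfolding differentiable_def by blast
    obtain fv where fv: "((\<lambda>y. f' y v) has_derivative fv) (at x)" using f(2) unfolding differentiable_def by blast
    have fs: "fu v = fv u" by (rule second_derivative_symmetric[OF S f(1) fu fv])
    have dH: "((\<lambda>y. H' y w) has_derivative (\<lambda>z. A x *v fw z + A' z *v f' x w)) (at x)"
      if "((\<lambda>y. f' y w) has_derivative fw) (at x)" for w fw
      by (rule has_derivative_transform_within_open[OF
            bounded_bilinear.FDERIV[OF bounded_bilinear_matrix_vector_mult A' that] S]) (simp add: A)
    have "A x *v fu v + A' v *v f' x u = A x *v fv u + A' u *v f' x v"
      by (rule second_derivative_symmetric[OF S H(1) dH[OF fu] dH[OF fv]])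
    then show ?thesis using fs by simp
  qed
  then show ?thesis using that A' by blast
qed

context foliated_manifold
begin

abbreviation "ctr p \<equiv> chart_at T (fol_map F (fol_at F p) p)"
abbreviation "trv p \<equiv> snd (ctr p) \<circ> fol_map F (fol_at F p) \<circ> chart_inv (chart_at M p)"
abbreviation "\<Gamma> p \<equiv> christoffel_matrix T h (ctr p) (snd (ctr p) (fol_map F (fol_at F p) p))"

definition frame_dom :: "'a \<Rightarrow> 'a set" where
  "frame_dom p = {y \<in> fol_dom F (fol_at F p). fol_map F (fol_at F p) y \<in> fst (ctr p)}"

context
  fixes p assumes p: "p \<in> carrier_of M"
begin

lemma ctr: "ctr p \<in> atlas T" "fol_map F (fol_at F p) p \<in> fst (ctr p)"
  using smooth_manifold_chart_at[OF smooth(2) fol_map_carrier[OF at_index[OF p] at_dom[OF p]]] by auto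

lemma frame_dom: "openin (mtop M) (frame_dom p)" "p \<in> frame_dom p"
  unfolding frame_dom_def
  using openin_smooth_map_preimage[OF fol_map_smooth[OF at_index[OF p]] dom_open[OF at_index[OF p]]
      smooth_manifold_chart(1)[OF smooth(2) ctr(1)]] ctr at_dom[OF p] by auto

lemma nconn_eq: "nconn M F p X = \<Gamma> p (nproj M F p X)"
  by (simp add: nconn_def christoffel_matrix_def Let_def)

lemma christoffel_at: "\<Gamma> p u *v v = \<Gamma> p v *v u" "linear (\<Gamma> p)"
  using christoffel_matrix_symmetric[OF riemannian(2) ctr(1)] linear_christoffel_matrix[OF riemannian(2) ctr(1)] ctr by auto

lemma nframe_at_self: "nframe_at M F p p = mat 1"
proof (rule matrix_eq[THEN iffD2], intro allI)
  fix u
  note a = at_index[OF p] at_dom[OF p]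
  show "nframe_at M F p p *v u = mat 1 *v u"
    unfolding nframe_at_def nframe_apply(1)[OF a ctr]
    by (simp add: ntriv_at[OF p] to_coord_chart_at(1)[OF smooth(2) fol_map_carrier[OF a]])
qed

lemma invertible_nframe_at: "y \<in> frame_dom p \<Longrightarrow> invertible (nframe_at M F p y)"
  unfolding nframe_at_def using nframe_apply(2)[OF at_index[OF p] _ ctr(1)] by (simp add: frame_dom_def)

text \<open>The frame comes from coordinates: its matrix is the differential of the transverse
  coordinates as a map on \<open>Q\<close>. This lets the symmetry of second derivatives say
  something about derivatives taken in the frame.\<close>

lemma has_derivative_transverse_coord:
  assumes y: "y \<in> frame_dom p" and C: "C \<in> atlas M" "y \<in> fst C"
  shows "((snd (ctr p) \<circ> fol_map F (fol_at F p) \<circ> chart_inv C) has_derivative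
    (\<lambda>v. nframe_at M F p y *v nproj M F y (from_coord M C y v))) (at (snd C y))"
proof -
  note a = at_index[OF p]
  have y': "y \<in> fol_dom F (fol_at F p)" "fol_map F (fol_at F p) y \<in> fst (ctr p)" using y by (auto simp: frame_dom_def)
  have "((snd (ctr p) \<circ> fol_map F (fol_at F p) \<circ> chart_inv C) has_derivative
    (\<lambda>v. to_coord T (ctr p) (fol_map F (fol_at F p) y) (D (fol_at F p) y (from_coord M C y v)))) (at (snd C y))"
    by (rule has_derivative_mderiv_coord[OF smooth fol_map_mdiff[OF a y'(1)] fol_map_mcont[OF a y'(1)] C ctr(1) y'(2)])
  then show ?thesis
    unfolding nframe_at_def by (simp add: nframe_apply(1)[OF a y'(1) ctr(1) y'(2)] ntriv_nproj[OF a y'(1)])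
qed

lemma has_derivative_trv: "(trv p has_derivative nproj M F p) (at (snd (chart_at M p) p))"
  using has_derivative_transverse_coord[OF frame_dom(2) smooth_manifold_chart_at[OF smooth(1) p]]
  by (simp add: nframe_at_self to_coord_chart_at(2)[OF smooth(1) p])

lemma trv_self: "trv p (snd (chart_at M p) p) = snd (ctr p) (fol_map F (fol_at F p) p)"
  using chart_inv_left[OF smooth(1) smooth_manifold_chart_at[OF smooth(1) p]] by simp

lemma frame_dom_chart:
  obtains S where "open S" "snd (chart_at M p) p \<in> S"
    "\<forall>x\<in>S. chart_inv (chart_at M p) x \<in> frame_dom p \<inter> fst (chart_at M p)"
proof -
  note c = smooth_manifold_chart_at[OF smooth(1) p]
  show ?thesis
    by (rule that[OF open_chart_image[OF smooth(1) c(1) frame_dom(1)]])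
      (use c frame_dom(2) chart_inv_left[OF smooth(1) c(1)] in auto)
qed

text \<open>A foliated endomorphism, written in the frame, is a differentiable function of the
  transverse coordinates. Hence its derivative factors through \<open>nproj\<close>, which is why it
  is given as \<open>J'\<close> applied to a normal vector.\<close>

lemma has_derivative_endo_in_frame:
  assumes J: "foliated_endo M F J"
  obtains J' where "((\<lambda>x. nframe_at M F p (chart_inv (chart_at M p) x) ** J (chart_inv (chart_at M p) x) **
      matrix_inv (nframe_at M F p (chart_inv (chart_at M p) x))) has_derivative (\<lambda>v. J' (nproj M F p v)))
    (at (snd (chart_at M p) p))" "linear J'"
proof -
  let ?i = "fol_at F p" and ?c = "chart_at M p"
  note a = at_index[OF p] at_dom[OF p] and c = smooth_manifold_chart_at[OF smooth(1) p]
  obtain U A where U: "openin (mtop M) U" "p \<in> U" "U \<subseteq> fol_dom F ?i"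
    and sA: "smooth_endo_on (fol_map F ?i ` U) T A"
    and A: "\<And>y u. y \<in> U \<Longrightarrow> ntriv M F ?i y (J y *v u) = A (fol_map F ?i y) *v ntriv M F ?i y u"
    using J[unfolded foliated_endo_def, rule_format, OF a] by blast
  define s where "s = (\<lambda>x. let t = chart_inv (ctr p) x; R = matrix (to_coord T (ctr p) t) in R ** A t ** matrix_inv R)"
  have "smooth_on (snd (ctr p) ` (fst (ctr p) \<inter> fol_map F ?i ` U)) s"
    using sA ctr(1) unfolding smooth_endo_on_def s_def by (cases "ctr p") fastforce
  then have "s differentiable (at (snd (ctr p) (fol_map F ?i p)))"
    by (rule smooth_on_differentiable) (use ctr(2) U(2) in blast)
  then obtain J' where J': "(s has_derivative J') (at (snd (ctr p) (fol_map F ?i p)))" unfolding differentiable_def by blast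
  have eq: "s (snd (ctr p) (fol_map F ?i y)) = nframe_at M F p y ** J y ** matrix_inv (nframe_at M F p y)"
    if y: "y \<in> frame_dom p \<inter> U" for y
  proof -
    have y': "y \<in> fol_dom F ?i" "fol_map F ?i y \<in> fst (ctr p)" using y by (auto simp: frame_dom_def)
    let ?K = "matrix (to_coord T (ctr p) (fol_map F ?i y))" and ?B = "matrix (ntriv M F ?i y)"
    note nf = nframe_matrix[OF a(1) y'(1) ctr(1) y'(2)]
    note iB = invertible_ntriv[OF a(1) y'(1)]
    have "?B ** J y = A (fol_map F ?i y) ** ?B"
      by (rule matrix_eq[THEN iffD2]) (use A y iB(2) in \<open>simp flip: matrix_vector_mul_assoc\<close>)
    then have "?B ** J y ** matrix_inv ?B = A (fol_map F ?i y) ** (?B ** matrix_inv ?B)"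
      by (simp add: matrix_mul_assoc)
    then have "A (fol_map F ?i y) = ?B ** J y ** matrix_inv ?B" by (simp add: matrix_inv_right_left[OF iB(1)])
    moreover have "s (snd (ctr p) (fol_map F ?i y)) = ?K ** A (fol_map F ?i y) ** matrix_inv ?K"
      by (simp add: s_def Let_def chart_inv_left[OF smooth(2) ctr(1) y'(2)])
    ultimately show ?thesis
      unfolding nframe_at_def by (simp add: nf(1) matrix_inv_matrix_mult[OF nf(2) iB(1)] matrix_mul_assoc)
  qed
  have "((s \<circ> trv p) has_derivative (J' \<circ> nproj M F p)) (at (snd ?c p))"
    by (rule diff_chain_at[OF has_derivative_trv]) (simp only: trv_self J')
  moreover have "open (snd ?c ` (fst ?c \<inter> (frame_dom p \<inter> U)))"
    by (rule open_chart_image[OF smooth(1) c(1)]) (intro openin_Int frame_dom U)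
  ultimately have "((\<lambda>x. nframe_at M F p (chart_inv ?c x) ** J (chart_inv ?c x) **
      matrix_inv (nframe_at M F p (chart_inv ?c x))) has_derivative (J' \<circ> nproj M F p)) (at (snd ?c p))"
    by (rule has_derivative_transform_within_open)
      (use c U frame_dom eq chart_inv_left[OF smooth(1) c(1)] in auto)
  then show ?thesis
    by (intro that[of J'] has_derivative_linear[OF J']) (simp add: o_def)
qed

text \<open>The left side is written in the realisation of \<open>Q\<close> at \<open>y\<close>,
  which may jump with \<open>y\<close>. The frame absorbs the jump and leaves the metric
  coefficients of the model, whose derivative is known.\<close>

lemma gram_nmetric_frame:
  assumes y: "y \<in> frame_dom p"
  shows "gram (nmetric F y) = transpose (nframe_at M F p y) **
    metric_matrix T h (ctr p) (snd (ctr p) (fol_map F (fol_at F p) y)) ** nframe_at M F p y"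
proof -
  note a = at_index[OF p]
  have y': "y \<in> fol_dom F (fol_at F p)" "fol_map F (fol_at F p) y \<in> fst (ctr p)" using y by (auto simp: frame_dom_def)
  have yc: "y \<in> carrier_of M" using y'(1) dom_subset[OF a] by blast
  let ?R = "nframe_at M F p y" and ?G = "metric_matrix T h (ctr p) (snd (ctr p) (fol_map F (fol_at F p) y))"
  have R: "?R *v u = to_coord T (ctr p) (fol_map F (fol_at F p) y) (ntriv M F (fol_at F p) y u)" for u
    unfolding nframe_at_def by (rule nframe_apply(1)[OF a y'(1) ctr(1) y'(2)])
  have ip: "inner_product (metric_in_chart T h (ctr p) (snd (ctr p) (fol_map F (fol_at F p) y)))"
    by (rule inner_product_metric_in_chart[OF riemannian(2) ctr(1)]) (use y' in blast)
  have "u \<bullet> (gram (nmetric F y) *v v) = u \<bullet> ((transpose ?R ** ?G ** ?R) *v v)" for u v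
  proof -
    have "u \<bullet> (gram (nmetric F y) *v v) = nmetric F y u v"
      by (rule gram_bilinear[symmetric]) (use inner_product_nmetric[OF yc] in \<open>simp add: inner_product_def\<close>)
    also have "\<dots> = metric_in_chart T h (ctr p) (snd (ctr p) (fol_map F (fol_at F p) y)) (?R *v u) (?R *v v)"
      unfolding R by (simp add: nmetric_ntriv[OF a y'(1)] metric_in_chart_to_coord[OF smooth(2) ctr(1) y'(2)])
    also have "\<dots> = (?R *v u) \<bullet> (?G *v (?R *v v))"
      unfolding metric_matrix_def by (rule gram_bilinear) (use ip in \<open>simp add: inner_product_def\<close>)
    also have "\<dots> = u \<bullet> (transpose ?R *v (?G *v (?R *v v)))"
      using dot_lmul_matrix[of "?G *v (?R *v v)" ?R u] by (simp add: inner_commute)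
    finally show ?thesis by (simp add: matrix_vector_mul_assoc matrix_mul_assoc del: transpose_matrix_vector)
  qed
  then have "gram (nmetric F y) *v v = (transpose ?R ** ?G ** ?R) *v v" for v using vector_eq_ldot by blast
  then show ?thesis by (simp only: matrix_eq) blast
qed

end

end

section \<open>Derivative and divergence of the almost Hermitian structure\<close>

locale almost_hermitian_foliation = foliated_manifold M g F
  for M :: "('a, 'e::euclidean_space) mfd" and g :: "('a, 'e) metric"
    and F :: "('i, 'a, 't, 'q::finite) foliation" +
  fixes J :: "'a \<Rightarrow> real^'q^'q"
  assumes J_foliated: "foliated_endo M F J"
    and J_square: "p \<in> carrier_of M \<Longrightarrow> J p ** J p = - mat 1"
    and J_isometry: "p \<in> carrier_of M \<Longrightarrow> nmetric F p (J p *v u) (J p *v v) = nmetric F p u v"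
begin

lemma fundamental_2vector:
  assumes "p \<in> carrier_of M"
  shows "fundamental_2vector F J p = - (J p ** matrix_inv (gram (nmetric F p)))"
    "transpose (fundamental_2vector F J p) = - fundamental_2vector F J p"
  using fundamental_2vector_eq[OF inner_product_nmetric[OF assms], of J] J_square[OF assms] J_isometry[OF assms] by auto

abbreviation "J_frame p x \<equiv> nframe_at M F p (chart_inv (chart_at M p) x) ** J (chart_inv (chart_at M p) x) **
      matrix_inv (nframe_at M F p (chart_inv (chart_at M p) x))"

lemma fundamental_2vector_frame:
  assumes p: "p \<in> carrier_of M" and y: "y \<in> frame_dom p"
  defines "R \<equiv> nframe_at M F p y" and "G \<equiv> metric_matrix T h (ctr p) (snd (ctr p) (fol_map F (fol_at F p) y))"
  shows "R ** fundamental_2vector F J y ** transpose R = - (R ** J y ** matrix_inv R) ** matrix_inv G"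
    "invertible G"
proof -
  note a = at_index[OF p]
  have y': "y \<in> fol_dom F (fol_at F p)" "fol_map F (fol_at F p) y \<in> fst (ctr p)"
    using y by (auto simp: frame_dom_def)
  have yc: "y \<in> carrier_of M" using y'(1) dom_subset[OF a] by blast
  have iR: "invertible R" unfolding R_def by (rule invertible_nframe_at[OF p y])
  note R = matrix_inv_right_left[OF iR]
  have "inner_product (metric_in_chart T h (ctr p) (snd (ctr p) (fol_map F (fol_at F p) y)))"
    by (rule inner_product_metric_in_chart[OF riemannian(2) ctr(1)[OF p]]) (use y' in blast)
  then show iG: "invertible G" unfolding G_def metric_matrix_def by (rule invertible_gram)
  let ?g = "gram (nmetric F y)"
  have g: "?g = transpose R ** G ** R" unfolding R_def G_def by (rule gram_nmetric_frame[OF p y])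
  have ig: "?g ** matrix_inv ?g = mat 1"
    using matrix_inv_right_left[OF invertible_gram[OF inner_product_nmetric[OF yc]]] by blast
  \<comment> \<open>Cyclic rotation of the identity for the inverse yields
    \<open>G^{-1} = R g^{-1} R^T\<close>, so that conjugating \<open>J\<close> by the frame matches
    transforming the 2-vector.\<close>
  have "transpose R ** (G ** R ** matrix_inv ?g) = mat 1" using ig unfolding g by (simp only: matrix_mul_assoc)
  then have "(G ** R ** matrix_inv ?g) ** transpose R = mat 1" using matrix_left_right_inverse by blast
  then have "G ** (R ** matrix_inv ?g ** transpose R) = mat 1" by (simp only: matrix_mul_assoc)
  then have Gi: "matrix_inv G = R ** matrix_inv ?g ** transpose R" by (rule matrix_inv_unique)
  have "(R ** J y ** matrix_inv R) ** matrix_inv G = R ** J y ** (matrix_inv R ** R) ** matrix_inv ?g ** transpose R"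
    unfolding Gi by (simp only: matrix_mul_assoc)
  also have "\<dots> = R ** (J y ** matrix_inv ?g) ** transpose R" by (simp add: R matrix_mul_assoc)
  finally show "R ** fundamental_2vector F J y ** transpose R = - (R ** J y ** matrix_inv R) ** matrix_inv G"
    by (simp add: fundamental_2vector[OF yc] matrix_mult_distrib)
qed

text \<open>\<open>K\<close> is \<open>\<nabla>J\<close>; no derivative of \<open>g\<close> appears because the connection is metric.\<close>

lemma nabla_2vector_fundamental:
  assumes p: "p \<in> carrier_of M"
    and J': "(J_frame p has_derivative (\<lambda>v. J' (nproj M F p v))) (at (snd (chart_at M p) p))"
  defines "K \<equiv> \<lambda>u. J' u + \<Gamma> p u ** J p - J p ** \<Gamma> p u"
  shows "nabla_2vector M F (fundamental_2vector F J) p X = - (K (nproj M F p X) ** matrix_inv (gram (nmetric F p)))"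
    and "transpose (nabla_2vector M F (fundamental_2vector F J) p X) = - nabla_2vector M F (fundamental_2vector F J) p X"
proof -
  let ?c = "chart_at M p" and ?x0 = "snd (chart_at M p) p"
  note c = smooth_manifold_chart_at[OF smooth(1) p]
  obtain S where S: "open S" "?x0 \<in> S" and "\<forall>x\<in>S. chart_inv ?c x \<in> frame_dom p \<inter> fst ?c"
    by (rule frame_dom_chart[OF p])
  note Sd = this(3)[rule_format]
  define \<Phi> where "\<Phi> = (\<lambda>x. nframe_at M F p (chart_inv ?c x) ** fundamental_2vector F J (chart_inv ?c x) **
    transpose (nframe_at M F p (chart_inv ?c x)))"
  define G where "G = metric_matrix T h (ctr p) \<circ> trv p"
  define G0 where "G0 = gram (nmetric F p)"
  have px0: "chart_inv ?c ?x0 = p" by (rule chart_inv_left[OF smooth(1) c])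
  have Gy: "G x = metric_matrix T h (ctr p) (snd (ctr p) (fol_map F (fol_at F p) (chart_inv ?c x)))" for x
    by (simp add: G_def)
  have \<Phi>: "\<Phi> x = - J_frame p x ** matrix_inv (G x)" and Ginv: "invertible (G x)" if "x \<in> S" for x
    using fundamental_2vector_frame[OF p, of "chart_inv ?c x"] Sd[OF that] unfolding \<Phi>_def Gy by blast+
  have G0: "G ?x0 = G0"
    using gram_nmetric_frame[OF p frame_dom(2)[OF p]] unfolding Gy px0 G0_def nframe_at_self[OF p]
    by (simp add: transpose_mat)
  have J0: "J_frame p ?x0 = J p" 
    by (simp add: px0 nframe_at_self[OF p] matrix_inv_mat_1)
  define Gd where "Gd = (\<lambda>u. transpose (\<Gamma> p u) ** G0 + G0 ** \<Gamma> p u)"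
  have dG: "(G has_derivative (\<lambda>v. Gd (nproj M F p v))) (at ?x0)"
  proof -
    have t: "snd (ctr p) (fol_map F (fol_at F p) p) \<in> snd (ctr p) ` fst (ctr p)" using ctr[OF p] by blast
    have "(metric_matrix T h (ctr p) has_derivative Gd) (at (trv p ?x0))"
      using has_derivative_metric_matrix[OF riemannian(2) ctr(1)[OF p] t] G0
      unfolding Gd_def trv_self[OF p] Gy px0 by simp
    from diff_chain_at[OF has_derivative_trv[OF p] this] show ?thesis
      by (simp add: G_def o_def)
  qed
  obtain n' where n': "((\<lambda>x. matrix_inv (G x)) has_derivative n') (at ?x0)"
    using differentiable_matrix_inv(1)[OF differentiableI[OF dG] Ginv[OF S(2)]] unfolding differentiable_def by blast
  have "\<Phi> differentiable (at ?x0)"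
    by (rule differentiableI,
        rule has_derivative_transform_within_open[OF has_derivative_matrix_mult[OF has_derivative_minus[OF J'] n'] S])
      (simp only: \<Phi>)
  then obtain \<Phi>' where \<Phi>': "(\<Phi> has_derivative \<Phi>') (at ?x0)" unfolding differentiable_def by blast
  have inv0: "G0 ** matrix_inv G0 = mat 1" "matrix_inv G0 ** G0 = mat 1"
    unfolding G0_def using matrix_inv_right_left[OF invertible_gram[OF inner_product_nmetric[OF p]]] by auto
  have F0: "\<Phi> ?x0 = - (J p ** matrix_inv G0)"
    using \<Phi>[OF S(2)] unfolding G0 J0 by (simp add: matrix_mult_distrib)
  \<comment> \<open>Solving the product rule for \<open>\<Phi> G = - J_frame\<close> spares a
    formula for the derivative of the inverse; \<open>n'\<close> serves only to know that
    \<open>\<Phi>\<close> is differentiable.\<close>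
  have "((\<lambda>x. \<Phi> x ** G x) has_derivative (\<lambda>v. \<Phi> ?x0 ** Gd (nproj M F p v) + \<Phi>' v ** G ?x0)) (at ?x0)"
    by (rule has_derivative_matrix_mult[OF \<Phi>' dG])
  moreover have "((\<lambda>x. \<Phi> x ** G x) has_derivative (\<lambda>v. - J' (nproj M F p v))) (at ?x0)"
  proof (rule has_derivative_transform_within_open[OF has_derivative_minus[OF J'] S])
    fix x assume x: "x \<in> S"
    have "\<Phi> x ** G x = - (J_frame p x) ** (matrix_inv (G x) ** G x)"
      unfolding \<Phi>[OF x] by (simp only: matrix_mul_assoc)
    then show "- J_frame p x = \<Phi> x ** G x" by (simp add: matrix_inv_right_left[OF Ginv[OF x]])
  qed
  ultimately have "(\<lambda>v. \<Phi> ?x0 ** Gd (nproj M F p v) + \<Phi>' v ** G ?x0) = (\<lambda>v. - J' (nproj M F p v))"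
    by (rule has_derivative_unique)
  from fun_cong[OF this, of X]
  have eq: "\<Phi>' X ** G0 = - J' (nproj M F p X) + (J p ** matrix_inv G0) ** Gd (nproj M F p X)"
    unfolding F0 G0 by (simp add: matrix_mult_distrib algebra_simps)
  define u where "u = nproj M F p X"
  \<comment> \<open>The summand with \<open>transpose (\<Gamma> p u)\<close> will cancel against the
    connection term acting on the second slot of the 2-vector. What remains is the commutator of
    \<open>\<Gamma> p u\<close> with \<open>J\<close>.\<close>
  have eq': "\<Phi>' X = - (J' u ** matrix_inv G0) + J p ** matrix_inv G0 ** transpose (\<Gamma> p u) + J p ** \<Gamma> p u ** matrix_inv G0"
  proof -
    have "\<Phi>' X = \<Phi>' X ** G0 ** matrix_inv G0" by (simp add: inv0 flip: matrix_mul_assoc)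
    also have "\<dots> = - (J' u ** matrix_inv G0) + J p ** matrix_inv G0 ** transpose (\<Gamma> p u) ** (G0 ** matrix_inv G0)
        + J p ** (matrix_inv G0 ** G0) ** \<Gamma> p u ** matrix_inv G0"
      unfolding eq Gd_def u_def[symmetric] by (simp only: matrix_mult_distrib matrix_mul_assoc add.assoc)
    finally show ?thesis by (simp add: inv0)
  qed
  have dd: "dir_deriv M p (\<lambda>y. nframe_at M F p y ** fundamental_2vector F J y ** transpose (nframe_at M F p y)) X = \<Phi>' X"
    unfolding dir_deriv_def using frechet_derivative_at[OF \<Phi>'] by (simp add: \<Phi>_def o_def)
  have nab: "nabla_2vector M F (fundamental_2vector F J) p X =
    \<Phi>' X + \<Gamma> p u ** fundamental_2vector F J p + fundamental_2vector F J p ** transpose (\<Gamma> p u)"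
    unfolding nabla_2vector_def Let_def dd nconn_eq[OF p] u_def ..
  show "nabla_2vector M F (fundamental_2vector F J) p X = - (K (nproj M F p X) ** matrix_inv (gram (nmetric F p)))"
    unfolding nab eq' fundamental_2vector(1)[OF p] K_def G0_def[symmetric] u_def[symmetric]
    by (simp add: matrix_mult_distrib matrix_mul_assoc algebra_simps)
  have "((\<lambda>x. transpose (\<Phi> x)) has_derivative (\<lambda>v. transpose (\<Phi>' v))) (at ?x0)"
    by (rule bounded_linear.has_derivative[OF bounded_linear_transpose \<Phi>'])
  moreover have "((\<lambda>x. transpose (\<Phi> x)) has_derivative (\<lambda>v. - \<Phi>' v)) (at ?x0)"
  proof (rule has_derivative_transform_within_open[OF has_derivative_minus[OF \<Phi>'] S])
    fix x assume x: "x \<in> S"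
    have "chart_inv ?c x \<in> carrier_of M"
      using Sd[OF x] smooth_manifold_chart(5)[OF smooth(1) c(1)] by blast
    then show "- \<Phi> x = transpose (\<Phi> x)"
      unfolding \<Phi>_def by (simp add: matrix_transpose_mul fundamental_2vector(2) matrix_mult_distrib matrix_mul_assoc)
  qed
  ultimately have "(\<lambda>v. transpose (\<Phi>' v)) = (\<lambda>v. - \<Phi>' v)" by (rule has_derivative_unique)
  then have t\<Phi>: "transpose (\<Phi>' X) = - \<Phi>' X" by (rule fun_cong)
  have tadd: "transpose (A + B) = transpose A + transpose B" for A B :: "real^'q^'q"
    by (simp add: transpose_def vec_eq_iff)
  show "transpose (nabla_2vector M F (fundamental_2vector F J) p X) = - nabla_2vector M F (fundamental_2vector F J) p X"
    unfolding nab tadd by (simp add: t\<Phi> matrix_transpose_mul fundamental_2vector(2)[OF p] matrix_mult_distrib)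
qed

text \<open>Differentiating \<open>J^2 = -1\<close> in the frame shows that \<open>J'\<close>
  anticommutes with \<open>J\<close>, and a commutator with \<open>J\<close> does so as well; hence
  so does \<open>K\<close>. With this, the pointwise lemma on the trace of \<open>D_2 F\<close>
  applies.\<close>

lemma cosymplectic_divergence:
  assumes cos: "transv_cosymplectic M g F J" and p: "p \<in> carrier_of M"
    and J': "(J_frame p has_derivative (\<lambda>v. J' (nproj M F p v))) (at (snd (chart_at M p) p))" "linear J'"
  defines "K \<equiv> \<lambda>u. J' u + \<Gamma> p u ** J p - J p ** \<Gamma> p u"
  shows "K u ** J p = - (J p ** K u)"
    and "linear K"
    and "(\<Sum>i\<in>UNIV. \<Sum>j\<in>UNIV. matrix_inv (gram (nmetric F p)) $ i $ j *\<^sub>R (K (axis i 1) *v axis j 1)) = 0"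
proof -
  let ?c = "chart_at M p" and ?x0 = "snd (chart_at M p) p"
  note c = smooth_manifold_chart_at[OF smooth(1) p]
  have px0: "chart_inv ?c ?x0 = p" by (rule chart_inv_left[OF smooth(1) c])
  obtain S where S: "open S" "?x0 \<in> S" and "\<forall>x\<in>S. chart_inv ?c x \<in> frame_dom p \<inter> fst ?c"
    by (rule frame_dom_chart[OF p])
  note Sd = this(3)[rule_format]
  have J0: "J_frame p ?x0 = J p" 
    by (simp add: px0 nframe_at_self[OF p] matrix_inv_mat_1)
  have "((\<lambda>x. J_frame p x ** J_frame p x) has_derivative
      (\<lambda>v. J_frame p ?x0 ** J' (nproj M F p v) + J' (nproj M F p v) ** J_frame p ?x0)) (at ?x0)"
    by (rule has_derivative_matrix_mult[OF J'(1) J'(1)])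
  moreover have "((\<lambda>x. J_frame p x ** J_frame p x) has_derivative (\<lambda>v. 0)) (at ?x0)"
  proof (rule has_derivative_transform_within_open[OF has_derivative_const[of "- mat 1"] S])
    fix x assume x: "x \<in> S"
    let ?y = "chart_inv ?c x"
    have y: "?y \<in> carrier_of M" using Sd[OF x] smooth_manifold_chart(5)[OF smooth(1) c(1)] by blast
    have iR: "invertible (nframe_at M F p ?y)" using Sd[OF x] invertible_nframe_at[OF p] by blast
    have "J_frame p x ** J_frame p x = (nframe_at M F p ?y ** J ?y ** matrix_inv (nframe_at M F p ?y)) **
      (nframe_at M F p ?y ** (J ?y ** matrix_inv (nframe_at M F p ?y)))" by (simp only: matrix_mul_assoc)
    also have "\<dots> = nframe_at M F p ?y ** (J ?y ** J ?y) ** matrix_inv (nframe_at M F p ?y)"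
      unfolding matrix_conjugate_cancel[OF iR] by (simp only: matrix_mul_assoc)
    finally show "- mat 1 = J_frame p x ** J_frame p x"
      by (simp add: J_square[OF y] matrix_mult_distrib matrix_inv_right_left[OF iR])
  qed
  ultimately have "(\<lambda>v. J_frame p ?x0 ** J' (nproj M F p v) + J' (nproj M F p v) ** J_frame p ?x0) = (\<lambda>v. 0)"
    by (rule has_derivative_unique)
  then have "J_frame p ?x0 ** J' (nproj M F p v) + J' (nproj M F p v) ** J_frame p ?x0 = 0" for v by metis
  then have JJ': "J p ** J' u + J' u ** J p = 0" for u
    using surj_nproj[OF p] unfolding J0 by (metis surjD)
  show KJ: "K u ** J p = - (J p ** K u)" for u
  proof -
    have "K u ** J p + J p ** K u = (J p ** J' u + J' u ** J p) + \<Gamma> p u ** (J p ** J p) - (J p ** J p) ** \<Gamma> p u"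
      by (simp add: K_def matrix_mult_distrib matrix_mul_assoc)
    also have "\<dots> = 0" by (simp add: JJ' J_square[OF p] matrix_mult_distrib)
    finally show ?thesis by (simp add: add_eq_0_iff)
  qed
  note lin\<Gamma> = christoffel_at(2)[OF p]
  show linK: "linear K"
    by (intro linearI) (simp_all add: K_def linear_add[OF J'(2)] linear_add[OF lin\<Gamma>] linear_cmul[OF J'(2)]
        linear_cmul[OF lin\<Gamma>] matrix_mult_distrib linear_cmul[OF linear_matrix_mult_left]
        linear_cmul[OF linear_matrix_mult_right] scaleR_right_distrib scaleR_right_diff_distrib)
  let ?G = "gram (nmetric F p)"
  note ip = inner_product_nmetric[OF p]
  have bil: "bilinear (nmetric F p)" using ip by (simp add: inner_product_def)
  define Df where "Df = (\<lambda>u. - (K u ** matrix_inv ?G))"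
  have nab: "nabla_2vector M F (fundamental_2vector F J) p (nlift M g F p u) = Df u" for u
    using nabla_2vector_fundamental(1)[OF p J'(1), of "nlift M g F p u"]
    unfolding nproj_nlift[OF p] Df_def K_def by blast
  have tDf: "transpose (Df u) = - Df u" for u
    using nabla_2vector_fundamental(2)[OF p J'(1), of "nlift M g F p u"] unfolding nab .
  have linDf: "linear Df"
    unfolding Df_def by (intro linearI) (simp_all add: linear_add[OF linK] linear_cmul[OF linK] matrix_mult_distrib
        linear_cmul[OF linear_matrix_mult_left])
  have ax: "nmetric F p (axis c 1) u = (?G *v u) $ c" for c u
  proof -
    have "nmetric F p (axis c 1) u = axis c 1 \<bullet> (?G *v u)" by (rule gram_bilinear[OF bil])
    then show ?thesis by (simp only: inner_axis' inner_real_def mult_1)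
  qed
  have N: "nabla_fundamental M g F J p = (\<chi> c. Df (matrix_inv ?G *v axis c 1))"
    using metric_tensor_contraction[OF invertible_gram[OF ip] linDf]
    by (simp only: nabla_fundamental_def nab ax)
  note om = inner_product_orthogonal_matrix[OF ip J_isometry[OF p] J_square[OF p]]
  show "(\<Sum>i\<in>UNIV. \<Sum>j\<in>UNIV. matrix_inv ?G $ i $ j *\<^sub>R (K (axis i 1) *v axis j 1)) = 0"
  proof (rule divergence_of_cosymplectic[OF invertible_gram[OF ip] transpose_matrix_inv_gram[OF ip] om J_square[OF p]
        linDf tDf _ KJ refl])
    show "Df u = - (K u ** matrix_inv ?G)" for u by (simp add: Df_def)
    fix b
    have "tr_deriv F p (D2_fundamental M g F J p) $ b = 0"
      using cos p by (simp add: transv_cosymplectic_def)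
    then show "(\<Sum>c\<in>UNIV. \<Sum>a\<in>UNIV. of_real (?G $ c $ a) *
      (tensor3_apply (proj10 (J p)) (proj01 (J p)) (proj01 (J p)) (\<chi> c. Df (matrix_inv ?G *v axis c 1)) +
       tensor3_apply (proj01 (J p)) (proj10 (J p)) (proj10 (J p)) (\<chi> c. Df (matrix_inv ?G *v axis c 1))) $ c $ a $ b) = (0::complex)"
      by (simp add: tr_deriv_def D2_fundamental_def Let_def N gram_def)
  qed
qed

end

section \<open>Harmonicity\<close>

context foliated_twistor_map
begin

abbreviation "A y \<equiv> matrix (transv_diff M F N F' \<phi> y)"

lemma transv_diff:
  assumes p: "p \<in> carrier_of M"
  shows "linear (transv_diff M F N F' \<phi> p)"
    and "A p *v nproj M F p X = nproj N F' (\<phi> p) (mderiv M N \<phi> p X)"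
proof -
  have L: "linear (nproj N F' (\<phi> p) \<circ> mderiv M N \<phi> p)"
    by (rule linear_compose[OF linear_mderiv[OF smooth(1) N.smooth(1) \<phi>_mdiff[OF p]] N.linear_nproj[OF \<phi>_carrier[OF p]]])
  have K: "(nproj N F' (\<phi> p) \<circ> mderiv M N \<phi> p) X = 0" if "nproj M F p X = 0" for X
    using leafwise_derivative(1)[OF p that] by simp
  show lin: "linear (transv_diff M F N F' \<phi> p)"
    unfolding transv_diff_def by (rule linear_on_quotient[OF linear_nproj[OF p] surj_nproj[OF p] L K])
  have "transv_diff M F N F' \<phi> p (nproj M F p X) = (nproj N F' (\<phi> p) \<circ> mderiv M N \<phi> p) X"
    unfolding transv_diff_def by (rule on_quotient_eq[OF linear_nproj[OF p] L K])
  then show "A p *v nproj M F p X = nproj N F' (\<phi> p) (mderiv M N \<phi> p X)"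
    by (simp add: matrix_apply[OF lin])
qed

lemma vertical_part_eq:
  assumes p: "p \<in> carrier_of M"
  shows "vertical_part N F' (\<psi> p) (mderiv M N.EB \<psi> p X) = snd (mderiv M N.EB \<psi> p X) +
    N.\<Gamma> (\<phi> p) (A p *v nproj M F p X) ** snd (\<psi> p) - snd (\<psi> p) ** N.\<Gamma> (\<phi> p) (A p *v nproj M F p X)"
proof -
  have q: "fst (\<psi> p) \<in> carrier_of N" using \<phi>_carrier[OF p] by simp
  have "nconn N F' (\<phi> p) (mderiv N.EB N fst (\<psi> p) (mderiv M N.EB \<psi> p X)) = N.\<Gamma> (\<phi> p) (A p *v nproj M F p X)"
    unfolding N.mderiv_fst_endo_bundle[OF q] mderiv_\<phi>[OF p, symmetric] N.nconn_eq[OF \<phi>_carrier[OF p]]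
      transv_diff(2)[OF p] ..
  then show ?thesis by (simp add: vertical_part_def Let_def)
qed

lemma linear_mderiv_\<psi>: "p \<in> carrier_of M \<Longrightarrow> linear (mderiv M N.EB \<psi> p)"
  using has_derivative_linear[OF has_derivative_\<psi>] .

text \<open>It descends to the quotient by \<open>leafwise_derivative\<close>: for \<open>X\<close>
  tangent to the leaf, the horizontal part, the connection terms and the raw fibre derivative all
  vanish.\<close>

lemma twistor_transv_diff:
  assumes p: "p \<in> carrier_of M"
  shows "twistor_transv_diff M F N F' \<psi> p (nproj M F p X) = (A p *v nproj M F p X,
    vertical_part N F' (\<psi> p) (mderiv M N.EB \<psi> p X))"
proof -
  have q: "fst (\<psi> p) \<in> carrier_of N" using \<phi>_carrier[OF p] by simp
  let ?L = "twistor_nproj N F' (\<psi> p) \<circ> mderiv M N.EB \<psi> p"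
  have L: "?L X = (A p *v nproj M F p X, vertical_part N F' (\<psi> p) (mderiv M N.EB \<psi> p X))" for X
    unfolding comp_apply twistor_nproj_def N.mderiv_fst_endo_bundle[OF q] mderiv_\<phi>[OF p, symmetric]
      transv_diff(2)[OF p] by simp
  note lin = linear_nproj[OF p] linear_mderiv_\<psi>[OF p] N.christoffel_at(2)[OF \<phi>_carrier[OF p]]
  have L': "?L = (\<lambda>X. (A p *v nproj M F p X, snd (mderiv M N.EB \<psi> p X) +
    N.\<Gamma> (\<phi> p) (A p *v nproj M F p X) ** snd (\<psi> p) - snd (\<psi> p) ** N.\<Gamma> (\<phi> p) (A p *v nproj M F p X)))"
    by (rule ext) (simp only: L vertical_part_eq[OF p])
  have "linear ?L" unfolding L'
    by (intro linearI) (simp_all only: linear_add[OF lin(1)] linear_add[OF lin(2)]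
        linear_add[OF lin(3)] linear_cmul[OF lin(1)] linear_cmul[OF lin(2)] linear_cmul[OF lin(3)]
        matrix_vector_right_distrib matrix_vector_mult_scaleR matrix_mult_distrib snd_add snd_scaleR
        linear_cmul[OF linear_matrix_mult_left] linear_cmul[OF linear_matrix_mult_right],
       simp_all add: algebra_simps)
  moreover have "?L X = 0" if "nproj M F p X = 0" for X
    unfolding L vertical_part_eq[OF p] leafwise_derivative(2)[OF p that] that
    using linear_0[OF lin(3)] by (simp add: zero_prod_def linear_0[OF linear_matrix_mult_left] linear_0[OF linear_matrix_mult_right])
  ultimately show ?thesis
    unfolding twistor_transv_diff_def L[symmetric] by (rule on_quotient_eq[OF linear_nproj[OF p]])
qed

abbreviation "A_frame p x \<equiv> nframe_at N F' (\<phi> p) (\<phi> (chart_inv (chart_at M p) x)) ** A (chart_inv (chart_at M p) x) **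
  matrix_inv (nframe_at M F p (chart_inv (chart_at M p) x))"

lemma frame_dom_map:
  assumes p: "p \<in> carrier_of M"
  obtains S where "open S" "snd (chart_at M p) p \<in> S"
    "\<forall>x\<in>S. chart_inv (chart_at M p) x \<in> frame_dom p \<inter> fst (chart_at M p) \<and>
      \<phi> (chart_inv (chart_at M p) x) \<in> N.frame_dom (\<phi> p) \<inter> fst (chart_at N (\<phi> p)) \<and>
      snd (chart_at M p) (chart_inv (chart_at M p) x) = x"
proof -
  note c = smooth_manifold_chart_at[OF smooth(1) p]
  note cn = smooth_manifold_chart_at[OF N.smooth(1) \<phi>_carrier[OF p]]
  define W where "W = frame_dom p \<inter> {z \<in> carrier_of M. \<phi> z \<in> N.frame_dom (\<phi> p) \<inter> fst (chart_at N (\<phi> p))}"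
  have "openin (mtop M) W"
    unfolding W_def
    by (intro openin_Int frame_dom p openin_smooth_map_preimage[OF \<phi>_smooth openin_topspace]
        N.frame_dom \<phi>_carrier smooth_manifold_chart(1)[OF N.smooth(1) cn(1)])
  note op = open_chart_image[OF smooth(1) c(1) this]
  show ?thesis
  proof (rule that[OF op])
    show "snd (chart_at M p) p \<in> snd (chart_at M p) ` (fst (chart_at M p) \<inter> W)"
      using c frame_dom(2)[OF p] p N.frame_dom(2)[OF \<phi>_carrier[OF p]] cn(2) by (auto simp: W_def)
  qed (auto simp: W_def chart_inv_left[OF smooth(1) c(1)])
qed

text \<open>Let \<open>f\<close> be the transverse coordinates on \<open>M\<close> and
  \<open>fN \<circ> k\<close> those of \<open>N\<close> pulled back by \<open>\<phi>\<close>. The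
  chain rule reads \<open>(fN \<circ> k)' = A_frame f'\<close>, so \<open>A_frame\<close> is a
  coefficient matrix between two differentials. Its symmetric derivative is the second fundamental
  form before the Christoffel terms are added.\<close>

lemma has_derivative_A_frame:
  assumes p: "p \<in> carrier_of M"
  obtains A' where "(A_frame p has_derivative A') (at (snd (chart_at M p) p))"
    "\<forall>X Y. A' X *v nproj M F p Y = A' Y *v nproj M F p X"
proof -
  let ?c = "chart_at M p" and ?CN = "chart_at N (\<phi> p)"
  let ?x0 = "snd ?c p"
  note c = smooth_manifold_chart_at[OF smooth(1) p]
  note q = \<phi>_carrier[OF p]
  note cn = smooth_manifold_chart_at[OF N.smooth(1) q]
  obtain S where S: "open S" "?x0 \<in> S" and "\<forall>x\<in>S. chart_inv ?c x \<in> frame_dom p \<inter> fst ?c \<and>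
      \<phi> (chart_inv ?c x) \<in> N.frame_dom (\<phi> p) \<inter> fst ?CN \<and> snd ?c (chart_inv ?c x) = x"
    by (rule frame_dom_map[OF p])
  note Sd = this(3)[rule_format]
  define f where "f = trv p"
  define k where "k = snd ?CN \<circ> \<phi> \<circ> chart_inv ?c"
  define fN where "fN = snd (N.ctr (\<phi> p)) \<circ> fol_map F' (fol_at F' (\<phi> p)) \<circ> chart_inv ?CN"
  define SN where "SN = snd ?CN ` {z \<in> fol_dom F' (fol_at F' (\<phi> p)) \<inter> fst ?CN. fol_map F' (fol_at F' (\<phi> p)) z \<in> fst (N.ctr (\<phi> p))}"
  have sf: "smooth_on S f"
  proof -
    have "smooth_on (snd ?c ` {z \<in> fol_dom F (fol_at F p) \<inter> fst ?c. fol_map F (fol_at F p) z \<in> fst (ctr p)}) f"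
      unfolding f_def by (rule smooth_map_on_smooth[OF fol_map_smooth[OF at_index[OF p]] c(1) ctr(1)[OF p]])
    moreover have "S \<subseteq> snd ?c ` {z \<in> fol_dom F (fol_at F p) \<inter> fst ?c. fol_map F (fol_at F p) z \<in> fst (ctr p)}"
    proof
      fix x assume "x \<in> S"
      from Sd[OF this] show "x \<in> snd ?c ` {z \<in> fol_dom F (fol_at F p) \<inter> fst ?c. fol_map F (fol_at F p) z \<in> fst (ctr p)}"
        unfolding frame_dom_def by (intro image_eqI[of _ _ "chart_inv ?c x"]) auto
    qed
    ultimately show ?thesis unfolding smooth_on_def using Ck_on_subset by blast
  qed
  have sk: "smooth_on S k"
  proof -
    have "smooth_on (snd ?c ` {z \<in> carrier_of M \<inter> fst ?c. \<phi> z \<in> fst ?CN}) k"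
      unfolding k_def by (rule smooth_map_on_smooth[OF \<phi>_smooth c(1) cn(1)])
    moreover have "S \<subseteq> snd ?c ` {z \<in> carrier_of M \<inter> fst ?c. \<phi> z \<in> fst ?CN}"
    proof
      fix x assume "x \<in> S"
      from Sd[OF this] show "x \<in> snd ?c ` {z \<in> carrier_of M \<inter> fst ?c. \<phi> z \<in> fst ?CN}"
        using smooth_manifold_chart(5)[OF smooth(1) c(1)] by (intro image_eqI[of _ _ "chart_inv ?c x"]) auto
    qed
    ultimately show ?thesis unfolding smooth_on_def using Ck_on_subset by blast
  qed
  have sN: "smooth_on SN fN"
    unfolding SN_def fN_def
    by (rule smooth_map_on_smooth[OF N.fol_map_smooth[OF N.at_index[OF q]] cn(1) N.ctr(1)[OF q]])
  have kS: "k ` S \<subseteq> SN"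
  proof (rule image_subsetI)
    fix x assume "x \<in> S"
    from Sd[OF this] show "k x \<in> SN"
      unfolding k_def SN_def N.frame_dom_def by auto
  qed
  note dH = differentiable_deriv_comp[OF sk sN S(1) kS S(2)]
  have df: "frechet_derivative f (at x) v = nframe_at M F p (chart_inv ?c x) *v
      nproj M F (chart_inv ?c x) (from_coord M ?c (chart_inv ?c x) v)" if x: "x \<in> S" for x v
  proof -
    have "(f has_derivative (\<lambda>v. nframe_at M F p (chart_inv ?c x) *v
        nproj M F (chart_inv ?c x) (from_coord M ?c (chart_inv ?c x) v))) (at x)"
      using has_derivative_transverse_coord[OF p _ c(1), of "chart_inv ?c x"] Sd[OF x] by (simp add: f_def)
    from frechet_derivative_at[OF this] show ?thesis by (simp add: fun_eq_iff)
  qed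
  \<comment> \<open>Inserting the inverse frame of \<open>M\<close> times itself turns
    \<open>A\<close> on \<open>Q\<close> into \<open>A_frame\<close> acting on the differential of
    \<open>f\<close>.\<close>
  have fact: "frechet_derivative (fN \<circ> k) (at x) v = A_frame p x *v frechet_derivative f (at x) v" if x: "x \<in> S" for x v
  proof -
    let ?y = "chart_inv ?c x"
    have y: "?y \<in> frame_dom p" "?y \<in> fst ?c" "\<phi> ?y \<in> N.frame_dom (\<phi> p)" "\<phi> ?y \<in> fst ?CN" "snd ?c ?y = x"
      using Sd[OF x] by auto
    have yc: "?y \<in> carrier_of M" using smooth_manifold_chart(5)[OF smooth(1) c(1)] y(2) by blast
    have dk: "(k has_derivative (\<lambda>v. to_coord N ?CN (\<phi> ?y) (mderiv M N \<phi> ?y (from_coord M ?c ?y v)))) (at x)"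
      using has_derivative_mderiv_coord[OF smooth(1) N.smooth(1) \<phi>_mdiff[OF yc] \<phi>_mcont[OF yc] c(1) y(2) cn(1) y(4)]
      unfolding y(5) k_def .
    have kx: "k x = snd ?CN (\<phi> ?y)" by (simp add: k_def)
    have "(fN has_derivative (\<lambda>v. nframe_at N F' (\<phi> p) (\<phi> ?y) *v nproj N F' (\<phi> ?y) (from_coord N ?CN (\<phi> ?y) v))) (at (k x))"
      unfolding kx fN_def by (rule N.has_derivative_transverse_coord[OF q y(3) cn(1) y(4)])
    from diff_chain_at[OF dk this]
    have "((fN \<circ> k) has_derivative (\<lambda>v. nframe_at N F' (\<phi> p) (\<phi> ?y) *v nproj N F' (\<phi> ?y) (from_coord N ?CN (\<phi> ?y)
      (to_coord N ?CN (\<phi> ?y) (mderiv M N \<phi> ?y (from_coord M ?c ?y v)))))) (at x)"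
      by (simp only: o_def)
    moreover have ft: "from_coord N ?CN (\<phi> ?y) (to_coord N ?CN (\<phi> ?y) w) = w" for w
      using to_from_coord(2)[OF N.smooth(1) cn(1) y(4)] by (metis comp_apply id_apply)
    ultimately have "((fN \<circ> k) has_derivative (\<lambda>v. nframe_at N F' (\<phi> p) (\<phi> ?y) *v (A ?y *v nproj M F ?y (from_coord M ?c ?y v)))) (at x)"
      by (simp only: ft transv_diff(2)[OF yc])
    from frechet_derivative_at[OF this]
    have "frechet_derivative (fN \<circ> k) (at x) v =
      nframe_at N F' (\<phi> p) (\<phi> ?y) *v (A ?y *v nproj M F ?y (from_coord M ?c ?y v))" by metis
    also have "\<dots> = (nframe_at N F' (\<phi> p) (\<phi> ?y) ** A ?y ** (matrix_inv (nframe_at M F p ?y) ** nframe_at M F p ?y)) *v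
        nproj M F ?y (from_coord M ?c ?y v)"
      using matrix_inv_right_left[OF invertible_nframe_at[OF p y(1)]] by (simp add: matrix_vector_mul_assoc)
    also have "\<dots> = A_frame p x *v frechet_derivative f (at x) v"
      unfolding df[OF x] matrix_vector_mul_assoc matrix_mul_assoc ..
    finally show ?thesis .
  qed
  have f0: "frechet_derivative f (at ?x0) = nproj M F p"
    unfolding f_def by (rule frechet_derivative_at[symmetric]) (rule has_derivative_trv[OF p])
  show ?thesis
  proof (rule coefficient_derivative_symmetric[where f = f and f' = "\<lambda>x. frechet_derivative f (at x)"
        and H = "fN \<circ> k" and H' = "\<lambda>x. frechet_derivative (fN \<circ> k) (at x)" and A = "A_frame p", OF S])
    show "(f has_derivative frechet_derivative f (at y)) (at y)" if "y \<in> S" for y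
      by (rule frechet_works[OF smooth_on_differentiable[OF sf that]])
    show "(\<lambda>y. frechet_derivative f (at y) w) differentiable (at ?x0)" for w
      by (rule smooth_on_differentiable[OF smooth_on_deriv[OF sf] S(2)])
    show "surj (frechet_derivative f (at ?x0))" unfolding f0 by (rule surj_nproj[OF p])
    show ?thesis if "(A_frame p has_derivative A') (at ?x0)"
      "\<forall>u v. A' u *v frechet_derivative f (at ?x0) v = A' v *v frechet_derivative f (at ?x0) u" for A'
      using \<open>\<And>A'. (A_frame p has_derivative A') (at ?x0) \<Longrightarrow>
        \<forall>X Y. A' X *v nproj M F p Y = A' Y *v nproj M F p X \<Longrightarrow> thesis\<close> that unfolding f0 by blast
  qed (use dH fact in auto)
qed

end

section \<open>Transversely holomorphic maps and vanishing of the tension field\<close>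

locale J_minus_map = foliated_twistor_map M g F N g' F' \<psi> + almost_hermitian_foliation M g F J
  for M :: "('a, 'e::euclidean_space) mfd" and g :: "('a, 'e) metric"
    and F :: "('i, 'a, 't, 'q::finite) foliation" and J :: "'a \<Rightarrow> real^'q^'q"
    and N :: "('b, 'f::euclidean_space) mfd" and g' :: "('b, 'f) metric"
    and F' :: "('j, 'b, 's, 'r::finite) foliation"
    and \<psi> :: "'a \<Rightarrow> 'b \<times> (real^'r^'r)" +
  assumes J_minus_holomorphic: "p \<in> carrier_of M \<Longrightarrow>
    twistor_transv_diff M F N F' \<psi> p (J p *v u) = J_minus (\<psi> p) (twistor_transv_diff M F N F' \<psi> p u)"
    and cosymplectic: "transv_cosymplectic M g F J"
begin

abbreviation "P p \<equiv> snd (\<psi> p)"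

lemma A_J: "p \<in> carrier_of M \<Longrightarrow> A p ** J p = P p ** A p"
proof (rule matrix_eq[THEN iffD2], intro allI)
  fix u assume p: "p \<in> carrier_of M"
  obtain X where X: "u = nproj M F p X" by (rule nproj_obtain[OF p])
  obtain Y where Y: "J p *v u = nproj M F p Y" by (rule nproj_obtain[OF p])
  have "fst (twistor_transv_diff M F N F' \<psi> p (J p *v u)) = P p *v fst (twistor_transv_diff M F N F' \<psi> p u)"
    unfolding J_minus_holomorphic[OF p] by (simp add: J_minus_def split: prod.splits)
  then have "A p *v (J p *v u) = P p *v (A p *v u)"
    unfolding Y unfolding X twistor_transv_diff[OF p] by simp
  then show "(A p ** J p) *v u = (P p ** A p) *v u" by (simp add: matrix_vector_mul_assoc)
qed

lemma P_square: "p \<in> carrier_of M \<Longrightarrow> P p ** P p = - mat 1"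
  using \<psi>_twistor[of p] by (auto simp: twistor_bundle_def)

text \<open>Taken from the bundle chart, so that its derivative is by construction the fibre
  component of the differential of \<open>\<psi>\<close>; the next lemma identifies it with the
  matrix of \<open>P\<close> in the frame.\<close>

abbreviation "P_frame p x \<equiv> snd (snd (chart_at N.EB (\<psi> p)) (\<psi> (chart_inv (chart_at M p) x)))"

lemma P_frame: "P_frame p x = nframe_at N F' (\<phi> p) (\<phi> (chart_inv (chart_at M p) x)) ** P (chart_inv (chart_at M p) x) **
    matrix_inv (nframe_at N F' (\<phi> p) (\<phi> (chart_inv (chart_at M p) x)))"
  by (simp add: N.endo_bundle_simps endo_chart_def nframe_at_def split: prod.splits)

text \<open>The relations \<open>A J = P A\<close> and \<open>P^2 = -1\<close> survive the change of
  frame, because adjacent frame factors cancel. At \<open>p\<close> the frames are the identity, so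
  the product rule gives these identities with the original \<open>A p\<close>, \<open>J p\<close>
  and \<open>P p\<close>.\<close>

lemma frame_derivative_relations:
  assumes p: "p \<in> carrier_of M"
    and A': "(A_frame p has_derivative A') (at (snd (chart_at M p) p))"
    and J': "(J_frame p has_derivative (\<lambda>X. J' (nproj M F p X))) (at (snd (chart_at M p) p))"
  defines "P' \<equiv> \<lambda>X. snd (mderiv M N.EB \<psi> p X)"
  shows "A' X ** J p + A p ** J' (nproj M F p X) = P' X ** A p + P p ** A' X"
    and "P' X ** P p + P p ** P' X = 0"
proof -
  let ?c = "chart_at M p"
  let ?x0 = "snd ?c p"
  note c = smooth_manifold_chart_at[OF smooth(1) p]
  note q = \<phi>_carrier[OF p]
  obtain S where S: "open S" "?x0 \<in> S" and "\<forall>x\<in>S. chart_inv ?c x \<in> frame_dom p \<inter> fst ?c \<and>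
      \<phi> (chart_inv ?c x) \<in> N.frame_dom (\<phi> p) \<inter> fst (chart_at N (\<phi> p)) \<and> snd ?c (chart_inv ?c x) = x"
    by (rule frame_dom_map[OF p])
  note Sd = this(3)[rule_format]
  have iR: "invertible (nframe_at M F p (chart_inv ?c x))"
    and iR': "invertible (nframe_at N F' (\<phi> p) (\<phi> (chart_inv ?c x)))"
    and yc: "chart_inv ?c x \<in> carrier_of M" if "x \<in> S" for x
    using Sd[OF that] invertible_nframe_at[OF p] N.invertible_nframe_at[OF q]
      smooth_manifold_chart(5)[OF smooth(1) c(1)] by blast+
  have px0: "chart_inv ?c ?x0 = p" by (rule chart_inv_left[OF smooth(1) c])
  have at0: "A_frame p ?x0 = A p" "J_frame p ?x0 = J p"
    unfolding px0 nframe_at_self[OF p] N.nframe_at_self[OF q] matrix_inv_mat_1 by simp_all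
  have "P_frame p ?x0 = P p"
    using P_frame[of p ?x0] unfolding px0 N.nframe_at_self[OF q] matrix_inv_mat_1 by simp
  note at0 = at0 this
  have P': "(P_frame p has_derivative P') (at ?x0)"
    using has_derivative_snd[OF has_derivative_\<psi>[OF p]] by (simp add: P'_def o_def)
  have eq1: "A_frame p x ** J_frame p x = P_frame p x ** A_frame p x" if x: "x \<in> S" for x
  proof -
    let ?y = "chart_inv ?c x"
    let ?R = "nframe_at M F p ?y" and ?R' = "nframe_at N F' (\<phi> p) (\<phi> ?y)"
    have "A_frame p x ** J_frame p x = (?R' ** A ?y ** matrix_inv ?R) ** (?R ** (J ?y ** matrix_inv ?R))"
      by (simp only: matrix_mul_assoc)
    also have "\<dots> = ?R' ** (A ?y ** J ?y) ** matrix_inv ?R"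
      unfolding matrix_conjugate_cancel[OF iR[OF x]] by (simp only: matrix_mul_assoc)
    also have "\<dots> = (?R' ** P ?y) ** (A ?y ** matrix_inv ?R)"
      unfolding A_J[OF yc[OF x]] by (simp only: matrix_mul_assoc)
    also have "\<dots> = (?R' ** P ?y ** matrix_inv ?R') ** (?R' ** (A ?y ** matrix_inv ?R))"
      by (rule matrix_conjugate_cancel[OF iR'[OF x], symmetric])
    finally show ?thesis unfolding P_frame by (simp only: matrix_mul_assoc)
  qed
  have "((\<lambda>x. A_frame p x ** J_frame p x) has_derivative
      (\<lambda>X. A_frame p ?x0 ** J' (nproj M F p X) + A' X ** J_frame p ?x0)) (at ?x0)"
    by (rule has_derivative_matrix_mult[OF A' J'])
  moreover have "((\<lambda>x. A_frame p x ** J_frame p x) has_derivative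
      (\<lambda>X. P_frame p ?x0 ** A' X + P' X ** A_frame p ?x0)) (at ?x0)"
    by (rule has_derivative_transform_within_open[OF has_derivative_matrix_mult[OF P' A'] S]) (simp only: eq1)
  ultimately have "(\<lambda>X. A_frame p ?x0 ** J' (nproj M F p X) + A' X ** J_frame p ?x0) =
      (\<lambda>X. P_frame p ?x0 ** A' X + P' X ** A_frame p ?x0)"
    by (rule has_derivative_unique)
  from fun_cong[OF this, of X] show "A' X ** J p + A p ** J' (nproj M F p X) = P' X ** A p + P p ** A' X"
    unfolding at0 by (simp only: add.commute)
  have eq2: "P_frame p x ** P_frame p x = - mat 1" if x: "x \<in> S" for x
  proof -
    let ?y = "chart_inv ?c x"
    let ?R = "nframe_at N F' (\<phi> p) (\<phi> ?y)"
    have "P_frame p x ** P_frame p x = (?R ** P ?y ** matrix_inv ?R) ** (?R ** (P ?y ** matrix_inv ?R))"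
      unfolding P_frame by (simp only: matrix_mul_assoc)
    also have "\<dots> = ?R ** (P ?y ** P ?y) ** matrix_inv ?R"
      unfolding matrix_conjugate_cancel[OF iR'[OF x]] by (simp only: matrix_mul_assoc)
    also have "\<dots> = - mat 1"
      unfolding P_square[OF yc[OF x]] matrix_mult_distrib matrix_mul_rid matrix_inv_right_left[OF iR'[OF x]] ..
    finally show ?thesis .
  qed
  have "((\<lambda>x. P_frame p x ** P_frame p x) has_derivative
      (\<lambda>X. P_frame p ?x0 ** P' X + P' X ** P_frame p ?x0)) (at ?x0)"
    by (rule has_derivative_matrix_mult[OF P' P'])
  moreover have "((\<lambda>x. P_frame p x ** P_frame p x) has_derivative (\<lambda>X. 0)) (at ?x0)"
    by (rule has_derivative_transform_within_open[OF has_derivative_const[of "- mat 1"] S]) (simp only: eq2)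
  ultimately have "(\<lambda>X. P_frame p ?x0 ** P' X + P' X ** P_frame p ?x0) = (\<lambda>X. 0)"
    by (rule has_derivative_unique)
  from fun_cong[OF this, of X] show "P' X ** P p + P p ** P' X = 0"
    unfolding at0 by (simp only: add.commute)
qed

lemma transv_tension_eq_0:
  assumes p: "p \<in> carrier_of M"
  shows "transv_tension M g F N F' \<phi> p = 0"
proof -
  note q = \<phi>_carrier[OF p]
  obtain J' where J': "(J_frame p has_derivative (\<lambda>X. J' (nproj M F p X))) (at (snd (chart_at M p) p))" "linear J'"
    by (rule has_derivative_endo_in_frame[OF p J_foliated])
  obtain A' where A': "(A_frame p has_derivative A') (at (snd (chart_at M p) p))"
    "\<forall>X Y. A' X *v nproj M F p Y = A' Y *v nproj M F p X"
    by (rule has_derivative_A_frame[OF p])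
  define P' where "P' = (\<lambda>X. snd (mderiv M N.EB \<psi> p X))"
  have rel: "A' X ** J p + A p ** J' (nproj M F p X) = P' X ** A p + P p ** A' X" "P' X ** P p + P p ** P' X = 0" for X
    using frame_derivative_relations[OF p A'(1) J'(1), of X] unfolding P'_def by blast+
  have linA': "linear A'" using A'(1) has_derivative_linear by blast
  have linP': "linear P'"
    unfolding P'_def using linear_compose[OF linear_mderiv_\<psi>[OF p] linear_snd] by (simp add: o_def)
  obtain L where L: "linear L" "nproj M F p \<circ> L = id"
    using linear_surjective_right_inverse[OF linear_nproj[OF p] surj_nproj[OF p]] by blast
  have nL: "nproj M F p (L u) = u" for u using L(2) by (metis comp_apply id_apply)
  \<comment> \<open>\<open>A'\<close> takes tangent vectors of \<open>M\<close>, but the second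
    fundamental form must live on \<open>Q\<close>. Symmetry gives this: the right-hand side of
    \<open>A' X (nproj Y) = A' Y (nproj X)\<close> sees \<open>X\<close> only through its class, and
    \<open>nproj\<close> is onto.\<close>
  have A'_nproj: "A' X = A' (L (nproj M F p X))" for X
  proof (rule matrix_eq[THEN iffD2], intro allI)
    fix v
    have "A' X *v nproj M F p (L v) = A' (L v) *v nproj M F p X" using A'(2) by blast
    also have "\<dots> = A' (L v) *v nproj M F p (L (nproj M F p X))" unfolding nL ..
    also have "\<dots> = A' (L (nproj M F p X)) *v nproj M F p (L v)" using A'(2) by blast
    finally show "A' X *v v = A' (L (nproj M F p X)) *v v" unfolding nL .
  qed
  \<comment> \<open>\<open>K\<close>, \<open>B\<close> and \<open>V\<close> are the covariant
    derivatives of \<open>J\<close>, \<open>A\<close> and \<open>P\<close>: frame derivative plus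
    Christoffel terms. \<open>L\<close> picks some lift of a normal vector, not necessarily
    horizontal.\<close>
  define K where "K = (\<lambda>u. J' u + \<Gamma> p u ** J p - J p ** \<Gamma> p u)"
  define B where "B = (\<lambda>u. A' (L u) + N.\<Gamma> (\<phi> p) (A p *v u) ** A p - A p ** \<Gamma> p u)"
  define V where "V = (\<lambda>u. P' (L u) + N.\<Gamma> (\<phi> p) (A p *v u) ** P p - P p ** N.\<Gamma> (\<phi> p) (A p *v u))"
  have div: "K u ** J p = - (J p ** K u)" "linear K"
    "(\<Sum>i\<in>UNIV. \<Sum>j\<in>UNIV. matrix_inv (gram (nmetric F p)) $ i $ j *\<^sub>R (K (axis i 1) *v axis j 1)) = 0" for u
    unfolding K_def
    by (rule cosymplectic_divergence[OF cosymplectic p J'])+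
  note \<Gamma>p = christoffel_at[OF p] and \<Gamma>q = N.christoffel_at[OF q]
  note AJ = A_J[OF p] and P2 = P_square[OF p]
  have nab: "nabla_hom M F N F' \<phi> A p (nlift M g F p u) = B u" for u
  proof -
    have "dir_deriv M p (\<lambda>y. nframe_at N F' (\<phi> p) (\<phi> y) ** A y ** matrix_inv (nframe_at M F p y)) = A'"
      unfolding dir_deriv_def using frechet_derivative_at[OF A'(1)] by (simp add: o_def)
    then show ?thesis
      unfolding nabla_hom_def N.nconn_eq[OF q] nconn_eq[OF p] transv_diff(2)[OF p, symmetric] nproj_nlift[OF p] B_def
      using A'_nproj[of "nlift M g F p u"] by (simp add: nproj_nlift[OF p])
  qed
  have VX: "twistor_transv_diff M F N F' \<psi> p u = (A p *v u, V u)" for u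
    using twistor_transv_diff[OF p, of "L u"] unfolding vertical_part_eq[OF p] nL V_def P'_def .
  have VJ: "V (J p *v u) = - (P p ** V u)" for u
    using J_minus_holomorphic[OF p, of u] unfolding VX by (simp add: J_minus_def split: prod.splits)
  \<comment> \<open>The analogue for \<open>P\<close> of the anticommutation of \<open>K\<close>
    with \<open>J\<close>: it makes \<open>V u\<close> an element of the vertical space at
    \<open>P\<close>, up to skewness.\<close>
  have VP: "V u ** P p = - (P p ** V u)" for u
  proof -
    have "V u ** P p + P p ** V u = (P' (L u) ** P p + P p ** P' (L u)) + N.\<Gamma> (\<phi> p) (A p *v u) ** (P p ** P p)
        - (P p ** P p) ** N.\<Gamma> (\<phi> p) (A p *v u)"
      by (simp add: V_def matrix_mult_distrib matrix_mul_assoc)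
    also have "\<dots> = 0" unfolding rel(2) P2 by (simp add: matrix_mult_distrib)
    finally show ?thesis by (simp add: add_eq_0_iff)
  qed
  \<comment> \<open>The terms \<open>A \<Gamma> J\<close> cancel on the left, the terms
    \<open>P \<Gamma> A\<close> with the symbols of \<open>N\<close> cancel on the right, and the
    remaining Christoffel terms agree by \<open>A J = P A\<close>.\<close>
  have comm: "B u ** J p + A p ** K u = V u ** A p + P p ** B u" for u
  proof -
    have "B u ** J p + A p ** K u = (A' (L u) ** J p + A p ** J' u) + N.\<Gamma> (\<phi> p) (A p *v u) ** (A p ** J p)
        - (A p ** J p) ** \<Gamma> p u"
      by (simp add: B_def K_def matrix_mult_distrib matrix_mul_assoc)
    also have "A' (L u) ** J p + A p ** J' u = P' (L u) ** A p + P p ** A' (L u)"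
      using rel(1)[of "L u"] unfolding nL .
    also have "P' (L u) ** A p + P p ** A' (L u) + N.\<Gamma> (\<phi> p) (A p *v u) ** (A p ** J p) - (A p ** J p) ** \<Gamma> p u =
      V u ** A p + P p ** B u"
      unfolding AJ by (simp add: B_def V_def matrix_mult_distrib matrix_mul_assoc)
    finally show ?thesis .
  qed
  \<comment> \<open>Each of the three summands is symmetric: the frame derivative by
    \<open>has_derivative_A_frame\<close>, and both Christoffel terms because the two model
    connections are torsion-free.\<close>
  have sym: "B u *v v = B v *v u" for u v
  proof -
    have "A' (L u) *v v = A' (L v) *v u"
      using A'(2)[rule_format, of "L u" "L v"] unfolding nL .
    moreover have "N.\<Gamma> (\<phi> p) (A p *v u) *v (A p *v v) = N.\<Gamma> (\<phi> p) (A p *v v) *v (A p *v u)" by (rule \<Gamma>q(1))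
    moreover have "\<Gamma> p u *v v = \<Gamma> p v *v u" by (rule \<Gamma>p(1))
    ultimately show ?thesis
      by (simp add: B_def matrix_vector_mult_add_rdistrib matrix_vector_mult_diff_rdistrib flip: matrix_vector_mul_assoc)
  qed
  note lin_rules = linear_add[OF linA'] linear_add[OF L(1)] linear_add[OF \<Gamma>q(2)] linear_add[OF \<Gamma>p(2)] linear_add[OF linP']
    linear_cmul[OF linA'] linear_cmul[OF L(1)] linear_cmul[OF \<Gamma>q(2)] linear_cmul[OF \<Gamma>p(2)] linear_cmul[OF linP']
    matrix_vector_right_distrib matrix_vector_mult_scaleR matrix_mult_distrib
    linear_cmul[OF linear_matrix_mult_left] linear_cmul[OF linear_matrix_mult_right]
  have linB: "linear B" unfolding B_def
    by (intro linearI) (simp_all only: lin_rules, simp_all add: algebra_simps)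
  have linV: "linear V" unfolding V_def
    by (intro linearI) (simp_all only: lin_rules, simp_all add: algebra_simps)
  have ip: "inner_product (nmetric F p)" by (rule inner_product_nmetric[OF p])
  then have bil: "bilinear (nmetric F p)" by (simp add: inner_product_def)
  define e where "e = (SOME e. orthonormal_frame F p e)"
  have "\<exists>e. orthonormal_frame F p e" unfolding orthonormal_frame_def by (rule inner_product_frame[OF ip])
  then have "orthonormal_frame F p e" unfolding e_def by (rule someI_ex)
  then have e: "nmetric F p (e i) (e j) = (if i = j then 1 else 0)" for i j by (simp add: orthonormal_frame_def)
  have bK: "bilinear (\<lambda>u v. K u *v v)" using bilinear_matrix_family[OF div(2), of "mat 1"] by simp
  have K0: "(\<Sum>a\<in>UNIV. K (e a) *v e a) = 0"
    using frame_trace[OF bil e bK] div(3) by simp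
  have "(\<Sum>a\<in>UNIV. B (e a) *v e a) = 0"
    by (rule tension_core[OF bil e J_isometry[OF p] J_square[OF p] P2 linB linV AJ comm sym VJ VP div(1) K0])
  then show ?thesis unfolding transv_tension_def Let_def e_def[symmetric] nab .
qed

end

theorem theorem5p8:
  fixes M :: "('a, 'e::euclidean_space) mfd" and g :: "('a, 'e) metric"
    and F :: "('i, 'a, 't, 'q::finite) foliation" and J :: "'a \<Rightarrow> real^'q^'q"
    and N :: "('b, 'f::euclidean_space) mfd" and g' :: "('b, 'f) metric"
    and F' :: "('j, 'b, 's, 'r::finite) foliation"
    and \<psi> :: "'a \<Rightarrow> 'b \<times> (real^'r^'r)"
  assumes "transv_almost_hermitian M g F J"
    and "transv_cosymplectic M g F J"
    and "foliated_riemannian N g' F'"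
    and "even CARD('r)"
    and "transv_J_minus_holomorphic M F J N F' \<psi>"
  shows "transv_harmonic M g F N F' (fst \<circ> \<psi>)"
proof -
  interpret J_minus_map M g F J N g' F' \<psi>
    by unfold_locales
      (use assms in \<open>auto simp: transv_almost_hermitian_def transv_J_minus_holomorphic_def\<close>)
  show ?thesis
    unfolding transv_harmonic_def using \<phi>_foliated transv_tension_eq_0 by blast
qed

end
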